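(* Let $p$ be an odd prime number, $k$ a field of characteristic $p$, $C_p$ the cyclic group of order $p$, and $A=kC_p$ its group algebra. Then for each $1\le n\le p-2$, $\widetilde{\mathrm S}_n(A)$ is a free left $A$-module of rank $\dfrac{1}{p}\dbinom{p}{n+1}$.
   Context: $\otimes=\otimes_k$. The group algebra $A=kC_p$ is a Hopf algebra with its usual structure: coproduct $g\mapsto g\otimes g$, counit $g\mapsto 1$ and antipode $g\mapsto g^{-1}$ for $g\in C_p$. For $n\ge0$, $\widetilde{\mathrm T}_n(A)=A^{\otimes n+1}$ is a left $A$-module via the diagonal action, i.e. $g\cdot(a_0\otimes\cdots\otimes a_n)=ga_0\otimes\cdots\otimes ga_n$ for $g\in C_p$, extended linearly. The symmetric group $S_{n+1}$, generated by the transpositions $\sigma_i=(i,i+1)$ for $1\le i\le n$, acts on the right on $\widetilde{\mathrm T}_n(A)$ by $$(a_0\otimes\cdots\otimes a_n)\cdot\sigma_i=-a_0\otimes\cdots\otimes a_{i-2}\otimes a_i\otimes a_{i-1}\otimes a_{i+1}\otimes\cdots\otimes a_n,$$ making it a right $kS_{n+1}$-module. Define $\widetilde{\mathrm S}_n(A)=\widetilde{\mathrm T}_n(A)\otimes_{kS_{n+1}}k$, where $k$ is the trivial left $kS_{n+1}$-module, with left $A$-module structure induced from $\widetilde{\mathrm T}_n(A)$. *)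

theory Defs
  imports
    "HOL-Algebra.Sym_Groups"
    "HOL-Algebra.Free_Abelian_Groups"
    "HOL-Algebra.Multiplicative_Group"
    "HOL-Algebra.IntRing"
    "Jordan_Normal_Form.Missing_VectorSpace"
begin

hide_const (open) Multiset.mult

section \<open>Sums, free modules and quotient modules\<close>

text \<open>Sum of a finitely supported family.\<close>
abbreviation fsupp_sum :: "('a, 'm) ring_scheme \<Rightarrow> ('i \<Rightarrow> 'a) \<Rightarrow> 'i set \<Rightarrow> 'a" where
  "fsupp_sum M f A \<equiv> gfinprod (add_monoid M) f A"

text \<open>The additive order of \<open>\<one>\<close>; by the convention of \<^const>\<open>group.ord\<close> it is 0 if no positive
  multiple of \<open>\<one>\<close> vanishes.\<close>
definition ring_characteristic :: "('a, 'm) ring_scheme \<Rightarrow> nat" where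
  "ring_characteristic R = group.ord (add_monoid R) \<one>\<^bsub>R\<^esub>"

text \<open>Module records extend ring records, so their multiplicative fields have to be filled with
  something; they are irrelevant for modules and are left undefined.\<close>

definition free_module :: "('a, 'm) ring_scheme \<Rightarrow> 'x set \<Rightarrow> ('a, 'x \<Rightarrow> 'a) module" where
  "free_module R S =
    \<lparr>carrier = {f \<in> S \<rightarrow>\<^sub>E carrier R. finite {x \<in> S. f x \<noteq> \<zero>\<^bsub>R\<^esub>}},
     mult = undefined, one = undefined,
     zero = (\<lambda>x\<in>S. \<zero>\<^bsub>R\<^esub>),
     add = (\<lambda>f g. \<lambda>x\<in>S. f x \<oplus>\<^bsub>R\<^esub> g x),
     smult = (\<lambda>c f. \<lambda>x\<in>S. c \<otimes>\<^bsub>R\<^esub> f x)\<rparr>"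

definition basis_elem :: "('a, 'm) ring_scheme \<Rightarrow> 'x set \<Rightarrow> 'x \<Rightarrow> 'x \<Rightarrow> 'a" where
  "basis_elem R S x = (\<lambda>y\<in>S. if y = x then \<one>\<^bsub>R\<^esub> else \<zero>\<^bsub>R\<^esub>)"

text \<open>The linear map from the free module on \<open>S\<close> to \<open>M\<close> that sends the basis element of \<open>x\<close> to
  \<open>\<phi> x\<close>.\<close>
definition linear_ext ::
  "('a, 'b, 'm) module_scheme \<Rightarrow> 'x set \<Rightarrow> ('x \<Rightarrow> 'b) \<Rightarrow> ('x \<Rightarrow> 'a) \<Rightarrow> 'b" where
  "linear_ext M S \<phi> f = fsupp_sum M (\<lambda>x. f x \<odot>\<^bsub>M\<^esub> \<phi> x) S"

text \<open>The map \<open>x + N \<mapsto> \<phi> x + N\<close> induced on \<open>M/N\<close> by an additive map \<open>\<phi>\<close> with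
  \<open>\<phi>(N) \<subseteq> N\<close>.\<close>
definition induced_map ::
  "('b, 'm) ring_scheme \<Rightarrow> 'b set \<Rightarrow> ('b \<Rightarrow> 'b) \<Rightarrow> 'b set \<Rightarrow> 'b set" where
  "induced_map M N \<phi> C = N <+>\<^bsub>M\<^esub> (\<phi> ` C)"

definition quotient_module ::
  "('a, 'b, 'm) module_scheme \<Rightarrow> 'b set \<Rightarrow> ('a, 'b set) module" where
  "quotient_module M N =
    \<lparr>carrier = a_rcosets\<^bsub>M\<^esub> N, mult = undefined, one = undefined,
     zero = N, add = set_add M,
     smult = (\<lambda>c. induced_map M N (\<lambda>x. c \<odot>\<^bsub>M\<^esub> x))\<rparr>"

text \<open>Linear independence and span over a general commutative ring are those of the theory of
  linear combinations in a module.\<close>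
definition free_of_rank ::
  "('a, 'k) ring_scheme \<Rightarrow> ('a, 'b, 'm) module_scheme \<Rightarrow> nat \<Rightarrow> bool" where
  "free_of_rank R M r \<longleftrightarrow>
    module R M \<and>
    (\<exists>B. finite B \<and> card B = r \<and> B \<subseteq> carrier M \<and>
         \<not> LinearCombinations.module.lin_dep R M B \<and>
         LinearCombinations.module.span R M B = carrier M)"


section \<open>Tensor powers over a commutative ring\<close>

text \<open>A pure tensor in the \<open>I\<close>-indexed tensor power of \<open>M\<close> comes from a tuple
  \<open>b \<in> I \<rightarrow>\<^sub>E carrier M\<close>. The tensor power is the free \<open>K\<close>-module on all tuples modulo
  multilinearity.\<close>

abbreviation tuples :: "('b, 'm) ring_scheme \<Rightarrow> 'i set \<Rightarrow> ('i \<Rightarrow> 'b) set" where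
  "tuples M I \<equiv> I \<rightarrow>\<^sub>E carrier M"

abbreviation tuple_module ::
  "('a, 'k) ring_scheme \<Rightarrow> ('b, 'm) ring_scheme \<Rightarrow> 'i set \<Rightarrow> ('a, ('i \<Rightarrow> 'b) \<Rightarrow> 'a) module" where
  "tuple_module K M I \<equiv> free_module K (tuples M I)"

abbreviation tuple_elem ::
  "('a, 'k) ring_scheme \<Rightarrow> ('b, 'm) ring_scheme \<Rightarrow> 'i set \<Rightarrow> ('i \<Rightarrow> 'b) \<Rightarrow> ('i \<Rightarrow> 'b) \<Rightarrow> 'a" where
  "tuple_elem K M I \<equiv> basis_elem K (tuples M I)"

definition multilinear_rels ::
  "('a, 'k) ring_scheme \<Rightarrow> ('a, 'b, 'm) module_scheme \<Rightarrow> 'i set \<Rightarrow> (('i \<Rightarrow> 'b) \<Rightarrow> 'a) set" where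
  "multilinear_rels K M I =
    {tuple_elem K M I (b(i := x \<oplus>\<^bsub>M\<^esub> y))
       \<ominus>\<^bsub>tuple_module K M I\<^esub> (tuple_elem K M I (b(i := x))
         \<oplus>\<^bsub>tuple_module K M I\<^esub> tuple_elem K M I (b(i := y)))
      | b i x y. b \<in> tuples M I \<and> i \<in> I \<and> x \<in> carrier M \<and> y \<in> carrier M}
    \<union> {tuple_elem K M I (b(i := c \<odot>\<^bsub>M\<^esub> x))
       \<ominus>\<^bsub>tuple_module K M I\<^esub> (c \<odot>\<^bsub>tuple_module K M I\<^esub> tuple_elem K M I (b(i := x)))
      | b i c x. b \<in> tuples M I \<and> i \<in> I \<and> c \<in> carrier K \<and> x \<in> carrier M}"

definition tensor_null ::
  "('a, 'k) ring_scheme \<Rightarrow> ('a, 'b, 'm) module_scheme \<Rightarrow> 'i set \<Rightarrow> (('i \<Rightarrow> 'b) \<Rightarrow> 'a) set" where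
  "tensor_null K M I =
    LinearCombinations.module.span K (tuple_module K M I) (multilinear_rels K M I)"

definition tensor_power ::
  "('a, 'k) ring_scheme \<Rightarrow> ('a, 'b, 'm) module_scheme \<Rightarrow> 'i set
    \<Rightarrow> ('a, (('i \<Rightarrow> 'b) \<Rightarrow> 'a) set) module" where
  "tensor_power K M I = quotient_module (tuple_module K M I) (tensor_null K M I)"

definition pure_tensor ::
  "('a, 'k) ring_scheme \<Rightarrow> ('a, 'b, 'm) module_scheme \<Rightarrow> 'i set
    \<Rightarrow> ('i \<Rightarrow> 'b) \<Rightarrow> (('i \<Rightarrow> 'b) \<Rightarrow> 'a) set" where
  "pure_tensor K M I b = tensor_null K M I +>\<^bsub>tuple_module K M I\<^esub> tuple_elem K M I b"

text \<open>The \<open>K\<close>-linear endomorphism of the tensor power given on pure tensors by an assignment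
  \<open>\<phi>\<close> from tuples to linear combinations of tuples that respects multilinearity.\<close>
definition tensor_map ::
  "('a, 'k) ring_scheme \<Rightarrow> ('a, 'b, 'm) module_scheme \<Rightarrow> 'i set
    \<Rightarrow> (('i \<Rightarrow> 'b) \<Rightarrow> (('i \<Rightarrow> 'b) \<Rightarrow> 'a))
    \<Rightarrow> (('i \<Rightarrow> 'b) \<Rightarrow> 'a) set \<Rightarrow> (('i \<Rightarrow> 'b) \<Rightarrow> 'a) set" where
  "tensor_map K M I \<phi> =
    induced_map (tuple_module K M I) (tensor_null K M I)
      (linear_ext (tuple_module K M I) (tuples M I) \<phi>)"


section \<open>Tensor products over a possibly non-commutative ring\<close>

text \<open>\<open>M \<otimes>\<^sub>R N\<close> for a right \<open>R\<close>-module \<open>M\<close>, whose right action is the separate argument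
  \<open>act\<close>, and a left \<open>R\<close>-module \<open>N\<close>: the free abelian group on pairs modulo biadditivity and
  balancedness.\<close>

abbreviation pair_module ::
  "('b, 'm) ring_scheme \<Rightarrow> ('c, 'n) ring_scheme \<Rightarrow> (int, 'b \<times> 'c \<Rightarrow> int) module" where
  "pair_module M N \<equiv> free_module \<Z> (carrier M \<times> carrier N)"

abbreviation pair_elem ::
  "('b, 'm) ring_scheme \<Rightarrow> ('c, 'n) ring_scheme \<Rightarrow> 'b \<Rightarrow> 'c \<Rightarrow> 'b \<times> 'c \<Rightarrow> int" where
  "pair_elem M N x y \<equiv> basis_elem \<Z> (carrier M \<times> carrier N) (x, y)"

definition balanced_rels ::
  "('r, 'k) ring_scheme \<Rightarrow> ('b, 'm) ring_scheme \<Rightarrow> ('b \<Rightarrow> 'r \<Rightarrow> 'b)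
    \<Rightarrow> ('r, 'c, 'n) module_scheme \<Rightarrow> ('b \<times> 'c \<Rightarrow> int) set" where
  "balanced_rels R M act N =
    {pair_elem M N (x \<oplus>\<^bsub>M\<^esub> x') y
       \<ominus>\<^bsub>pair_module M N\<^esub> (pair_elem M N x y \<oplus>\<^bsub>pair_module M N\<^esub> pair_elem M N x' y)
      | x x' y. x \<in> carrier M \<and> x' \<in> carrier M \<and> y \<in> carrier N}
    \<union> {pair_elem M N x (y \<oplus>\<^bsub>N\<^esub> y')
       \<ominus>\<^bsub>pair_module M N\<^esub> (pair_elem M N x y \<oplus>\<^bsub>pair_module M N\<^esub> pair_elem M N x y')
      | x y y'. x \<in> carrier M \<and> y \<in> carrier N \<and> y' \<in> carrier N}
    \<union> {pair_elem M N (act x r) y \<ominus>\<^bsub>pair_module M N\<^esub> pair_elem M N x (r \<odot>\<^bsub>N\<^esub> y)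
      | x r y. x \<in> carrier M \<and> r \<in> carrier R \<and> y \<in> carrier N}"

definition balanced_null ::
  "('r, 'k) ring_scheme \<Rightarrow> ('b, 'm) ring_scheme \<Rightarrow> ('b \<Rightarrow> 'r \<Rightarrow> 'b)
    \<Rightarrow> ('r, 'c, 'n) module_scheme \<Rightarrow> ('b \<times> 'c \<Rightarrow> int) set" where
  "balanced_null R M act N =
    LinearCombinations.module.span \<Z> (pair_module M N) (balanced_rels R M act N)"

text \<open>If \<open>M\<close> is moreover a left \<open>A\<close>-module (the scalar multiplication of the record \<open>M\<close>) and
  the two actions commute, \<open>M \<otimes>\<^sub>R N\<close> is a left \<open>A\<close>-module by \<open>a (x \<otimes> y) = a x \<otimes> y\<close>;
  this replaces the \<open>\<Z>\<close>-scalar multiplication of the quotient.\<close>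
definition balanced_tensor ::
  "('r, 'k) ring_scheme \<Rightarrow> ('a, 'b, 'm) module_scheme \<Rightarrow> ('b \<Rightarrow> 'r \<Rightarrow> 'b)
    \<Rightarrow> ('r, 'c, 'n) module_scheme \<Rightarrow> ('a, ('b \<times> 'c \<Rightarrow> int) set) module" where
  "balanced_tensor R M act N =
    \<lparr>carrier = a_rcosets\<^bsub>pair_module M N\<^esub> (balanced_null R M act N),
     mult = undefined, one = undefined,
     zero = balanced_null R M act N, add = set_add (pair_module M N),
     smult = (\<lambda>a. induced_map (pair_module M N) (balanced_null R M act N)
       (linear_ext (pair_module M N) (carrier M \<times> carrier N)
         (\<lambda>(x, y). pair_elem M N (a \<odot>\<^bsub>M\<^esub> x) y)))\<rparr>"


section \<open>Group algebras\<close>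

text \<open>As a module record, the group algebra carries both its ring structure and its
  \<open>K\<close>-module structure.\<close>
definition group_algebra ::
  "('a, 'k) ring_scheme \<Rightarrow> ('g, 'l) monoid_scheme \<Rightarrow> ('a, 'g \<Rightarrow> 'a) module" where
  "group_algebra K G = (free_module K (carrier G))
    \<lparr>mult := (\<lambda>a b. \<lambda>g\<in>carrier G.
        fsupp_sum K (\<lambda>h. a h \<otimes>\<^bsub>K\<^esub> b (inv\<^bsub>G\<^esub> h \<otimes>\<^bsub>G\<^esub> g)) (carrier G)),
     one := basis_elem K (carrier G) \<one>\<^bsub>G\<^esub>\<rparr>"

text \<open>Linear extension to the group algebra of operators \<open>\<rho> g\<close> on a \<open>K\<close>-module.\<close>
definition group_algebra_act ::
  "('g, 'l) monoid_scheme \<Rightarrow> ('a, 'b, 'm) module_scheme \<Rightarrow> ('g \<Rightarrow> 'b \<Rightarrow> 'b)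
    \<Rightarrow> ('g \<Rightarrow> 'a) \<Rightarrow> 'b \<Rightarrow> 'b" where
  "group_algebra_act G M \<rho> s x = fsupp_sum M (\<lambda>g. s g \<odot>\<^bsub>M\<^esub> \<rho> g x) (carrier G)"

definition trivial_module ::
  "('a, 'k) ring_scheme \<Rightarrow> ('g, 'l) monoid_scheme \<Rightarrow> ('g \<Rightarrow> 'a, 'a) module" where
  "trivial_module K G =
    \<lparr>carrier = carrier K, mult = mult K, one = one K, zero = zero K, add = add K,
     smult = (\<lambda>s c. fsupp_sum K s (carrier G) \<otimes>\<^bsub>K\<^esub> c)\<rparr>"


section \<open>The modules \<open>T\<^sub>n(A)\<close> and \<open>S\<^sub>n(A)\<close> for a group algebra \<open>A\<close>\<close>

text \<open>The tensor factors \<open>a\<^sub>0, \<dots>, a\<^sub>n\<close> are indexed by their positions \<open>1, \<dots>, n + 1\<close>, on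
  which \<^term>\<open>sym_group (n + 1)\<close> acts; so \<open>a\<^sub>j\<close> is entry \<open>j + 1\<close> of the tuple.\<close>

definition diag_op ::
  "('a, 'k) ring_scheme \<Rightarrow> ('g, 'l) monoid_scheme \<Rightarrow> nat \<Rightarrow> 'g
    \<Rightarrow> ((nat \<Rightarrow> 'g \<Rightarrow> 'a) \<Rightarrow> 'a) set \<Rightarrow> ((nat \<Rightarrow> 'g \<Rightarrow> 'a) \<Rightarrow> 'a) set" where
  "diag_op K G n g =
    tensor_map K (group_algebra K G) {1..n + 1}
      (\<lambda>b. tuple_elem K (group_algebra K G) {1..n + 1}
        (\<lambda>i\<in>{1..n + 1}. basis_elem K (carrier G) g \<otimes>\<^bsub>group_algebra K G\<^esub> b i))"

definition T_tilde ::
  "('a, 'k) ring_scheme \<Rightarrow> ('g, 'l) monoid_scheme \<Rightarrow> nat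
    \<Rightarrow> ('g \<Rightarrow> 'a, ((nat \<Rightarrow> 'g \<Rightarrow> 'a) \<Rightarrow> 'a) set) module" where
  "T_tilde K G n =
    \<lparr>carrier = carrier (tensor_power K (group_algebra K G) {1..n + 1}),
     mult = undefined, one = undefined,
     zero = zero (tensor_power K (group_algebra K G) {1..n + 1}),
     add = add (tensor_power K (group_algebra K G) {1..n + 1}),
     smult = group_algebra_act G (tensor_power K (group_algebra K G) {1..n + 1}) (diag_op K G n)\<rparr>"

text \<open>The right action of a permutation is \<open>(b\<^sub>1 \<otimes> \<dots> \<otimes> b\<^sub>n\<^sub>+\<^sub>1) \<cdot> \<pi> = sgn(\<pi>) b\<^sub>\<pi>\<^sub>(\<^sub>1\<^sub>) \<otimes> \<dots> \<otimes> b\<^sub>\<pi>\<^sub>(\<^sub>n\<^sub>+\<^sub>1\<^sub>)\<close>,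
  the unique right action (for the product \<open>\<pi> \<circ> \<tau>\<close> of \<^const>\<open>sym_group\<close>) in which the
  transposition \<open>(i, i+1)\<close> exchanges the entries at positions \<open>i\<close> and \<open>i + 1\<close> and changes
  the sign.\<close>
definition perm_op ::
  "('a, 'k) ring_scheme \<Rightarrow> ('g, 'l) monoid_scheme \<Rightarrow> nat \<Rightarrow> (nat \<Rightarrow> nat)
    \<Rightarrow> ((nat \<Rightarrow> 'g \<Rightarrow> 'a) \<Rightarrow> 'a) set \<Rightarrow> ((nat \<Rightarrow> 'g \<Rightarrow> 'a) \<Rightarrow> 'a) set" where
  "perm_op K G n \<pi> =
    tensor_map K (group_algebra K G) {1..n + 1}
      (\<lambda>b. let e = tuple_elem K (group_algebra K G) {1..n + 1} (\<lambda>i\<in>{1..n + 1}. b (\<pi> i))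
           in if evenperm \<pi> then e else \<ominus>\<^bsub>tuple_module K (group_algebra K G) {1..n + 1}\<^esub> e)"

definition sym_act ::
  "('a, 'k) ring_scheme \<Rightarrow> ('g, 'l) monoid_scheme \<Rightarrow> nat
    \<Rightarrow> ((nat \<Rightarrow> 'g \<Rightarrow> 'a) \<Rightarrow> 'a) set \<Rightarrow> ((nat \<Rightarrow> nat) \<Rightarrow> 'a)
    \<Rightarrow> ((nat \<Rightarrow> 'g \<Rightarrow> 'a) \<Rightarrow> 'a) set" where
  "sym_act K G n t s =
    group_algebra_act (sym_group (n + 1)) (tensor_power K (group_algebra K G) {1..n + 1})
      (perm_op K G n) s t"

definition S_tilde ::
  "('a, 'k) ring_scheme \<Rightarrow> ('g, 'l) monoid_scheme \<Rightarrow> nat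
    \<Rightarrow> ('g \<Rightarrow> 'a, (((nat \<Rightarrow> 'g \<Rightarrow> 'a) \<Rightarrow> 'a) set \<times> 'a \<Rightarrow> int) set) module" where
  "S_tilde K G n =
    balanced_tensor (group_algebra K (sym_group (n + 1))) (T_tilde K G n) (sym_act K G n)
      (trivial_module K (sym_group (n + 1)))"


section \<open>The action of transpositions on pure tensors\<close>

text \<open>The remaining lemmas confirm that \<^const>\<open>perm_op\<close> is well behaved on the quotient and
  that the generating transpositions of the symmetric group act as
  \<open>(a\<^sub>0 \<otimes> \<dots> \<otimes> a\<^sub>n) \<cdot> (i, i+1) = - a\<^sub>0 \<otimes> \<dots> \<otimes> a\<^sub>i \<otimes> a\<^sub>i\<^sub>-\<^sub>1 \<otimes> \<dots> \<otimes> a\<^sub>n\<close>.\<close>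

lemma module_free_module:
  assumes "cring R"
  shows "module R (free_module R S)"
proof -
  interpret cring R by fact
  have fin: "finite {x \<in> S. P x \<or> Q x}" if "finite {x \<in> S. P x}" "finite {x \<in> S. Q x}"
    for P Q
    using finite_UnI[OF that] by (rule rev_finite_subset) auto
  have fin_add: "finite {x \<in> S. f x \<oplus>\<^bsub>R\<^esub> g x \<noteq> \<zero>\<^bsub>R\<^esub>}"
    if "finite {x \<in> S. f x \<noteq> \<zero>\<^bsub>R\<^esub>}" "finite {x \<in> S. g x \<noteq> \<zero>\<^bsub>R\<^esub>}" for f g
    using fin[OF that] by (rule rev_finite_subset) auto
  have fin_smult: "finite {x \<in> S. c \<otimes>\<^bsub>R\<^esub> f x \<noteq> \<zero>\<^bsub>R\<^esub>}"
    if "finite {x \<in> S. f x \<noteq> \<zero>\<^bsub>R\<^esub>}" "c \<in> carrier R" for c f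
    using that(1) by (rule rev_finite_subset) (use that(2) in auto)
  have fin_neg: "finite {x \<in> S. \<ominus>\<^bsub>R\<^esub> f x \<noteq> \<zero>\<^bsub>R\<^esub>}"
    if "finite {x \<in> S. f x \<noteq> \<zero>\<^bsub>R\<^esub>}" for f
    using that by (rule rev_finite_subset) auto
  have grp: "abelian_group (free_module R S)"
  proof (rule abelian_groupI)
    fix f g h
    assume f: "f \<in> carrier (free_module R S)" and g: "g \<in> carrier (free_module R S)"
    show "f \<oplus>\<^bsub>free_module R S\<^esub> g \<in> carrier (free_module R S)"
      using f g fin_add[of f g] by (auto simp: free_module_def PiE_iff cong: conj_cong)
    show "f \<oplus>\<^bsub>free_module R S\<^esub> g = g \<oplus>\<^bsub>free_module R S\<^esub> f"
      using f g by (auto simp: free_module_def a_comm PiE_iff intro!: restrict_ext)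
    assume h: "h \<in> carrier (free_module R S)"
    show "f \<oplus>\<^bsub>free_module R S\<^esub> g \<oplus>\<^bsub>free_module R S\<^esub> h =
        f \<oplus>\<^bsub>free_module R S\<^esub> (g \<oplus>\<^bsub>free_module R S\<^esub> h)"
      using f g h by (auto simp: free_module_def a_assoc PiE_iff intro!: restrict_ext)
  next
    show "\<zero>\<^bsub>free_module R S\<^esub> \<in> carrier (free_module R S)"
      by (auto simp: free_module_def PiE_iff cong: conj_cong)
  next
    fix f assume f: "f \<in> carrier (free_module R S)"
    show "\<zero>\<^bsub>free_module R S\<^esub> \<oplus>\<^bsub>free_module R S\<^esub> f = f"
      using f by (auto simp: free_module_def PiE_iff extensional_def restrict_def)
    show "\<exists>g\<in>carrier (free_module R S). g \<oplus>\<^bsub>free_module R S\<^esub> f = \<zero>\<^bsub>free_module R S\<^esub>"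
      using f fin_neg[of f]
      by (intro bexI[of _ "restrict (\<lambda>x. \<ominus>\<^bsub>R\<^esub> f x) S"])
         (auto simp: free_module_def PiE_iff l_neg restrict_def extensional_def cong: conj_cong)
  qed
  show ?thesis
    by (rule moduleI[OF assms grp])
       (auto simp: free_module_def PiE_iff extensional_def restrict_def fin_smult
          l_distr r_distr m_assoc cong: conj_cong)
qed

lemma basis_elem_closed:
  assumes "cring R"
  shows "basis_elem R S x \<in> carrier (free_module R S)"
proof -
  interpret cring R by fact
  have "finite {y \<in> S. (if y = x then \<one>\<^bsub>R\<^esub> else \<zero>\<^bsub>R\<^esub>) \<noteq> \<zero>\<^bsub>R\<^esub>}"
    by (rule finite_subset[of _ "{x}"]) auto
  then show ?thesis
    by (auto simp: basis_elem_def free_module_def PiE_iff cong: conj_cong)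
qed

context
  fixes R :: "('a, 'k) ring_scheme" and M :: "('a, 'b, 'm) module_scheme"
    and S :: "'x set" and \<phi> :: "'x \<Rightarrow> 'b"
  assumes M: "module R M" and \<phi>: "\<phi> \<in> S \<rightarrow> carrier M"
begin

interpretation module R M by (fact M)

lemma phi_mem: "x \<in> S \<Longrightarrow> \<phi> x \<in> carrier M"
  using \<phi> by auto

lemma linear_ext_closed:
  assumes "f \<in> carrier (free_module R S)"
  shows "linear_ext M S \<phi> f \<in> carrier M"
  using M.add.gfinprod_closed[of "\<lambda>x. f x \<odot>\<^bsub>M\<^esub> \<phi> x" S] assms \<phi>
  by (auto simp: linear_ext_def free_module_def PiE_iff Pi_iff)

lemma linear_ext_add:
  assumes f: "f \<in> carrier (free_module R S)" and g: "g \<in> carrier (free_module R S)"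
  shows "linear_ext M S \<phi> (f \<oplus>\<^bsub>free_module R S\<^esub> g) = linear_ext M S \<phi> f \<oplus>\<^bsub>M\<^esub> linear_ext M S \<phi> g"
proof -
  have fin: "finite {x \<in> S. h x \<odot>\<^bsub>M\<^esub> \<phi> x \<noteq> \<zero>\<^bsub>M\<^esub>}"
    if "h \<in> carrier (free_module R S)" for h
  proof (rule finite_subset)
    show "{x \<in> S. h x \<odot>\<^bsub>M\<^esub> \<phi> x \<noteq> \<zero>\<^bsub>M\<^esub>} \<subseteq> {x \<in> S. h x \<noteq> \<zero>\<^bsub>R\<^esub>}"
      using \<phi> phi_mem by auto
    show "finite {x \<in> S. h x \<noteq> \<zero>\<^bsub>R\<^esub>}"
      using that by (simp add: free_module_def)
  qed
  have car: "h x \<in> carrier R" if "h \<in> carrier (free_module R S)" "x \<in> S" for h x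
    using that by (auto simp: free_module_def)
  have "linear_ext M S \<phi> (f \<oplus>\<^bsub>free_module R S\<^esub> g) =
      gfinprod (add_monoid M) (\<lambda>x. (f x \<odot>\<^bsub>M\<^esub> \<phi> x) \<oplus>\<^bsub>M\<^esub> (g x \<odot>\<^bsub>M\<^esub> \<phi> x)) S"
    unfolding linear_ext_def
    by (rule M.add.gfinprod_cong)
       (use f g \<phi> phi_mem car in \<open>auto simp: smult_l_distr free_module_def simp_implies_def\<close>)
  also have "\<dots> = linear_ext M S \<phi> f \<oplus>\<^bsub>M\<^esub> linear_ext M S \<phi> g"
    unfolding linear_ext_def
    by (subst M.add.gfinprod_distrib[OF fin[OF f] fin[OF g]]) (use f g \<phi> phi_mem car in auto)
  finally show ?thesis .
qed

lemma linear_ext_basis: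
  assumes x: "x \<in> S"
  shows "linear_ext M S \<phi> (basis_elem R S x) = \<phi> x"
proof -
  have "linear_ext M S \<phi> (basis_elem R S x) =
      gfinprod (add_monoid M) (\<lambda>y. basis_elem R S x y \<odot>\<^bsub>M\<^esub> \<phi> y) {x}"
    unfolding linear_ext_def
    by (rule M.add.gfinprod_mono_neutral_cong_right)
       (use \<phi> phi_mem x in \<open>auto simp: basis_elem_def\<close>)
  then show ?thesis
    using \<phi> phi_mem x by (auto simp: basis_elem_def)
qed

lemma linear_ext_smult:
  assumes f: "f \<in> carrier (free_module R S)" and c: "c \<in> carrier R"
  shows "linear_ext M S \<phi> (c \<odot>\<^bsub>free_module R S\<^esub> f) = c \<odot>\<^bsub>M\<^esub> linear_ext M S \<phi> f"
proof -
  define T where "T = {x \<in> S. f x \<noteq> \<zero>\<^bsub>R\<^esub>}"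
  have T: "finite T" "T \<subseteq> S" using f by (auto simp: T_def free_module_def)
  have car: "f x \<in> carrier R" if "x \<in> S" for x
    using that f by (auto simp: free_module_def)
  have 1: "linear_ext M S \<phi> f = (\<Oplus>\<^bsub>M\<^esub>x\<in>T. f x \<odot>\<^bsub>M\<^esub> \<phi> x)"
  proof -
    have "linear_ext M S \<phi> f = gfinprod (add_monoid M) (\<lambda>x. f x \<odot>\<^bsub>M\<^esub> \<phi> x) T"
      unfolding linear_ext_def
      by (rule M.add.gfinprod_mono_neutral_cong_right) (use \<phi> phi_mem car T in \<open>auto simp: T_def\<close>)
    then show ?thesis
      using T \<phi> car by (subst (asm) M.add.gfinprod_eq_finprod) (auto simp: finsum_def)
  qed
  have 2: "linear_ext M S \<phi> (c \<odot>\<^bsub>free_module R S\<^esub> f) = (\<Oplus>\<^bsub>M\<^esub>x\<in>T. c \<odot>\<^bsub>M\<^esub> (f x \<odot>\<^bsub>M\<^esub> \<phi> x))"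
  proof -
    have "linear_ext M S \<phi> (c \<odot>\<^bsub>free_module R S\<^esub> f) =
        gfinprod (add_monoid M) (\<lambda>x. c \<odot>\<^bsub>M\<^esub> (f x \<odot>\<^bsub>M\<^esub> \<phi> x)) T"
      unfolding linear_ext_def
      by (rule M.add.gfinprod_mono_neutral_cong_right)
         (use \<phi> phi_mem car T c in \<open>auto simp: T_def free_module_def smult_assoc1 Pi_iff\<close>)
    then show ?thesis
      using T phi_mem car c
      by (subst (asm) M.add.gfinprod_eq_finprod) (auto simp: finsum_def subset_iff)
  qed
  have "f x \<odot>\<^bsub>M\<^esub> \<phi> x \<in> carrier M" if "x \<in> T" for x
    using that T(2) car phi_mem by blast
  then show ?thesis
    unfolding 1 2 using T c by (intro finsum_smult_ldistr[symmetric]) auto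
qed

lemma linear_ext_hom: "linear_ext M S \<phi> \<in> module_hom R (free_module R S) M"
  by (auto simp: module_hom_def linear_ext_closed linear_ext_add linear_ext_smult)

lemma linear_ext_span:
  assumes D: "D \<subseteq> carrier (free_module R S)"
    and N: "LinearCombinations.submodule R N M"
    and DN: "\<And>r. r \<in> D \<Longrightarrow> linear_ext M S \<phi> r \<in> N"
    and f: "f \<in> LinearCombinations.module.span R (free_module R S) D"
  shows "linear_ext M S \<phi> f \<in> N"
proof -
  interpret F: module R "free_module R S"
    by (rule module_free_module) (rule R.is_cring)
  interpret mod_hom R "free_module R S" M "linear_ext M S \<phi>"
    by unfold_locales (rule linear_ext_hom)
  have "LinearCombinations.submodule R {g \<in> carrier (free_module R S). linear_ext M S \<phi> g \<in> N}
      (free_module R S)"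
    by (rule submodule.intro)
       (use N in \<open>auto simp: F.module_axioms submodule.m_closed submodule.zero_closed
          submodule.smult_closed\<close>)
  then have "LinearCombinations.module.span R (free_module R S) D
      \<subseteq> {g \<in> carrier (free_module R S). linear_ext M S \<phi> g \<in> N}"
    by (rule F.span_is_subset[rotated]) (use D DN in auto)
  with f show ?thesis by auto
qed

end

lemma induced_map_coset:
  assumes "abelian_group M" and N: "additive_subgroup N M"
    and x: "x \<in> carrier M" and h: "\<And>y. y \<in> carrier M \<Longrightarrow> h y \<in> carrier M"
    and add: "\<And>y z. y \<in> carrier M \<Longrightarrow> z \<in> carrier M \<Longrightarrow> h (y \<oplus>\<^bsub>M\<^esub> z) = h y \<oplus>\<^bsub>M\<^esub> h z"
    and hN: "\<And>y. y \<in> N \<Longrightarrow> h y \<in> N"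
  shows "induced_map M N h (N +>\<^bsub>M\<^esub> x) = N +>\<^bsub>M\<^esub> h x"
proof -
  interpret abelian_group M by fact
  interpret N: additive_subgroup N M by fact
  have sub: "y \<in> carrier M" if "y \<in> N" for y using that N.a_subset by auto
  have 1: "u \<oplus>\<^bsub>M\<^esub> h (v \<oplus>\<^bsub>M\<^esub> x) = (u \<oplus>\<^bsub>M\<^esub> h v) \<oplus>\<^bsub>M\<^esub> h x"
    if "u \<in> N" "v \<in> N" for u v
    using that x by (simp add: add h sub a_assoc)
  show ?thesis
  proof (intro equalityI subsetI)
    fix z assume "z \<in> induced_map M N h (N +>\<^bsub>M\<^esub> x)"
    then obtain u v where uv: "u \<in> N" "v \<in> N" "z = u \<oplus>\<^bsub>M\<^esub> h (v \<oplus>\<^bsub>M\<^esub> x)"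
      unfolding induced_map_def set_add_def' a_r_coset_def' by blast
    then show "z \<in> N +>\<^bsub>M\<^esub> h x"
      unfolding a_r_coset_def' using 1[OF uv(1,2)] hN by auto
  next
    fix z assume "z \<in> N +>\<^bsub>M\<^esub> h x"
    then obtain u where u: "u \<in> N" "z = u \<oplus>\<^bsub>M\<^esub> h x"
      unfolding a_r_coset_def' by blast
    then have "z = u \<oplus>\<^bsub>M\<^esub> h (\<zero>\<^bsub>M\<^esub> \<oplus>\<^bsub>M\<^esub> x)" using x by simp
    then show "z \<in> induced_map M N h (N +>\<^bsub>M\<^esub> x)"
      unfolding induced_map_def set_add_def' a_r_coset_def' using u N.zero_closed by blast
  qed
qed

lemma multilinear_rels_closed:
  assumes "cring K"
  shows "multilinear_rels K M I \<subseteq> carrier (tuple_module K M I)"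
proof -
  interpret F: module K "tuple_module K M I"
    by (rule module_free_module) fact
  show ?thesis
    unfolding multilinear_rels_def using assms by (auto intro!: basis_elem_closed)
qed

lemma tensor_null_submodule:
  assumes "cring K"
  shows "LinearCombinations.submodule K (tensor_null K M I) (tuple_module K M I)"
proof -
  interpret F: module K "tuple_module K M I"
    by (rule module_free_module) fact
  show ?thesis
    unfolding tensor_null_def
    by (rule F.span_is_submodule) (rule multilinear_rels_closed[OF assms])
qed

lemma tensor_null_subgroup:
  assumes "cring K"
  shows "additive_subgroup (tensor_null K M I) (tuple_module K M I)"
proof -
  interpret F: module K "tuple_module K M I"
    by (rule module_free_module) fact
  note N = tensor_null_submodule[OF assms, of M I]
  show ?thesis
  proof (rule additive_subgroup.intro, rule F.add.subgroupI)
    fix a assume a: "a \<in> tensor_null K M I"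
    then have "a \<in> carrier (tuple_module K M I)" using submodule.subset[OF N] by auto
    then have "\<ominus>\<^bsub>tuple_module K M I\<^esub> a = (\<ominus>\<^bsub>K\<^esub> \<one>\<^bsub>K\<^esub>) \<odot>\<^bsub>tuple_module K M I\<^esub> a"
      by (simp add: F.smult_minus_1)
    also have "\<dots> \<in> tensor_null K M I"
      using a by (intro submodule.smult_closed[OF N]) auto
    finally show "\<ominus>\<^bsub>tuple_module K M I\<^esub> a \<in> tensor_null K M I" .
  qed (use submodule.subset[OF N] submodule.zero_closed[OF N] submodule.m_closed[OF N] in auto)
qed

lemma tensor_map_pure:
  assumes K: "cring K" and \<phi>: "\<phi> \<in> tuples M I \<rightarrow> carrier (tuple_module K M I)"
    and resp: "\<And>r. r \<in> multilinear_rels K M I \<Longrightarrow>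
      linear_ext (tuple_module K M I) (tuples M I) \<phi> r \<in> tensor_null K M I"
    and b: "b \<in> tuples M I"
  shows "tensor_map K M I \<phi> (pure_tensor K M I b) = tensor_null K M I +>\<^bsub>tuple_module K M I\<^esub> \<phi> b"
proof -
  have F: "module K (tuple_module K M I)" by (rule module_free_module) fact
  then interpret F: module K "tuple_module K M I" .
  have "induced_map (tuple_module K M I) (tensor_null K M I)
      (linear_ext (tuple_module K M I) (tuples M I) \<phi>)
      (tensor_null K M I +>\<^bsub>tuple_module K M I\<^esub> tuple_elem K M I b) =
    tensor_null K M I +>\<^bsub>tuple_module K M I\<^esub>
      linear_ext (tuple_module K M I) (tuples M I) \<phi> (tuple_elem K M I b)"
  proof (rule induced_map_coset[OF F.abelian_group_axioms tensor_null_subgroup[OF K]])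
    fix y assume "y \<in> tensor_null K M I"
    then have "y \<in> LinearCombinations.module.span K (tuple_module K M I) (multilinear_rels K M I)"
      by (simp only: tensor_null_def)
    with resp show "linear_ext (tuple_module K M I) (tuples M I) \<phi> y \<in> tensor_null K M I"
      by (rule linear_ext_span[OF F \<phi> multilinear_rels_closed[OF K] tensor_null_submodule[OF K]])
  next
    show "tuple_elem K M I b \<in> carrier (tuple_module K M I)"
      by (rule basis_elem_closed[OF K])
  next
    fix y assume "y \<in> carrier (tuple_module K M I)"
    then show "linear_ext (tuple_module K M I) (tuples M I) \<phi> y \<in> carrier (tuple_module K M I)"
      by (rule linear_ext_closed[OF F \<phi>])
  next
    fix y z assume "y \<in> carrier (tuple_module K M I)" "z \<in> carrier (tuple_module K M I)"
    then show "linear_ext (tuple_module K M I) (tuples M I) \<phi> (y \<oplus>\<^bsub>tuple_module K M I\<^esub> z) =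
        linear_ext (tuple_module K M I) (tuples M I) \<phi> y
          \<oplus>\<^bsub>tuple_module K M I\<^esub> linear_ext (tuple_module K M I) (tuples M I) \<phi> z"
      by (rule linear_ext_add[OF F \<phi>])
  qed
  then show ?thesis
    using b by (simp add: tensor_map_def pure_tensor_def linear_ext_basis[OF F \<phi>])
qed


lemma module_group_algebra:
  assumes "cring K"
  shows "module K (group_algebra K G)"
proof -
  interpret F: module K "free_module K (carrier G)"
    by (rule module_free_module) fact
  show ?thesis
    by (rule module_criteria[OF assms])
       (use F.M.add.l_inv_ex F.M.a_comm F.M.a_assoc F.smult_assoc1 F.smult_l_distr F.smult_r_distr
        in \<open>auto simp: group_algebra_def\<close>)
qed

lemma perm_op_pure:
  assumes K: "cring K" and \<pi>: "\<pi> permutes {1..n + 1}"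
    and b: "b \<in> tuples (group_algebra K G) {1..n + 1}"
  shows "perm_op K G n \<pi> (pure_tensor K (group_algebra K G) {1..n + 1} b) =
    (let t = pure_tensor K (group_algebra K G) {1..n + 1} (\<lambda>i\<in>{1..n + 1}. b (\<pi> i))
     in if evenperm \<pi> then t
        else \<ominus>\<^bsub>tensor_power K (group_algebra K G) {1..n + 1}\<^esub> t)"
proof -
  define I where "I = {1..n + 1}"
  let ?A = "group_algebra K G" and ?F = "tuple_module K (group_algebra K G) I"
  let ?e = "tuple_elem K ?A I" and ?N = "tensor_null K ?A I"
  define \<phi> where "\<phi> = (\<lambda>b. let e = ?e (\<lambda>i\<in>I. b (\<pi> i)) in if evenperm \<pi> then e else \<ominus>\<^bsub>?F\<^esub> e)"
  interpret A: module K ?A by (rule module_group_algebra) fact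
  have F: "module K ?F" by (rule module_free_module) fact
  then interpret F: module K ?F .
  interpret N: additive_subgroup ?N ?F by (rule tensor_null_subgroup) fact
  have \<pi>I: "\<pi> i \<in> I \<longleftrightarrow> i \<in> I" for i
    unfolding I_def by (rule permutes_in_image[OF \<pi>])
  have e_mem [simp]: "?e c \<in> carrier ?F" for c by (rule basis_elem_closed) fact
  have \<phi>: "\<phi> \<in> tuples ?A I \<rightarrow> carrier ?F"
    by (auto simp: \<phi>_def Let_def)
  interpret h: mod_hom K ?F ?F "linear_ext ?F (tuples ?A I) \<phi>"
    by unfold_locales (rule linear_ext_hom[OF F \<phi>])
  have invI: "inv' \<pi> j \<in> I" if "j \<in> I" for j
    using that unfolding I_def by (simp only: permutes_in_image[OF permutes_inv[OF \<pi>]])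
  have upd: "(\<lambda>i\<in>I. (c(j := x)) (\<pi> i)) = (\<lambda>i\<in>I. c (\<pi> i))(inv' \<pi> j := x)" if "j \<in> I" for c j x
  proof -
    have "\<pi> (inv' \<pi> j) = j" "\<And>i. \<pi> i = j \<longleftrightarrow> i = inv' \<pi> j"
      using permutes_inverses[OF \<pi>] by auto
    then show ?thesis using invI[OF that] by (auto simp: fun_eq_iff restrict_def)
  qed
  have tup: "(\<lambda>i\<in>I. c (\<pi> i)) \<in> tuples ?A I" if "c \<in> tuples ?A I" for c
    using that \<pi>I by (auto simp: PiE_iff)
  have resp: "linear_ext ?F (tuples ?A I) \<phi> r \<in> ?N" if r: "r \<in> multilinear_rels K ?A I" for r
  proof -
    have rels: "multilinear_rels K ?A I \<subseteq> ?N"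
      unfolding tensor_null_def by (rule F.in_own_span) (rule multilinear_rels_closed[OF K])
    have ext: "linear_ext ?F (tuples ?A I) \<phi> (?e (c(j := x))) =
        (if evenperm \<pi> then ?e ((\<lambda>i\<in>I. c (\<pi> i))(inv' \<pi> j := x))
         else \<ominus>\<^bsub>?F\<^esub> ?e ((\<lambda>i\<in>I. c (\<pi> i))(inv' \<pi> j := x)))"
      if "c \<in> tuples ?A I" "j \<in> I" "x \<in> carrier ?A" for c j x
    proof -
      have "c(j := x) \<in> tuples ?A I" using that by (auto simp: PiE_iff extensional_def)
      then show ?thesis
        unfolding linear_ext_basis[OF F \<phi> \<open>c(j := x) \<in> tuples ?A I\<close>]
        by (simp only: \<phi>_def Let_def upd[OF that(2), of c x])
    qed
    have minus1: "\<ominus>\<^bsub>?F\<^esub> u \<ominus>\<^bsub>?F\<^esub> (\<ominus>\<^bsub>?F\<^esub> v \<oplus>\<^bsub>?F\<^esub> \<ominus>\<^bsub>?F\<^esub> w) = \<ominus>\<^bsub>?F\<^esub> (u \<ominus>\<^bsub>?F\<^esub> (v \<oplus>\<^bsub>?F\<^esub> w))"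
      if "u \<in> carrier ?F" "v \<in> carrier ?F" "w \<in> carrier ?F" for u v w
      using that by (simp add: a_minus_def F.M.minus_add)
    have minus2: "\<ominus>\<^bsub>?F\<^esub> u \<ominus>\<^bsub>?F\<^esub> (a \<odot>\<^bsub>?F\<^esub> (\<ominus>\<^bsub>?F\<^esub> v)) = \<ominus>\<^bsub>?F\<^esub> (u \<ominus>\<^bsub>?F\<^esub> (a \<odot>\<^bsub>?F\<^esub> v))"
      if "u \<in> carrier ?F" "v \<in> carrier ?F" "a \<in> carrier K" for u v a
      using that by (simp add: a_minus_def F.M.minus_add F.smult_r_minus)
    from r consider
      (add) c j x y where "c \<in> tuples ?A I" "j \<in> I" "x \<in> carrier ?A" "y \<in> carrier ?A"
        "r = ?e (c(j := x \<oplus>\<^bsub>?A\<^esub> y)) \<ominus>\<^bsub>?F\<^esub> (?e (c(j := x)) \<oplus>\<^bsub>?F\<^esub> ?e (c(j := y)))"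
    | (smult) c j a x where "c \<in> tuples ?A I" "j \<in> I" "a \<in> carrier K" "x \<in> carrier ?A"
        "r = ?e (c(j := a \<odot>\<^bsub>?A\<^esub> x)) \<ominus>\<^bsub>?F\<^esub> (a \<odot>\<^bsub>?F\<^esub> ?e (c(j := x)))"
      unfolding multilinear_rels_def by blast
    then show ?thesis
    proof cases
      case add
      define c' k where "c' = (\<lambda>i\<in>I. c (\<pi> i))" and "k = inv' \<pi> j"
      define r' where
        "r' = ?e (c'(k := x \<oplus>\<^bsub>?A\<^esub> y)) \<ominus>\<^bsub>?F\<^esub> (?e (c'(k := x)) \<oplus>\<^bsub>?F\<^esub> ?e (c'(k := y)))"
      have "r' \<in> multilinear_rels K ?A I"
        unfolding multilinear_rels_def r'_def c'_def k_def
        using tup[OF add(1)] invI[OF add(2)] add(3,4) by blast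
      then have "r' \<in> ?N" using rels by blast
      moreover have "linear_ext ?F (tuples ?A I) \<phi> r = (if evenperm \<pi> then r' else \<ominus>\<^bsub>?F\<^esub> r')"
        unfolding add(5) r'_def c'_def k_def
        by (cases "evenperm \<pi>") (simp_all add: ext[OF add(1,2)] add(3,4) minus1)
      ultimately show ?thesis by auto
    next
      case smult
      define c' k where "c' = (\<lambda>i\<in>I. c (\<pi> i))" and "k = inv' \<pi> j"
      define r' where "r' = ?e (c'(k := a \<odot>\<^bsub>?A\<^esub> x)) \<ominus>\<^bsub>?F\<^esub> (a \<odot>\<^bsub>?F\<^esub> ?e (c'(k := x)))"
      have "r' \<in> multilinear_rels K ?A I"
        unfolding multilinear_rels_def r'_def c'_def k_def
        using tup[OF smult(1)] invI[OF smult(2)] smult(3,4) by blast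
      then have "r' \<in> ?N" using rels by blast
      moreover have "linear_ext ?F (tuples ?A I) \<phi> r = (if evenperm \<pi> then r' else \<ominus>\<^bsub>?F\<^esub> r')"
        unfolding smult(5) r'_def c'_def k_def
        by (cases "evenperm \<pi>") (simp_all add: ext[OF smult(1,2)] smult(3,4) minus2)
      ultimately show ?thesis by auto
    qed
  qed
  have "perm_op K G n \<pi> (pure_tensor K ?A I b) = ?N +>\<^bsub>?F\<^esub> \<phi> b"
    unfolding perm_op_def I_def[symmetric] \<phi>_def[symmetric]
    by (rule tensor_map_pure[OF K \<phi> resp]) (use b in \<open>auto simp: I_def\<close>)
  moreover have "?N +>\<^bsub>?F\<^esub> (\<ominus>\<^bsub>?F\<^esub> u) = \<ominus>\<^bsub>tensor_power K ?A I\<^esub> (?N +>\<^bsub>?F\<^esub> u)"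
    if u: "u \<in> carrier ?F" for u
  proof -
    interpret N: abelian_subgroup ?N ?F
      by (rule abelian_subgroupI3) (rule N.additive_subgroup_axioms, rule F.M.abelian_group_axioms)
    have "\<ominus>\<^bsub>tensor_power K ?A I\<^esub> (?N +>\<^bsub>?F\<^esub> u) = inv\<^bsub>?F A_Mod ?N\<^esub> (?N +>\<^bsub>?F\<^esub> u)"
      by (simp add: a_inv_def m_inv_def tensor_power_def quotient_module_def A_FactGroup_def')
    also have "\<dots> = a_set_inv\<^bsub>?F\<^esub> (?N +>\<^bsub>?F\<^esub> u)"
      by (rule N.a_inv_FactGroup) (use u N.a_subset F.M.a_rcosetsI in \<open>simp add: A_FactGroup_def'\<close>)
    also have "\<dots> = ?N +>\<^bsub>?F\<^esub> (\<ominus>\<^bsub>?F\<^esub> u)"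
      by (rule N.a_rcos_inv[OF u])
    finally show ?thesis ..
  qed
  ultimately show ?thesis
    unfolding I_def[symmetric] by (simp add: \<phi>_def Let_def pure_tensor_def)
qed


lemma perm_op_adjacent_transposition:
  assumes K: "cring K" and i: "1 \<le> i" "i \<le> n"
    and b: "b \<in> tuples (group_algebra K G) {1..n + 1}"
  shows "perm_op K G n (Transposition.transpose i (i + 1))
      (pure_tensor K (group_algebra K G) {1..n + 1} b) =
    \<ominus>\<^bsub>tensor_power K (group_algebra K G) {1..n + 1}\<^esub>
      pure_tensor K (group_algebra K G) {1..n + 1} (b(i := b (i + 1), i + 1 := b i))"
proof -
  have \<pi>: "Transposition.transpose i (i + 1) permutes {1..n + 1}"
    using i by (intro permutes_swap_id) auto
  have "\<not> evenperm (Transposition.transpose i (i + 1))"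
    by (simp add: evenperm_swap)
  moreover have "(\<lambda>j\<in>{1..n + 1}. b (Transposition.transpose i (i + 1) j)) =
      b(i := b (i + 1), i + 1 := b i)"
  proof
    fix j
    have "b j = undefined" if "j \<notin> {1..n + 1}"
      using b that by (auto simp: PiE_iff extensional_def)
    then show "(\<lambda>j\<in>{1..n + 1}. b (Transposition.transpose i (i + 1) j)) j =
        (b(i := b (i + 1), i + 1 := b i)) j"
      using i by (cases "j = i"; cases "j = i + 1"; cases "j \<in> {1..n + 1}") auto
  qed
  ultimately show ?thesis
    unfolding perm_op_pure[OF K \<pi> b] Let_def by (simp only: if_False)
qed

end

theory Submission
  imports Defs
begin

text \<open>
Coinvariants under the signed action identify a tensor with minus the tensor in which two entries
are exchanged. As \<open>2\<close> is invertible in \<open>K\<close>, a tensor with two equal entries vanishes, so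
\<open>S\<^sub>n(A)\<close> is the exterior power \<open>\<Lambda>\<^sup>m(A)\<close> for \<open>m = n + 1\<close>, with one basis vector over \<open>K\<close>, up to
sign, for each \<open>m\<close>-element subset of \<open>C\<close>. The group \<open>C\<close> permutes these vectors, up to sign, by
translating subsets. If translation is free on the subsets, then one vector from each orbit
gives a basis over the group algebra.

Translation is free, and there is even a canonical representative in each orbit. The product of
the elements of \<open>gX\<close> is \<open>g\<^sup>m\<close> times that of \<open>X\<close>, and \<open>g \<mapsto> g\<^sup>m\<close> is a bijection of \<open>C\<close>
because \<open>m\<close> is coprime to the order of \<open>C\<close>. Hence every subset is \<open>gX\<close> for exactly one \<open>g\<close> and
one \<open>X\<close> whose elements have product \<open>1\<close> (\<open>translate_bij_betw\<close>), and counting gives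
\<open>p\<cdot>r = p choose m\<close> for the number \<open>r\<close> of these \<open>X\<close>.

The map \<open>\<theta> x = x \<otimes> 1\<close> from the tensor power onto the coinvariants is surjective and
\<open>A\<close>-linear; the module axioms for \<open>S\<^sub>n(A)\<close> are transported along it. Generation
(\<open>basis_vector_generates\<close>) is then a statement about tensors of group elements: such a tensor is
killed by \<open>\<theta>\<close>, or it is a translate of a rearrangement of a chosen enumeration of some \<open>X\<close> as
above. For independence (\<open>basis_vector_independent\<close>) it suffices to have, for each enumerated
subset, a linear functional on the tensor power that is invariant under the signed action: these
are the functionals that factor through \<open>\<theta>\<close> (\<open>\<theta>_kernel\<close>). They are the \<open>m\<times>m\<close> minors: the minor
for the enumeration \<open>t\<close> takes the value \<open>1\<close> on the tensor of \<open>t\<close> and vanishes on tensors of group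
elements that form a different set.

Throughout, maps out of the quotients come from universal properties: a multilinear map extends
to the tensor power (\<open>tensor_lift\<close>), and a biadditive balanced map is defined on the balanced tensor
product (\<open>biadditive_kills_null\<close>).
\<close>

section \<open>Free modules and quotient modules\<close>

text \<open>The support of an element is finite, so coefficients can be split off one at a time. In this form
the lemma serves as an induction principle: a property that defines a submodule needs to be
checked on basis elements only.\<close>

lemma free_module_generated:
  assumes R: "cring R" and W: "LinearCombinations.submodule R W (free_module R S)"
    and basis: "\<And>x. x \<in> S \<Longrightarrow> basis_elem R S x \<in> W"
  shows "carrier (free_module R S) \<subseteq> W"
proof
  interpret cring R by fact
  interpret F: module R "free_module R S" by (rule module_free_module[OF R])
  fix f assume f: "f \<in> carrier (free_module R S)"
  define T where "T = {x \<in> S. f x \<noteq> \<zero>\<^bsub>R\<^esub>}"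
  have "finite T" using f by (simp add: T_def free_module_def)
  moreover have "{x \<in> S. f x \<noteq> \<zero>\<^bsub>R\<^esub>} \<subseteq> T" by (simp add: T_def)
  ultimately show "f \<in> W" using f
  proof (induction T arbitrary: f rule: finite_induct)
    case empty
    then have "f = \<zero>\<^bsub>free_module R S\<^esub>"
      by (auto simp: free_module_def PiE_iff extensional_def restrict_def fun_eq_iff)
    then show ?case using submodule.zero_closed[OF W] by simp
  next
    case (insert x T)
    show ?case
    proof (cases "x \<in> S")
      case False
      with insert.prems show ?thesis by (intro insert.IH) auto
    next
      case True
      define g where "g = f(x := \<zero>\<^bsub>R\<^esub>)"
      have fS: "f y \<in> carrier R" if "y \<in> S" for y
        using insert.prems(2) that by (auto simp: free_module_def)
      have "finite {y \<in> S. g y \<noteq> \<zero>\<^bsub>R\<^esub>}"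
        using insert.prems(2) by (rule_tac finite_subset[of _ "{y \<in> S. f y \<noteq> \<zero>\<^bsub>R\<^esub>}"])
          (auto simp: free_module_def g_def)
      then have g: "g \<in> carrier (free_module R S)"
        using insert.prems(2) True by (auto simp: free_module_def g_def PiE_iff extensional_def)
      have "g \<in> W"
        by (rule insert.IH[OF _ g]) (use insert.prems(1) in \<open>auto simp: g_def\<close>)
      moreover have "f x \<odot>\<^bsub>free_module R S\<^esub> basis_elem R S x \<in> W"
        using True fS basis by (intro submodule.smult_closed[OF W]) auto
      moreover have "f = g \<oplus>\<^bsub>free_module R S\<^esub> f x \<odot>\<^bsub>free_module R S\<^esub> basis_elem R S x"
      proof
        fix y
        have "f y = undefined" if "y \<notin> S"
          using insert.prems(2) that by (auto simp: free_module_def PiE_iff extensional_def)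
        then show "f y = (g \<oplus>\<^bsub>free_module R S\<^esub> f x \<odot>\<^bsub>free_module R S\<^esub> basis_elem R S x) y"
          using fS True by (cases "y \<in> S") (auto simp: free_module_def g_def basis_elem_def)
      qed
      ultimately show ?thesis using submodule.m_closed[OF W] by metis
    qed
  qed
qed

lemma equalizer_submodule:
  assumes "module R M" "module R N" "f \<in> module_hom R M N" "g \<in> module_hom R M N"
  shows "LinearCombinations.submodule R {x \<in> carrier M. f x = g x} M"
proof -
  interpret f: mod_hom R M N f by (intro mod_hom.intro mod_hom_axioms.intro assms)
  interpret g: mod_hom R M N g by (intro mod_hom.intro mod_hom_axioms.intro assms)
  show ?thesis
    by (rule submodule.intro) (auto simp: assms(1))
qed

lemma module_hom_comp:
  assumes "f \<in> module_hom R L M" "g \<in> module_hom R M N"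
  shows "(\<lambda>x. g (f x)) \<in> module_hom R L N"
  using assms by (auto simp: module_hom_def Pi_iff)

lemma preimage_submodule:
  assumes "module R M" "module R N" "f \<in> module_hom R M N" and W: "LinearCombinations.submodule R W N"
  shows "LinearCombinations.submodule R {x \<in> carrier M. f x \<in> W} M"
proof -
  interpret f: mod_hom R M N f by (intro mod_hom.intro mod_hom_axioms.intro assms)
  show ?thesis
    by (rule submodule.intro)
      (auto simp: assms(1) submodule.m_closed[OF W] submodule.zero_closed[OF W] submodule.smult_closed[OF W])
qed

lemma module_hom_finsum:
  assumes "module R M" "module R N" "f \<in> module_hom R M N" and g: "finite A" "g \<in> A \<rightarrow> carrier M"
  shows "f (\<Oplus>\<^bsub>M\<^esub>x\<in>A. g x) = (\<Oplus>\<^bsub>N\<^esub>x\<in>A. f (g x))"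
proof -
  interpret f: mod_hom R M N f by (intro mod_hom.intro mod_hom_axioms.intro assms)
  show ?thesis
    using g by (induction A rule: finite_induct) (auto simp: Pi_def)
qed

text \<open>Every module axiom is an equation between elements that can be lifted to \<open>M\<close>, including the axioms
of the additive group. So quotients inherit them all at once.\<close>

lemma module_surjective_image:
  assumes M: "module R M" and f: "f ` carrier M = carrier Q" "f \<zero>\<^bsub>M\<^esub> = \<zero>\<^bsub>Q\<^esub>"
    and add: "\<And>x y. x \<in> carrier M \<Longrightarrow> y \<in> carrier M \<Longrightarrow> f (x \<oplus>\<^bsub>M\<^esub> y) = f x \<oplus>\<^bsub>Q\<^esub> f y"
    and smult: "\<And>c x. c \<in> carrier R \<Longrightarrow> x \<in> carrier M \<Longrightarrow> f (c \<odot>\<^bsub>M\<^esub> x) = c \<odot>\<^bsub>Q\<^esub> f x"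
  shows "module R Q"
proof -
  interpret module R M by fact
  have car: "f x \<in> carrier Q" if "x \<in> carrier M" for x
    using that f(1) by blast
  have ex: "\<exists>x \<in> carrier M. v = f x" if "v \<in> carrier Q" for v
    using that f(1) by blast
  note f_add = add[symmetric] and f_smult = smult[symmetric]
  show ?thesis
  proof (rule module_criteria[OF R.is_cring]; (intro allI impI ballI)?; (elim conjE)?)
    show "\<zero>\<^bsub>Q\<^esub> \<in> carrier Q" using car[of "\<zero>\<^bsub>M\<^esub>"] f(2) by simp
  next
    fix v assume "v \<in> carrier Q"
    then obtain x where x: "x \<in> carrier M" "v = f x" using ex by blast
    show "\<exists>w \<in> carrier Q. v \<oplus>\<^bsub>Q\<^esub> w = \<zero>\<^bsub>Q\<^esub>"
      by (rule bexI[of _ "f (\<ominus>\<^bsub>M\<^esub> x)"]) (simp_all add: x f_add car M.r_neg f(2))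
    show "v \<oplus>\<^bsub>Q\<^esub> \<zero>\<^bsub>Q\<^esub> = v" unfolding f(2)[symmetric] by (simp add: x f_add)
    show "\<one>\<^bsub>R\<^esub> \<odot>\<^bsub>Q\<^esub> v = v" by (simp add: x f_smult)
  next
    fix v w assume "v \<in> carrier Q" "w \<in> carrier Q"
    then obtain x y where "x \<in> carrier M" "v = f x" "y \<in> carrier M" "w = f y" using ex by blast
    then show "v \<oplus>\<^bsub>Q\<^esub> w \<in> carrier Q" "v \<oplus>\<^bsub>Q\<^esub> w = w \<oplus>\<^bsub>Q\<^esub> v"
      by (simp_all add: f_add car M.a_comm)
  next
    fix c v assume "c \<in> carrier R" "v \<in> carrier Q"
    then show "c \<odot>\<^bsub>Q\<^esub> v \<in> carrier Q" using ex by (metis smult smult_closed car)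
  next
    fix u v w assume "u \<in> carrier Q" "v \<in> carrier Q" "w \<in> carrier Q"
    then obtain x y z where "x \<in> carrier M" "u = f x" "y \<in> carrier M" "v = f y"
      "z \<in> carrier M" "w = f z" using ex by meson
    then show "u \<oplus>\<^bsub>Q\<^esub> v \<oplus>\<^bsub>Q\<^esub> w = u \<oplus>\<^bsub>Q\<^esub> (v \<oplus>\<^bsub>Q\<^esub> w)"
      by (simp add: f_add M.a_assoc)
  next
    fix a b v assume ab: "a \<in> carrier R" "b \<in> carrier R" and "v \<in> carrier Q"
    then obtain x where x: "x \<in> carrier M" "v = f x" using ex by blast
    show "(a \<otimes>\<^bsub>R\<^esub> b) \<odot>\<^bsub>Q\<^esub> v = a \<odot>\<^bsub>Q\<^esub> (b \<odot>\<^bsub>Q\<^esub> v)"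
      "(a \<oplus>\<^bsub>R\<^esub> b) \<odot>\<^bsub>Q\<^esub> v = a \<odot>\<^bsub>Q\<^esub> v \<oplus>\<^bsub>Q\<^esub> b \<odot>\<^bsub>Q\<^esub> v"
      using ab x by (simp_all add: f_add f_smult smult_assoc1 smult_l_distr)
  next
    fix a v w assume a: "a \<in> carrier R" and "v \<in> carrier Q" "w \<in> carrier Q"
    then obtain x y where "x \<in> carrier M" "v = f x" "y \<in> carrier M" "w = f y" using ex by blast
    then show "a \<odot>\<^bsub>Q\<^esub> (v \<oplus>\<^bsub>Q\<^esub> w) = a \<odot>\<^bsub>Q\<^esub> v \<oplus>\<^bsub>Q\<^esub> a \<odot>\<^bsub>Q\<^esub> w"
      using a by (simp add: f_add f_smult smult_r_distr)
  qed
qed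

context
  fixes R :: "('a, 'k) ring_scheme" and M :: "('a, 'b, 'm) module_scheme" and N :: "'b set"
  assumes M: "module R M" and N: "LinearCombinations.submodule R N M"
begin

interpretation module R M by (fact M)

lemma submodule_imp_abelian_subgroup: "abelian_subgroup N M"
proof (rule abelian_subgroupI3)
  show "additive_subgroup N M"
  proof (rule additive_subgroup.intro, rule M.add.subgroupI)
    fix a assume a: "a \<in> N"
    then have "\<ominus>\<^bsub>M\<^esub> a = (\<ominus>\<^bsub>R\<^esub> \<one>\<^bsub>R\<^esub>) \<odot>\<^bsub>M\<^esub> a"
      using submodule.subset[OF N] by (simp add: smult_minus_1 subset_iff)
    also have "\<dots> \<in> N" using a by (intro submodule.smult_closed[OF N]) auto
    finally show "\<ominus>\<^bsub>M\<^esub> a \<in> N" .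
  qed (use submodule.subset[OF N] submodule.zero_closed[OF N] submodule.m_closed[OF N] in auto)
qed (rule M.abelian_group_axioms)

interpretation N: abelian_subgroup N M by (rule submodule_imp_abelian_subgroup)

lemma induced_map_hom_coset:
  assumes f: "f \<in> module_hom R M M" "\<And>x. x \<in> N \<Longrightarrow> f x \<in> N" and x: "x \<in> carrier M"
  shows "induced_map M N f (N +>\<^bsub>M\<^esub> x) = N +>\<^bsub>M\<^esub> f x"
  by (rule induced_map_coset[OF M.abelian_group_axioms N.additive_subgroup_axioms])
     (use f x in \<open>auto simp: module_hom_def\<close>)

lemma quotient_carrier: "carrier (quotient_module M N) = (\<lambda>x. N +>\<^bsub>M\<^esub> x) ` carrier M"
  by (auto simp: quotient_module_def A_RCOSETS_def')

lemma quotient_zero: "\<zero>\<^bsub>quotient_module M N\<^esub> = N"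
  by (simp add: quotient_module_def)

lemma coset_add:
  "x \<in> carrier M \<Longrightarrow> y \<in> carrier M \<Longrightarrow>
    N +>\<^bsub>M\<^esub> (x \<oplus>\<^bsub>M\<^esub> y) = (N +>\<^bsub>M\<^esub> x) \<oplus>\<^bsub>quotient_module M N\<^esub> (N +>\<^bsub>M\<^esub> y)"
  by (simp add: quotient_module_def N.a_rcos_sum)

lemma coset_smult:
  "c \<in> carrier R \<Longrightarrow> x \<in> carrier M \<Longrightarrow>
    N +>\<^bsub>M\<^esub> (c \<odot>\<^bsub>M\<^esub> x) = c \<odot>\<^bsub>quotient_module M N\<^esub> (N +>\<^bsub>M\<^esub> x)"
  unfolding quotient_module_def
  by (simp, rule induced_map_coset[symmetric, OF M.abelian_group_axioms N.additive_subgroup_axioms])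
     (auto simp: smult_r_distr intro: submodule.smult_closed[OF N])

lemma coset_eq_null_iff: "x \<in> carrier M \<Longrightarrow> N +>\<^bsub>M\<^esub> x = N \<longleftrightarrow> x \<in> N"
  using N.a_rcos_self M.a_coset_join2[OF _ N.a_subgroup] by metis

lemma quotient_is_module: "module R (quotient_module M N)"
  by (rule module_surjective_image[OF M, of "\<lambda>x. N +>\<^bsub>M\<^esub> x"])
     (auto simp: quotient_carrier coset_add coset_smult quotient_zero coset_eq_null_iff
        submodule.zero_closed[OF N])

lemma quotient_projection_hom: "(\<lambda>x. N +>\<^bsub>M\<^esub> x) \<in> module_hom R M (quotient_module M N)"
  by (auto simp: module_hom_def quotient_carrier coset_add coset_smult)

text \<open>Reduces linearity of a map on cosets to linearity of its composite with the projection.\<close>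

lemma quotient_homI:
  assumes f: "f \<in> module_hom R M P" and h: "\<And>x. x \<in> carrier M \<Longrightarrow> h (N +>\<^bsub>M\<^esub> x) = f x"
  shows "h \<in> module_hom R (quotient_module M N) P"
  unfolding module_hom_def
proof (intro CollectI conjI allI impI Pi_I; (elim conjE)?)
  have f': "\<And>x. x \<in> carrier M \<Longrightarrow> f x \<in> carrier P" 
    "\<And>x y. x \<in> carrier M \<Longrightarrow> y \<in> carrier M \<Longrightarrow> f (x \<oplus>\<^bsub>M\<^esub> y) = f x \<oplus>\<^bsub>P\<^esub> f y"
    "\<And>c x. c \<in> carrier R \<Longrightarrow> x \<in> carrier M \<Longrightarrow> f (c \<odot>\<^bsub>M\<^esub> x) = c \<odot>\<^bsub>P\<^esub> f x"
    using f by (auto simp: module_hom_def)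
  fix u v assume "u \<in> carrier (quotient_module M N)"
  then obtain x where x: "x \<in> carrier M" "u = N +>\<^bsub>M\<^esub> x" by (auto simp: quotient_carrier)
  show "h u \<in> carrier P" using x by (simp add: h f')
  show "h (c \<odot>\<^bsub>quotient_module M N\<^esub> u) = c \<odot>\<^bsub>P\<^esub> h u" if "c \<in> carrier R" for c
    unfolding x(2) by (subst coset_smult[symmetric]) (use x that in \<open>auto simp: h f'\<close>)
  assume "v \<in> carrier (quotient_module M N)"
  then obtain y where y: "y \<in> carrier M" "v = N +>\<^bsub>M\<^esub> y" by (auto simp: quotient_carrier)
  show "h (u \<oplus>\<^bsub>quotient_module M N\<^esub> v) = h u \<oplus>\<^bsub>P\<^esub> h v"
    unfolding x(2) y(2) by (subst coset_add[symmetric]) (use x y in \<open>auto simp: h f'\<close>)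
qed

lemma induced_map_hom:
  assumes f: "f \<in> module_hom R M M" "\<And>x. x \<in> N \<Longrightarrow> f x \<in> N"
  shows "induced_map M N f \<in> module_hom R (quotient_module M N) (quotient_module M N)"
  by (rule quotient_homI[OF module_hom_comp[OF f(1) quotient_projection_hom]])
     (rule induced_map_hom_coset[OF f])

lemma quotient_lift:
  assumes P: "module R P" and f: "f \<in> module_hom R M P" and fN: "\<And>x. x \<in> N \<Longrightarrow> f x = \<zero>\<^bsub>P\<^esub>"
  shows "\<exists>h \<in> module_hom R (quotient_module M N) P. \<forall>x \<in> carrier M. h (N +>\<^bsub>M\<^esub> x) = f x"
proof -
  interpret P: module R P by fact
  define h where "h C = the_elem (f ` C)" for C
  have h: "h (N +>\<^bsub>M\<^esub> x) = f x" if x: "x \<in> carrier M" for x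
  proof -
    have "f (u \<oplus>\<^bsub>M\<^esub> x) = f x" if "u \<in> N" for u
      using that x N.a_subset fN funcset_mem[OF module_hom_closed[OF f] x]
      by (subst module_hom_add[OF f]) auto
    then have "(\<lambda>u. f (u \<oplus>\<^bsub>M\<^esub> x)) ` N = (\<lambda>u. f x) ` N" by (rule image_cong[OF refl])
    moreover have "f ` (N +>\<^bsub>M\<^esub> x) = (\<lambda>u. f (u \<oplus>\<^bsub>M\<^esub> x)) ` N"
      unfolding a_r_coset_def' by auto
    moreover have "N \<noteq> {}" using N.zero_closed by blast
    ultimately have "f ` (N +>\<^bsub>M\<^esub> x) = {f x}" by (simp add: image_constant_conv)
    then show ?thesis by (simp add: h_def)
  qed
  from quotient_homI[OF f h] h show ?thesis by blast
qed

end

section \<open>Representations and group algebras\<close>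

text \<open>The signed permutations act from the right, so they represent the opposite of the symmetric group.
This locale collects the rules that they share with representations: the linear ones.\<close>
locale linear_operator_family = module K M
  for K :: "('a, 'k) ring_scheme" and M :: "('a, 'b, 'm) module_scheme" +
  fixes G :: "('g, 'l) monoid_scheme" and \<rho> :: "'g \<Rightarrow> 'b \<Rightarrow> 'b"
  assumes finite_group: "finite (carrier G)"
    and hom: "g \<in> carrier G \<Longrightarrow> \<rho> g \<in> module_hom K M M"
begin

lemma rho_closed [simp]: "g \<in> carrier G \<Longrightarrow> x \<in> carrier M \<Longrightarrow> \<rho> g x \<in> carrier M"
  using module_hom_closed[OF hom] by blast

lemma rho_add [simp]: "g \<in> carrier G \<Longrightarrow> x \<in> carrier M \<Longrightarrow> y \<in> carrier M \<Longrightarrow>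
    \<rho> g (x \<oplus>\<^bsub>M\<^esub> y) = \<rho> g x \<oplus>\<^bsub>M\<^esub> \<rho> g y"
  by (rule module_hom_add[OF hom])

lemma rho_smult [simp]: "g \<in> carrier G \<Longrightarrow> c \<in> carrier K \<Longrightarrow> x \<in> carrier M \<Longrightarrow>
    \<rho> g (c \<odot>\<^bsub>M\<^esub> x) = c \<odot>\<^bsub>M\<^esub> \<rho> g x"
  by (rule module_hom_smult[OF hom])

abbreviation act :: "('g \<Rightarrow> 'a) \<Rightarrow> 'b \<Rightarrow> 'b" where
  "act \<equiv> group_algebra_act G M \<rho>"

lemma coeff_closed: "a \<in> carrier (group_algebra K G) \<Longrightarrow> g \<in> carrier G \<Longrightarrow> a g \<in> carrier K"
  by (auto simp: group_algebra_def free_module_def)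

lemma act_eq_finsum:
  assumes "a \<in> carrier (group_algebra K G)" "x \<in> carrier M"
  shows "act a x = (\<Oplus>\<^bsub>M\<^esub>g\<in>carrier G. a g \<odot>\<^bsub>M\<^esub> \<rho> g x)"
  unfolding group_algebra_act_def
  by (rule M.add.gfinprod_eq_finprod[OF finite_group]) (use assms in \<open>auto simp: coeff_closed\<close>)

lemma act_closed: "a \<in> carrier (group_algebra K G) \<Longrightarrow> x \<in> carrier M \<Longrightarrow> act a x \<in> carrier M"
  by (auto simp: act_eq_finsum coeff_closed)

lemma group_algebra_add:
  "g \<in> carrier G \<Longrightarrow> (a \<oplus>\<^bsub>group_algebra K G\<^esub> b) g = a g \<oplus>\<^bsub>K\<^esub> b g"
  by (simp add: group_algebra_def free_module_def)

lemma group_algebra_add_closed: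
  "a \<in> carrier (group_algebra K G) \<Longrightarrow> b \<in> carrier (group_algebra K G) \<Longrightarrow>
    a \<oplus>\<^bsub>group_algebra K G\<^esub> b \<in> carrier (group_algebra K G)"
  by (auto simp: group_algebra_def free_module_def PiE_iff finite_group)

lemma act_add_left:
  assumes "a \<in> carrier (group_algebra K G)" "b \<in> carrier (group_algebra K G)" "x \<in> carrier M"
  shows "act (a \<oplus>\<^bsub>group_algebra K G\<^esub> b) x = act a x \<oplus>\<^bsub>M\<^esub> act b x"
proof -
  have "act (a \<oplus>\<^bsub>group_algebra K G\<^esub> b) x =
      (\<Oplus>\<^bsub>M\<^esub>g\<in>carrier G. a g \<odot>\<^bsub>M\<^esub> \<rho> g x \<oplus>\<^bsub>M\<^esub> b g \<odot>\<^bsub>M\<^esub> \<rho> g x)"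
    unfolding act_eq_finsum[OF group_algebra_add_closed[OF assms(1,2)] assms(3)]
    by (rule M.finsum_cong') (use assms in \<open>auto simp: group_algebra_add coeff_closed smult_l_distr\<close>)
  also have "\<dots> = act a x \<oplus>\<^bsub>M\<^esub> act b x"
    using assms by (subst M.finsum_addf) (auto simp: act_eq_finsum coeff_closed)
  finally show ?thesis .
qed

lemma act_hom:
  assumes "a \<in> carrier (group_algebra K G)"
  shows "act a \<in> module_hom K M M"
  unfolding module_hom_def
proof (intro CollectI conjI Pi_I allI impI; (elim conjE)?)
  fix x y assume x: "x \<in> carrier M" and y: "y \<in> carrier M"
  show "act a (x \<oplus>\<^bsub>M\<^esub> y) = act a x \<oplus>\<^bsub>M\<^esub> act a y"
  proof -
    have "act a (x \<oplus>\<^bsub>M\<^esub> y) = (\<Oplus>\<^bsub>M\<^esub>g\<in>carrier G. a g \<odot>\<^bsub>M\<^esub> \<rho> g x \<oplus>\<^bsub>M\<^esub> a g \<odot>\<^bsub>M\<^esub> \<rho> g y)"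
      unfolding act_eq_finsum[OF assms M.a_closed[OF x y]]
      by (rule M.finsum_cong') (use assms x y in \<open>auto simp: coeff_closed smult_r_distr\<close>)
    also have "\<dots> = act a x \<oplus>\<^bsub>M\<^esub> act a y"
      using assms x y by (subst M.finsum_addf) (auto simp: act_eq_finsum coeff_closed)
    finally show ?thesis .
  qed
next
  fix c x assume c: "c \<in> carrier K" and x: "x \<in> carrier M"
  have "act a (c \<odot>\<^bsub>M\<^esub> x) = (\<Oplus>\<^bsub>M\<^esub>g\<in>carrier G. c \<odot>\<^bsub>M\<^esub> (a g \<odot>\<^bsub>M\<^esub> \<rho> g x))"
    unfolding act_eq_finsum[OF assms smult_closed[OF c x]]
    by (rule M.finsum_cong') (use assms c x in \<open>auto simp: coeff_closed smult_assoc1[symmetric] R.m_comm\<close>)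
  also have "\<dots> = c \<odot>\<^bsub>M\<^esub> act a x"
    unfolding act_eq_finsum[OF assms x]
    by (rule finsum_smult_ldistr[symmetric]) (use assms c x finite_group in \<open>auto simp: coeff_closed\<close>)
  finally show "act a (c \<odot>\<^bsub>M\<^esub> x) = c \<odot>\<^bsub>M\<^esub> act a x" .
qed (use assms act_closed in auto)

lemma act_basis:
  assumes "g \<in> carrier G" "x \<in> carrier M"
  shows "act (basis_elem K (carrier G) g) x = \<rho> g x"
proof -
  have b: "basis_elem K (carrier G) g \<in> carrier (group_algebra K G)"
    using basis_elem_closed[OF R.is_cring] by (simp add: group_algebra_def)
  have "act (basis_elem K (carrier G) g) x =
      (\<Oplus>\<^bsub>M\<^esub>h\<in>carrier G. if g = h then \<rho> h x else \<zero>\<^bsub>M\<^esub>)"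
    unfolding act_eq_finsum[OF b assms(2)]
    by (rule M.finsum_cong') (use assms in \<open>auto simp: basis_elem_def\<close>)
  then show ?thesis
    using assms M.finsum_singleton[OF assms(1) finite_group, of "\<lambda>h. \<rho> h x"] by auto
qed

text \<open>A linear map sees the action of the group algebra only through the operators of the group
elements. This yields equivariance of commuting maps and, later, the behaviour of invariant
functionals.\<close>

lemma hom_act:
  assumes N: "module K N" and f: "f \<in> module_hom K M N"
    and a: "a \<in> carrier (group_algebra K G)" and x: "x \<in> carrier M"
  shows "f (act a x) = (\<Oplus>\<^bsub>N\<^esub>g\<in>carrier G. a g \<odot>\<^bsub>N\<^esub> f (\<rho> g x))"
proof -
  interpret N: module K N by fact
  have fc: "f y \<in> carrier N" if "y \<in> carrier M" for y
    using module_hom_closed[OF f] that by blast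
  have "f (act a x) = (\<Oplus>\<^bsub>N\<^esub>g\<in>carrier G. f (a g \<odot>\<^bsub>M\<^esub> \<rho> g x))"
    unfolding act_eq_finsum[OF a x]
    by (rule module_hom_finsum[OF module_axioms N f finite_group]) (use x coeff_closed[OF a] in auto)
  also have "\<dots> = (\<Oplus>\<^bsub>N\<^esub>g\<in>carrier G. a g \<odot>\<^bsub>N\<^esub> f (\<rho> g x))"
    by (rule N.M.finsum_cong') (use x coeff_closed[OF a] fc in \<open>auto simp: module_hom_smult[OF f]\<close>)
  finally show ?thesis .
qed

lemma commuting_hom_act:
  assumes f: "f \<in> module_hom K M M" and a: "a \<in> carrier (group_algebra K G)" and x: "x \<in> carrier M"
    and comm: "\<And>g. g \<in> carrier G \<Longrightarrow> f (\<rho> g x) = \<rho> g (f x)"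
  shows "f (act a x) = act a (f x)"
proof -
  have fx: "f x \<in> carrier M" using module_hom_closed[OF f] x by blast
  show ?thesis
    unfolding hom_act[OF module_axioms f a x] act_eq_finsum[OF a fx]
    by (rule M.finsum_cong') (use fx coeff_closed[OF a] in \<open>auto simp: comm\<close>)
qed

lemma act_smult_left:
  assumes c: "c \<in> carrier K" and a: "a \<in> carrier (group_algebra K G)" and x: "x \<in> carrier M"
  shows "act (c \<odot>\<^bsub>group_algebra K G\<^esub> a) x = c \<odot>\<^bsub>M\<^esub> act a x"
proof -
  interpret A: module K "group_algebra K G" by (rule module_group_algebra) (rule R.is_cring)
  have "act (c \<odot>\<^bsub>group_algebra K G\<^esub> a) x = (\<Oplus>\<^bsub>M\<^esub>g\<in>carrier G. c \<odot>\<^bsub>M\<^esub> (a g \<odot>\<^bsub>M\<^esub> \<rho> g x))"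
    unfolding act_eq_finsum[OF A.smult_closed[OF c a] x]
    by (rule M.finsum_cong')
       (use c x coeff_closed[OF a] in \<open>auto simp: group_algebra_def free_module_def smult_assoc1\<close>)
  also have "\<dots> = c \<odot>\<^bsub>M\<^esub> act a x"
    unfolding act_eq_finsum[OF a x]
    by (rule finsum_smult_ldistr[symmetric]) (use c x coeff_closed[OF a] finite_group in auto)
  finally show ?thesis .
qed

end

locale finite_group_representation = linear_operator_family K M G \<rho> + G: group G
  for K :: "('a, 'k) ring_scheme" and M :: "('a, 'b, 'm) module_scheme"
    and G :: "('g, 'l) monoid_scheme" and \<rho> :: "'g \<Rightarrow> 'b \<Rightarrow> 'b" +
  assumes act_one: "x \<in> carrier M \<Longrightarrow> \<rho> \<one>\<^bsub>G\<^esub> x = x"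
    and act_mult: "g \<in> carrier G \<Longrightarrow> h \<in> carrier G \<Longrightarrow> x \<in> carrier M
      \<Longrightarrow> \<rho> (g \<otimes>\<^bsub>G\<^esub> h) x = \<rho> g (\<rho> h x)"
begin

lemma group_algebra_mult:
  assumes "a \<in> carrier (group_algebra K G)" "b \<in> carrier (group_algebra K G)" "g \<in> carrier G"
  shows "(a \<otimes>\<^bsub>group_algebra K G\<^esub> b) g =
    (\<Oplus>\<^bsub>K\<^esub>h\<in>carrier G. a h \<otimes>\<^bsub>K\<^esub> b (inv\<^bsub>G\<^esub> h \<otimes>\<^bsub>G\<^esub> g))"
proof -
  have "(\<lambda>h. a h \<otimes>\<^bsub>K\<^esub> b (inv\<^bsub>G\<^esub> h \<otimes>\<^bsub>G\<^esub> g)) \<in> carrier G \<rightarrow> carrier K"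
    using assms by (auto simp: coeff_closed)
  with assms show ?thesis
    using R.add.gfinprod_eq_finprod[OF finite_group] by (simp add: group_algebra_def finsum_def)
qed

lemma group_algebra_mult_closed:
  assumes "a \<in> carrier (group_algebra K G)" "b \<in> carrier (group_algebra K G)"
  shows "a \<otimes>\<^bsub>group_algebra K G\<^esub> b \<in> carrier (group_algebra K G)"
proof -
  have "(a \<otimes>\<^bsub>group_algebra K G\<^esub> b) g \<in> carrier K" if "g \<in> carrier G" for g
    unfolding group_algebra_mult[OF assms that] by (rule R.finsum_closed) (use assms that in \<open>auto simp: coeff_closed\<close>)
  then show ?thesis
    by (auto simp: group_algebra_def free_module_def PiE_iff finite_group)
qed

text \<open>Exchange the two summations in the convolution and substitute \<open>g = hk\<close>.\<close>

lemma act_group_algebra_mult: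
  assumes a: "a \<in> carrier (group_algebra K G)" and b: "b \<in> carrier (group_algebra K G)"
    and x: "x \<in> carrier M"
  shows "act (a \<otimes>\<^bsub>group_algebra K G\<^esub> b) x = act a (act b x)"
proof -
  let ?C = "carrier G"
  note [simp] = coeff_closed[OF a] coeff_closed[OF b] x
  have "act (a \<otimes>\<^bsub>group_algebra K G\<^esub> b) x =
      (\<Oplus>\<^bsub>M\<^esub>g\<in>?C. \<Oplus>\<^bsub>M\<^esub>h\<in>?C. (a h \<otimes>\<^bsub>K\<^esub> b (inv\<^bsub>G\<^esub> h \<otimes>\<^bsub>G\<^esub> g)) \<odot>\<^bsub>M\<^esub> \<rho> g x)"
    unfolding act_eq_finsum[OF group_algebra_mult_closed[OF a b] x]
  proof (rule M.finsum_cong'[OF refl])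
    fix g assume g: "g \<in> ?C"
    show "(a \<otimes>\<^bsub>group_algebra K G\<^esub> b) g \<odot>\<^bsub>M\<^esub> \<rho> g x =
        (\<Oplus>\<^bsub>M\<^esub>h\<in>?C. (a h \<otimes>\<^bsub>K\<^esub> b (inv\<^bsub>G\<^esub> h \<otimes>\<^bsub>G\<^esub> g)) \<odot>\<^bsub>M\<^esub> \<rho> g x)"
      unfolding group_algebra_mult[OF a b g]
      by (rule finsum_smult_r) (use g finite_group in auto)
  qed auto
  also have "\<dots> = (\<Oplus>\<^bsub>M\<^esub>h\<in>?C. \<Oplus>\<^bsub>M\<^esub>g\<in>?C. (a h \<otimes>\<^bsub>K\<^esub> b (inv\<^bsub>G\<^esub> h \<otimes>\<^bsub>G\<^esub> g)) \<odot>\<^bsub>M\<^esub> \<rho> g x)"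
    by (rule M.add.finprod_finprod_swap[folded finsum_def]) (auto simp: finite_group)
  also have "\<dots> = (\<Oplus>\<^bsub>M\<^esub>h\<in>?C. a h \<odot>\<^bsub>M\<^esub> \<rho> h (act b x))"
  proof (rule M.finsum_cong'[OF refl])
    fix h assume h: "h \<in> ?C"
    have "(\<Oplus>\<^bsub>M\<^esub>g\<in>?C. (a h \<otimes>\<^bsub>K\<^esub> b (inv\<^bsub>G\<^esub> h \<otimes>\<^bsub>G\<^esub> g)) \<odot>\<^bsub>M\<^esub> \<rho> g x) =
        (\<Oplus>\<^bsub>M\<^esub>k\<in>?C. a h \<odot>\<^bsub>M\<^esub> \<rho> h (b k \<odot>\<^bsub>M\<^esub> \<rho> k x))"
      by (rule M.finsum_reindex_bij_witness[where i = "\<lambda>k. h \<otimes>\<^bsub>G\<^esub> k" and j = "\<lambda>g. inv\<^bsub>G\<^esub> h \<otimes>\<^bsub>G\<^esub> g"])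
        (use h in \<open>auto simp: G.m_assoc[symmetric] smult_assoc1 act_mult[symmetric]\<close>)
    also have "\<dots> = a h \<odot>\<^bsub>M\<^esub> (\<Oplus>\<^bsub>M\<^esub>k\<in>?C. \<rho> h (b k \<odot>\<^bsub>M\<^esub> \<rho> k x))"
      by (rule finsum_smult_ldistr[symmetric]) (use h finite_group in auto)
    also have "(\<Oplus>\<^bsub>M\<^esub>k\<in>?C. \<rho> h (b k \<odot>\<^bsub>M\<^esub> \<rho> k x)) = \<rho> h (act b x)"
      unfolding act_eq_finsum[OF b x]
      by (rule module_hom_finsum[OF module_axioms module_axioms hom[OF h] finite_group, symmetric]) auto
    finally show "(\<Oplus>\<^bsub>M\<^esub>g\<in>?C. (a h \<otimes>\<^bsub>K\<^esub> b (inv\<^bsub>G\<^esub> h \<otimes>\<^bsub>G\<^esub> g)) \<odot>\<^bsub>M\<^esub> \<rho> g x) =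
      a h \<odot>\<^bsub>M\<^esub> \<rho> h (act b x)" .
  qed (use b act_closed in auto)
  also have "\<dots> = act a (act b x)"
    by (rule act_eq_finsum[symmetric]) (use a b act_closed in auto)
  finally show ?thesis .
qed

end

lemma free_module_finsum_apply:
  assumes "cring K" "finite A" "f \<in> A \<rightarrow> carrier (free_module K S)" "x \<in> S"
  shows "(\<Oplus>\<^bsub>free_module K S\<^esub>i\<in>A. f i) x = (\<Oplus>\<^bsub>K\<^esub>i\<in>A. f i x)"
proof -
  interpret cring K by fact
  interpret F: module K "free_module K S" by (rule module_free_module) fact
  show ?thesis
    using assms(2,3)
  proof (induction A rule: finite_induct)
    case empty
    show ?case
      unfolding F.M.finsum_empty finsum_empty using assms(4) by (simp add: free_module_def)
  next
    case (insert i A)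
    have "f j x \<in> carrier K" if "j \<in> insert i A" for j
      using insert.prems that assms(4) by (auto simp: free_module_def Pi_def PiE_def)
    then have "(\<Oplus>\<^bsub>K\<^esub>i\<in>insert i A. f i x) = f i x \<oplus>\<^bsub>K\<^esub> (\<Oplus>\<^bsub>K\<^esub>i\<in>A. f i x)"
      using insert.hyps by (subst finsum_insert) auto
    moreover have "(\<Oplus>\<^bsub>free_module K S\<^esub>i\<in>insert i A. f i) x = f i x \<oplus>\<^bsub>K\<^esub> (\<Oplus>\<^bsub>free_module K S\<^esub>i\<in>A. f i) x"
      using insert.hyps insert.prems assms(4)
      by (subst F.M.finsum_insert) (auto simp: free_module_def Pi_def)
    ultimately show ?case using insert by (auto simp: Pi_def)
  qed
qed

text \<open>The convolution of the group algebra is the action of the group algebra on this representation,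
so associativity, distributivity and the unit law are instances of the rules for representations.\<close>

lemma regular_representation:
  assumes "cring K" "group G" "finite (carrier G)"
  shows "finite_group_representation K (free_module K (carrier G)) G
    (\<lambda>g f. \<lambda>x\<in>carrier G. f (inv\<^bsub>G\<^esub> g \<otimes>\<^bsub>G\<^esub> x))"
proof -
  interpret cring K by fact
  interpret G: group G by fact
  interpret F: module K "free_module K (carrier G)" by (rule module_free_module) fact
  show ?thesis
  proof (unfold_locales, goal_cases)
    case (2 g)
    then show ?case
      by (auto simp: module_hom_def free_module_def PiE_iff assms(3) fun_eq_iff restrict_def extensional_def)
  next
    case (4 g h x)
    then show ?case
      by (auto simp: fun_eq_iff restrict_def G.inv_mult_group G.m_assoc)
  qed (use assms in \<open>auto simp: free_module_def PiE_iff extensional_def restrict_def fun_eq_iff\<close>)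
qed

lemma group_algebra_mult_eq_act:
  assumes "cring K" "group G" "finite (carrier G)"
    and a: "a \<in> carrier (group_algebra K G)" and b: "b \<in> carrier (group_algebra K G)"
  shows "a \<otimes>\<^bsub>group_algebra K G\<^esub> b = group_algebra_act G (free_module K (carrier G))
    (\<lambda>g f. \<lambda>x\<in>carrier G. f (inv\<^bsub>G\<^esub> g \<otimes>\<^bsub>G\<^esub> x)) a b"
proof -
  interpret cring K by fact
  interpret G: group G by fact
  let ?A = "group_algebra K G" and ?F = "free_module K (carrier G)"
  let ?\<rho> = "\<lambda>g f. \<lambda>x\<in>carrier G. f (inv\<^bsub>G\<^esub> g \<otimes>\<^bsub>G\<^esub> x)"
  interpret \<rho>: finite_group_representation K ?F G ?\<rho>
    by (rule regular_representation[OF assms(1-3)])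
  have carrier: "carrier ?A = carrier ?F" by (simp add: group_algebra_def)
  have ext: "u = v" if "u \<in> carrier ?F" "v \<in> carrier ?F" "\<And>g. g \<in> carrier G \<Longrightarrow> u g = v g" for u v
    using that by (auto simp: free_module_def intro: PiE_ext)
  show ?thesis
  proof (rule ext)
      note bF = b[unfolded carrier]
      fix g assume g: "g \<in> carrier G"
      have "\<rho>.act a b g = (\<Oplus>\<^bsub>K\<^esub>h\<in>carrier G. (a h \<odot>\<^bsub>?F\<^esub> ?\<rho> h b) g)"
        unfolding \<rho>.act_eq_finsum[OF a bF]
        by (rule free_module_finsum_apply[OF assms(1,3) _ g])
           (use \<rho>.rho_closed[OF _ bF] \<rho>.coeff_closed[OF a] in auto)
      also have "\<dots> = (\<Oplus>\<^bsub>K\<^esub>h\<in>carrier G. a h \<otimes>\<^bsub>K\<^esub> b (inv\<^bsub>G\<^esub> h \<otimes>\<^bsub>G\<^esub> g))"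
        by (rule finsum_cong')
           (use g \<rho>.coeff_closed[OF a] \<rho>.coeff_closed[OF b] in \<open>auto simp: free_module_def\<close>)
      finally show "(a \<otimes>\<^bsub>?A\<^esub> b) g = \<rho>.act a b g"
        using \<rho>.group_algebra_mult[OF a b g] by simp
    qed (use a b \<rho>.group_algebra_mult_closed \<rho>.act_closed carrier in auto)
qed

lemma basis_elem_mult:
  assumes "cring K" "group G" "finite (carrier G)" "g \<in> carrier G" "b \<in> carrier (group_algebra K G)"
  shows "basis_elem K (carrier G) g \<otimes>\<^bsub>group_algebra K G\<^esub> b =
    (\<lambda>x\<in>carrier G. b (inv\<^bsub>G\<^esub> g \<otimes>\<^bsub>G\<^esub> x))"
proof -
  interpret \<rho>: finite_group_representation K "free_module K (carrier G)" G
    "\<lambda>g f. \<lambda>x\<in>carrier G. f (inv\<^bsub>G\<^esub> g \<otimes>\<^bsub>G\<^esub> x)"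
    by (rule regular_representation[OF assms(1-3)])
  have "basis_elem K (carrier G) g \<in> carrier (group_algebra K G)"
    using basis_elem_closed[OF assms(1)] by (simp add: group_algebra_def)
  from group_algebra_mult_eq_act[OF assms(1-3) this assms(5)] assms(4,5) show ?thesis
    by (simp add: \<rho>.act_basis group_algebra_def)
qed

lemma basis_elem_mult_hom:
  assumes "cring K" "group G" "finite (carrier G)" "g \<in> carrier G"
  shows "(\<lambda>b. basis_elem K (carrier G) g \<otimes>\<^bsub>group_algebra K G\<^esub> b)
    \<in> module_hom K (group_algebra K G) (group_algebra K G)"
proof -
  interpret A: module K "group_algebra K G" by (rule module_group_algebra) fact
  interpret \<rho>: finite_group_representation K "free_module K (carrier G)" G
    "\<lambda>g f. \<lambda>x\<in>carrier G. f (inv\<^bsub>G\<^esub> g \<otimes>\<^bsub>G\<^esub> x)"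
    by (rule regular_representation[OF assms(1-3)])
  have "(\<lambda>f. \<lambda>x\<in>carrier G. f (inv\<^bsub>G\<^esub> g \<otimes>\<^bsub>G\<^esub> x)) \<in> module_hom K (group_algebra K G) (group_algebra K G)"
    using \<rho>.hom[OF assms(4)] by (simp add: module_hom_def group_algebra_def)
  then show ?thesis
    by (auto simp: module_hom_def basis_elem_mult[OF assms])
qed

lemma group_algebra_cring:
  assumes "cring K" "comm_group G" "finite (carrier G)"
  shows "cring (group_algebra K G)"
proof -
  interpret cring K by fact
  interpret G: comm_group G by fact
  let ?A = "group_algebra K G" and ?F = "free_module K (carrier G)"
  let ?\<rho> = "\<lambda>g f. \<lambda>x\<in>carrier G. f (inv\<^bsub>G\<^esub> g \<otimes>\<^bsub>G\<^esub> x)"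
  interpret \<rho>: finite_group_representation K ?F G ?\<rho>
    by (rule regular_representation[OF assms(1) G.is_group assms(3)])
  interpret A: module K ?A by (rule module_group_algebra) fact
  have carrier: "carrier ?A = carrier ?F" and add: "add ?A = add ?F"
    by (simp_all add: group_algebra_def)
  have ext: "u = v" if "u \<in> carrier ?F" "v \<in> carrier ?F" "\<And>g. g \<in> carrier G \<Longrightarrow> u g = v g" for u v
    using that by (auto simp: free_module_def intro: PiE_ext)
  have mult: "a \<otimes>\<^bsub>?A\<^esub> b = \<rho>.act a b" if "a \<in> carrier ?A" "b \<in> carrier ?A" for a b
    by (rule group_algebra_mult_eq_act[OF assms(1) G.is_group assms(3) that])
  have comm: "a \<otimes>\<^bsub>?A\<^esub> b = b \<otimes>\<^bsub>?A\<^esub> a" if a: "a \<in> carrier ?A" and b: "b \<in> carrier ?A" for a b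
  proof (rule ext)
    fix g assume g: "g \<in> carrier G"
    show "(a \<otimes>\<^bsub>?A\<^esub> b) g = (b \<otimes>\<^bsub>?A\<^esub> a) g"
      unfolding \<rho>.group_algebra_mult[OF a b g] \<rho>.group_algebra_mult[OF b a g]
      by (rule finsum_reindex_bij_witness
          [where i = "\<lambda>k. inv\<^bsub>G\<^esub> k \<otimes>\<^bsub>G\<^esub> g" and j = "\<lambda>k. inv\<^bsub>G\<^esub> k \<otimes>\<^bsub>G\<^esub> g"])
        (use g \<rho>.coeff_closed[OF a] \<rho>.coeff_closed[OF b] in
          \<open>auto simp: G.inv_mult_group G.m_ac m_comm\<close>)
  qed (use a b \<rho>.group_algebra_mult_closed carrier in auto)
  have one: "\<one>\<^bsub>?A\<^esub> = basis_elem K (carrier G) \<one>\<^bsub>G\<^esub>" by (simp add: group_algebra_def)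
  have one_closed: "\<one>\<^bsub>?A\<^esub> \<in> carrier ?A"
    unfolding one carrier by (rule basis_elem_closed) fact
  have l_one: "\<one>\<^bsub>?A\<^esub> \<otimes>\<^bsub>?A\<^esub> a = a" if "a \<in> carrier ?A" for a
    using mult[OF one_closed that] \<rho>.act_basis[of "\<one>\<^bsub>G\<^esub>" a] \<rho>.act_one[of a] that
    by (simp add: one carrier)
  show ?thesis
  proof (rule cringI)
    show "abelian_group ?A" by (rule A.M.abelian_group_axioms)
    show "comm_monoid ?A"
    proof (rule comm_monoidI)
      fix x y z assume xyz: "x \<in> carrier ?A" "y \<in> carrier ?A" "z \<in> carrier ?A"
      show "x \<otimes>\<^bsub>?A\<^esub> y \<otimes>\<^bsub>?A\<^esub> z = x \<otimes>\<^bsub>?A\<^esub> (y \<otimes>\<^bsub>?A\<^esub> z)"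
        using \<rho>.act_group_algebra_mult[OF xyz(1,2) xyz(3)[unfolded carrier]] xyz
        by (metis mult \<rho>.group_algebra_mult_closed)
      show "x \<otimes>\<^bsub>?A\<^esub> y = y \<otimes>\<^bsub>?A\<^esub> x" by (rule comm[OF xyz(1,2)])
    qed (simp_all add: \<rho>.group_algebra_mult_closed one_closed l_one)
    show "(x \<oplus>\<^bsub>?A\<^esub> y) \<otimes>\<^bsub>?A\<^esub> z = x \<otimes>\<^bsub>?A\<^esub> z \<oplus>\<^bsub>?A\<^esub> y \<otimes>\<^bsub>?A\<^esub> z"
      if "x \<in> carrier ?A" "y \<in> carrier ?A" "z \<in> carrier ?A" for x y z
      using that \<rho>.act_add_left[of x y z] by (simp add: mult add carrier A.M.a_closed[unfolded add carrier])
  qed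
qed

lemma (in finite_group_representation) group_algebra_module:
  assumes "comm_group G"
  shows "module (group_algebra K G)
    \<lparr>carrier = carrier M, mult = u, one = v, zero = zero M, add = add M, smult = act\<rparr>"
    (is "module ?A ?M")
proof (rule module_criteria)
  show "cring ?A" by (rule group_algebra_cring[OF R.is_cring assms finite_group])
  have one: "\<one>\<^bsub>?A\<^esub> = basis_elem K (carrier G) \<one>\<^bsub>G\<^esub>" by (simp add: group_algebra_def)
  show "\<forall>v \<in> carrier ?M. \<one>\<^bsub>?A\<^esub> \<odot>\<^bsub>?M\<^esub> v = v"
    by (simp add: one act_basis act_one)
  show "\<forall>v \<in> carrier ?M. \<exists>w \<in> carrier ?M. v \<oplus>\<^bsub>?M\<^esub> w = \<zero>\<^bsub>?M\<^esub>"
    using M.r_neg by auto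
qed (auto simp: act_closed act_add_left act_group_algebra_mult module_hom_add[OF act_hom] M.a_ac)

section \<open>Tensor powers\<close>

text \<open>Additivity and homogeneity in the entry at position \<open>i\<close> are packed into one condition: with the
other entries fixed, the map is a homomorphism.\<close>
definition multilinear_map ::
  "('a, 'k) ring_scheme \<Rightarrow> ('a, 'b, 'm) module_scheme \<Rightarrow> 'i set \<Rightarrow> ('a, 'c, 'n) module_scheme
    \<Rightarrow> (('i \<Rightarrow> 'b) \<Rightarrow> 'c) \<Rightarrow> bool" where
  "multilinear_map K M I P \<phi> \<longleftrightarrow> \<phi> \<in> tuples M I \<rightarrow> carrier P \<and>
    (\<forall>b \<in> tuples M I. \<forall>i \<in> I. (\<lambda>x. \<phi> (b(i := x))) \<in> module_hom K M P)"

lemma fun_upd_tuple: "b \<in> tuples M I \<Longrightarrow> i \<in> I \<Longrightarrow> x \<in> carrier M \<Longrightarrow> b(i := x) \<in> tuples M I"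
  by (auto simp: PiE_iff extensional_def)

lemma multilinear_map_comp:
  "multilinear_map K M I P \<phi> \<Longrightarrow> f \<in> module_hom K P Q \<Longrightarrow> multilinear_map K M I Q (\<lambda>b. f (\<phi> b))"
  unfolding multilinear_map_def
  using module_hom_closed[of f K P Q] by (simp add: Pi_iff module_hom_comp[of _ K M P f Q])

text \<open>Covers both families of operators on the tensor power: for the diagonal action \<open>\<pi>\<close> is the
identity and each \<open>f i\<close> is multiplication by a group element, for the symmetric group each \<open>f i\<close>
is the identity.\<close>

lemma multilinear_map_reindex:
  assumes \<phi>: "multilinear_map K M I P \<phi>" and \<pi>: "\<pi> permutes I"
    and f: "\<And>i. i \<in> I \<Longrightarrow> f i \<in> module_hom K M M"
  shows "multilinear_map K M I P (\<lambda>b. \<phi> (\<lambda>i\<in>I. f i (b (\<pi> i))))"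
  unfolding multilinear_map_def
proof (intro conjI Pi_I ballI)
  have \<pi>I: "\<pi> i \<in> I" if "i \<in> I" for i
    using that permutes_in_image[OF \<pi>] by simp
  have closed: "(\<lambda>i\<in>I. f i (b (\<pi> i))) \<in> tuples M I" if b: "b \<in> tuples M I" for b
    using b \<pi>I module_hom_closed[OF f] by (auto simp: PiE_iff)
  show "\<phi> (\<lambda>i\<in>I. f i (b (\<pi> i))) \<in> carrier P" if b: "b \<in> tuples M I" for b
    using \<phi> closed[OF b] unfolding multilinear_map_def by blast
  fix b i assume b: "b \<in> tuples M I" and i: "i \<in> I"
  define k where "k = inv' \<pi> i"
  have k: "k \<in> I" "\<And>j. \<pi> j = i \<longleftrightarrow> j = k"
    using permutes_in_image[OF permutes_inv[OF \<pi>], of i] i permutes_inverses[OF \<pi>] by (auto simp: k_def)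
  have "(\<lambda>j\<in>I. f j ((b(i := x)) (\<pi> j))) = (\<lambda>j\<in>I. f j (b (\<pi> j)))(k := f k x)" for x
    using k by (auto simp: fun_eq_iff)
  moreover have "(\<lambda>x. \<phi> ((\<lambda>j\<in>I. f j (b (\<pi> j)))(k := f k x))) \<in> module_hom K M P"
  proof (rule module_hom_comp[OF f[OF k(1)]])
    show "(\<lambda>x. \<phi> ((\<lambda>j\<in>I. f j (b (\<pi> j)))(k := x))) \<in> module_hom K M P"
      using \<phi> closed[OF b] k(1) unfolding multilinear_map_def by blast
  qed
  ultimately show "(\<lambda>x. \<phi> (\<lambda>j\<in>I. f j ((b(i := x)) (\<pi> j)))) \<in> module_hom K M P"
    by simp
qed

context
  fixes K :: "('a, 'k) ring_scheme" and M :: "('a, 'b, 'm) module_scheme" and I :: "'i set"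
  assumes M: "module K M"
begin

interpretation M: module K M by (fact M)
interpretation F: module K "tuple_module K M I" by (rule module_free_module[OF M.R.is_cring])

lemma tensor_power_module: "module K (tensor_power K M I)"
  unfolding tensor_power_def
  by (rule quotient_is_module[OF F.module_axioms tensor_null_submodule[OF M.R.is_cring]])

lemma tensor_projection_hom:
  "(\<lambda>f. tensor_null K M I +>\<^bsub>tuple_module K M I\<^esub> f)
    \<in> module_hom K (tuple_module K M I) (tensor_power K M I)"
  unfolding tensor_power_def
  by (rule quotient_projection_hom[OF F.module_axioms tensor_null_submodule[OF M.R.is_cring]])

lemma multilinear_rels_subset_null: "multilinear_rels K M I \<subseteq> tensor_null K M I"
  unfolding tensor_null_def
  by (rule F.in_own_span) (rule multilinear_rels_closed[OF M.R.is_cring])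

lemma pure_tensor_closed: "pure_tensor K M I b \<in> carrier (tensor_power K M I)"
  unfolding pure_tensor_def
  by (rule funcset_mem[OF module_hom_closed[OF tensor_projection_hom] basis_elem_closed[OF M.R.is_cring]])

text \<open>Every tuple, not only those from a basis of \<open>M\<close>, indexes a basis element of the free module of
which the tensor power is a quotient.\<close>

lemma tensor_power_generated:
  assumes W: "LinearCombinations.submodule K W (tensor_power K M I)"
    and pure: "\<And>b. b \<in> tuples M I \<Longrightarrow> pure_tensor K M I b \<in> W"
  shows "carrier (tensor_power K M I) \<subseteq> W"
proof -
  have "carrier (tuple_module K M I) \<subseteq>
      {f \<in> carrier (tuple_module K M I). tensor_null K M I +>\<^bsub>tuple_module K M I\<^esub> f \<in> W}"
    by (rule free_module_generated[OF M.R.is_cring preimage_submodule[OF F.module_axioms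
            tensor_power_module tensor_projection_hom W]])
       (simp add: pure[unfolded pure_tensor_def] basis_elem_closed[OF M.R.is_cring])
  then show ?thesis
    unfolding tensor_power_def
      quotient_carrier[OF F.module_axioms tensor_null_submodule[OF M.R.is_cring]] by blast
qed

text \<open>The defining relations of the tensor power are those that a multilinear map satisfies.\<close>

lemma linear_ext_kills_tensor_null:
  assumes P: "module K P" and \<phi>: "multilinear_map K M I P \<phi>"
    and f: "f \<in> tensor_null K M I"
  shows "linear_ext P (tuples M I) \<phi> f = \<zero>\<^bsub>P\<^esub>"
proof -
  interpret P: module K P by fact
  have \<phi>c: "\<phi> \<in> tuples M I \<rightarrow> carrier P" using \<phi> by (simp add: multilinear_map_def)
  define L where "L = linear_ext P (tuples M I) \<phi>"
  interpret L: mod_hom K "tuple_module K M I" P L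
    unfolding L_def by unfold_locales (rule linear_ext_hom[OF P \<phi>c])
  have bas [simp]: "tuple_elem K M I b \<in> carrier (tuple_module K M I)" for b
    by (rule basis_elem_closed[OF M.R.is_cring])
  have ext: "L (tuple_elem K M I b) = \<phi> b" if "b \<in> tuples M I" for b
    unfolding L_def by (rule linear_ext_basis[OF P \<phi>c that])
  have kill: "L r \<in> {\<zero>\<^bsub>P\<^esub>}" if "r \<in> multilinear_rels K M I" for r
    using that unfolding multilinear_rels_def
  proof (elim UnE CollectE exE conjE)
    fix b i x y assume *: "b \<in> tuples M I" "i \<in> I" "x \<in> carrier M" "y \<in> carrier M"
      and r: "r = tuple_elem K M I (b(i := x \<oplus>\<^bsub>M\<^esub> y)) \<ominus>\<^bsub>tuple_module K M I\<^esub>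
        (tuple_elem K M I (b(i := x)) \<oplus>\<^bsub>tuple_module K M I\<^esub> tuple_elem K M I (b(i := y)))"
    have h: "(\<lambda>x. \<phi> (b(i := x))) \<in> module_hom K M P" using \<phi> * by (simp add: multilinear_map_def)
    have "L r = \<phi> (b(i := x \<oplus>\<^bsub>M\<^esub> y)) \<ominus>\<^bsub>P\<^esub> (\<phi> (b(i := x)) \<oplus>\<^bsub>P\<^esub> \<phi> (b(i := y)))"
      using * by (simp add: r ext fun_upd_tuple)
    also have "\<dots> = \<zero>\<^bsub>P\<^esub>"
      using module_hom_add[OF h *(3,4)] funcset_mem[OF module_hom_closed[OF h]] *
      by (simp add: a_minus_def P.M.r_neg)
    finally show ?thesis by simp
  next
    fix b i c x assume *: "b \<in> tuples M I" "i \<in> I" "c \<in> carrier K" "x \<in> carrier M"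
      and r: "r = tuple_elem K M I (b(i := c \<odot>\<^bsub>M\<^esub> x)) \<ominus>\<^bsub>tuple_module K M I\<^esub>
        (c \<odot>\<^bsub>tuple_module K M I\<^esub> tuple_elem K M I (b(i := x)))"
    have h: "(\<lambda>x. \<phi> (b(i := x))) \<in> module_hom K M P" using \<phi> * by (simp add: multilinear_map_def)
    have "L r = \<phi> (b(i := c \<odot>\<^bsub>M\<^esub> x)) \<ominus>\<^bsub>P\<^esub> (c \<odot>\<^bsub>P\<^esub> \<phi> (b(i := x)))"
      using * by (simp add: r ext fun_upd_tuple)
    also have "\<dots> = \<zero>\<^bsub>P\<^esub>"
      using module_hom_smult[OF h *(3,4)] funcset_mem[OF module_hom_closed[OF h]] *
      by (simp add: a_minus_def P.M.r_neg)
    finally show ?thesis by simp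
  qed
  have zero: "LinearCombinations.submodule K {\<zero>\<^bsub>P\<^esub>} P"
    by (rule submodule.intro) (auto simp: P)
  have "L f \<in> {\<zero>\<^bsub>P\<^esub>}"
    unfolding L_def
    by (rule linear_ext_span[OF P \<phi>c multilinear_rels_closed[OF M.R.is_cring] zero kill[unfolded L_def]
          f[unfolded tensor_null_def]])
  then show ?thesis by (simp add: L_def)
qed

theorem tensor_lift:
  assumes P: "module K P" and \<phi>: "multilinear_map K M I P \<phi>"
  shows "\<exists>h \<in> module_hom K (tensor_power K M I) P.
    \<forall>b \<in> tuples M I. h (pure_tensor K M I b) = \<phi> b"
proof -
  have \<phi>c: "\<phi> \<in> tuples M I \<rightarrow> carrier P" using \<phi> by (simp add: multilinear_map_def)
  obtain h where "h \<in> module_hom K (tensor_power K M I) P"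
    "\<forall>x \<in> carrier (tuple_module K M I).
      h (tensor_null K M I +>\<^bsub>tuple_module K M I\<^esub> x) = linear_ext P (tuples M I) \<phi> x"
    using quotient_lift[OF F.module_axioms tensor_null_submodule[OF M.R.is_cring] P
        linear_ext_hom[OF P \<phi>c] linear_ext_kills_tensor_null[OF P \<phi>]]
    unfolding tensor_power_def by blast
  then show ?thesis
    by (auto simp: pure_tensor_def basis_elem_closed[OF M.R.is_cring] linear_ext_basis[OF P \<phi>c]
        intro!: bexI[of _ h])
qed

lemma pure_tensor_multilinear: "multilinear_map K M I (tensor_power K M I) (pure_tensor K M I)"
  unfolding multilinear_map_def
proof (intro conjI Pi_I ballI)
  interpret T: module K "tensor_power K M I" by (rule tensor_power_module)
  let ?p = "\<lambda>f. tensor_null K M I +>\<^bsub>tuple_module K M I\<^esub> f"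
  interpret p: mod_hom K "tuple_module K M I" "tensor_power K M I" ?p
    by unfold_locales (rule tensor_projection_hom)
  have bas [simp]: "tuple_elem K M I b \<in> carrier (tuple_module K M I)" for b
    by (rule basis_elem_closed[OF M.R.is_cring])
  have kill: "?p r = \<zero>\<^bsub>tensor_power K M I\<^esub>" if "r \<in> multilinear_rels K M I" for r
    using that multilinear_rels_subset_null multilinear_rels_closed[OF M.R.is_cring, of M I]
      coset_eq_null_iff[OF F.module_axioms tensor_null_submodule[OF M.R.is_cring], of r]
      quotient_zero[OF F.module_axioms tensor_null_submodule[OF M.R.is_cring]]
    unfolding tensor_power_def by auto
  have diff: "u = v" if "u \<ominus>\<^bsub>tensor_power K M I\<^esub> v = \<zero>\<^bsub>tensor_power K M I\<^esub>"
    "u \<in> carrier (tensor_power K M I)" "v \<in> carrier (tensor_power K M I)" for u v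
    using that T.M.minus_equality[of u "\<ominus>\<^bsub>tensor_power K M I\<^esub> v"] by (simp add: a_minus_def)
  fix b i assume b: "b \<in> tuples M I" and i: "i \<in> I"
  show "(\<lambda>x. pure_tensor K M I (b(i := x))) \<in> module_hom K M (tensor_power K M I)"
    unfolding module_hom_def
  proof (intro CollectI conjI Pi_I allI impI; (elim conjE)?)
    fix x y assume xy: "x \<in> carrier M" "y \<in> carrier M"
    have "?p (tuple_elem K M I (b(i := x \<oplus>\<^bsub>M\<^esub> y)) \<ominus>\<^bsub>tuple_module K M I\<^esub>
        (tuple_elem K M I (b(i := x)) \<oplus>\<^bsub>tuple_module K M I\<^esub> tuple_elem K M I (b(i := y)))) =
        \<zero>\<^bsub>tensor_power K M I\<^esub>"
    proof (rule kill, unfold multilinear_rels_def, rule UnI1, rule CollectI, (rule exI)+, rule conjI[OF refl])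
    qed (intro conjI b i xy)
    then show "pure_tensor K M I (b(i := x \<oplus>\<^bsub>M\<^esub> y)) =
        pure_tensor K M I (b(i := x)) \<oplus>\<^bsub>tensor_power K M I\<^esub> pure_tensor K M I (b(i := y))"
      unfolding pure_tensor_def by (rule_tac diff) simp_all
  next
    fix c x assume cx: "c \<in> carrier K" "x \<in> carrier M"
    have "?p (tuple_elem K M I (b(i := c \<odot>\<^bsub>M\<^esub> x)) \<ominus>\<^bsub>tuple_module K M I\<^esub>
        (c \<odot>\<^bsub>tuple_module K M I\<^esub> tuple_elem K M I (b(i := x)))) = \<zero>\<^bsub>tensor_power K M I\<^esub>"
    proof (rule kill, unfold multilinear_rels_def, rule UnI2, rule CollectI, (rule exI)+, rule conjI[OF refl])
    qed (intro conjI b i cx)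
    then show "pure_tensor K M I (b(i := c \<odot>\<^bsub>M\<^esub> x)) =
        c \<odot>\<^bsub>tensor_power K M I\<^esub> pure_tensor K M I (b(i := x))"
      unfolding pure_tensor_def using cx by (rule_tac diff) simp_all
  qed (rule pure_tensor_closed)
qed (rule pure_tensor_closed)

text \<open>The lift of \<open>\<phi>\<close> has to be multilinear modulo the relations only. The proof compares two linear
maps on the free module, the extension of \<open>\<phi>\<close> followed by the projection and the extension of the
composite; they agree on basis elements, and the second one kills the relations.\<close>

lemma tensor_map_hom:
  assumes \<phi>c: "\<phi> \<in> tuples M I \<rightarrow> carrier (tuple_module K M I)"
    and \<phi>: "multilinear_map K M I (tensor_power K M I)
      (\<lambda>b. tensor_null K M I +>\<^bsub>tuple_module K M I\<^esub> \<phi> b)"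
  shows "tensor_map K M I \<phi> \<in> module_hom K (tensor_power K M I) (tensor_power K M I)"
    and "b \<in> tuples M I \<Longrightarrow> tensor_map K M I \<phi> (pure_tensor K M I b) =
      tensor_null K M I +>\<^bsub>tuple_module K M I\<^esub> \<phi> b"
proof -
  let ?p = "\<lambda>f. tensor_null K M I +>\<^bsub>tuple_module K M I\<^esub> f"
  let ?L = "linear_ext (tuple_module K M I) (tuples M I) \<phi>"
  let ?L' = "linear_ext (tensor_power K M I) (tuples M I) (\<lambda>b. ?p (\<phi> b))"
  note TM = tensor_power_module
  have L: "?L \<in> module_hom K (tuple_module K M I) (tuple_module K M I)"
    by (rule linear_ext_hom[OF F.module_axioms \<phi>c])
  have c': "(\<lambda>b. ?p (\<phi> b)) \<in> tuples M I \<rightarrow> carrier (tensor_power K M I)"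
    using \<phi> by (simp add: multilinear_map_def)
  have hom1: "(\<lambda>f. ?p (?L f)) \<in> module_hom K (tuple_module K M I) (tensor_power K M I)"
    by (rule module_hom_comp[OF L tensor_projection_hom])
  have "carrier (tuple_module K M I) \<subseteq> {f \<in> carrier (tuple_module K M I). ?p (?L f) = ?L' f}"
    by (rule free_module_generated[OF M.R.is_cring equalizer_submodule[OF F.module_axioms TM hom1
            linear_ext_hom[OF TM c']]])
      (use basis_elem_closed[OF M.R.is_cring] in
        \<open>auto simp: linear_ext_basis[OF F.module_axioms \<phi>c] linear_ext_basis[OF TM c']\<close>)
  then have eq: "?p (?L f) = ?L' f" if "f \<in> carrier (tuple_module K M I)" for f
    using that by blast
  have null: "?L f \<in> tensor_null K M I" if f: "f \<in> tensor_null K M I" for f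
  proof -
    have fc: "f \<in> carrier (tuple_module K M I)"
      using f submodule.subset[OF tensor_null_submodule[OF M.R.is_cring]] by blast
    have "?p (?L f) = \<zero>\<^bsub>tensor_power K M I\<^esub>"
      unfolding eq[OF fc] by (rule linear_ext_kills_tensor_null[OF TM \<phi> f])
    then show ?thesis
      using coset_eq_null_iff[OF F.module_axioms tensor_null_submodule[OF M.R.is_cring], of "?L f"]
        quotient_zero[OF F.module_axioms tensor_null_submodule[OF M.R.is_cring]]
        funcset_mem[OF module_hom_closed[OF L] fc]
      by (simp add: tensor_power_def)
  qed
  show "tensor_map K M I \<phi> \<in> module_hom K (tensor_power K M I) (tensor_power K M I)"
    unfolding tensor_map_def tensor_power_def
    by (rule induced_map_hom[OF F.module_axioms tensor_null_submodule[OF M.R.is_cring] L null])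
  show "tensor_map K M I \<phi> (pure_tensor K M I b) = ?p (\<phi> b)" if "b \<in> tuples M I"
    by (rule tensor_map_pure[OF M.R.is_cring \<phi>c null that])
       (use multilinear_rels_subset_null in blast)
qed

end

section \<open>Balanced tensor products\<close>

text \<open>The balanced tensor product is a quotient of a free abelian group, that is, of a free
\<open>\<Z>\<close>-module. To extend a map from it to an abelian group, the latter is viewed as a \<open>\<Z>\<close>-module.\<close>
definition additive_int_module :: "('b, 'm) ring_scheme \<Rightarrow> (int, 'b) module" where
  "additive_int_module P = \<lparr>carrier = carrier P, mult = mult P, one = one P, zero = zero P, add = add P,
    smult = (\<lambda>k x. add_pow P k x)\<rparr>"

lemma additive_int_module:
  assumes "abelian_group P"
  shows "module \<Z> (additive_int_module P)"
proof -
  interpret abelian_group P by fact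
  show ?thesis
    by (rule module_criteria[OF int_is_cring])
       (auto simp: additive_int_module_def a_ac add.int_pow_mult add.int_pow_distrib
          add.int_pow_pow mult.commute r_neg intro!: bexI[of _ "\<ominus>\<^bsub>P\<^esub> _"])
qed

lemma int_submoduleI:
  assumes "module \<Z> Q" "W \<subseteq> carrier Q" "\<zero>\<^bsub>Q\<^esub> \<in> W"
    and add: "\<And>u v. u \<in> W \<Longrightarrow> v \<in> W \<Longrightarrow> u \<oplus>\<^bsub>Q\<^esub> v \<in> W"
    and neg: "\<And>u. u \<in> W \<Longrightarrow> \<ominus>\<^bsub>Q\<^esub> u \<in> W"
  shows "LinearCombinations.submodule \<Z> W Q"
proof -
  interpret Q: module \<Z> Q by fact
  have smult: "k \<odot>\<^bsub>Q\<^esub> u \<in> W" if u: "u \<in> W" for k u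
  proof -
    have uQ: "u \<in> carrier Q" using u assms(2) by blast
    have step: "(i + 1) \<odot>\<^bsub>Q\<^esub> u = i \<odot>\<^bsub>Q\<^esub> u \<oplus>\<^bsub>Q\<^esub> u" "(i - 1) \<odot>\<^bsub>Q\<^esub> u = i \<odot>\<^bsub>Q\<^esub> u \<oplus>\<^bsub>Q\<^esub> \<ominus>\<^bsub>Q\<^esub> u" for i :: int
      using Q.smult_l_distr[of i 1 u] Q.smult_l_distr[of i "-1" u] Q.smult_one[of u]
        Q.smult_l_minus[of 1 u] uQ by (simp_all add: int.minus_equality)
    show ?thesis
      by (induction k rule: int_induct[where k = 0])
         (use assms(3) Q.smult_l_null[OF uQ] u in \<open>auto simp: step add neg\<close>)
  qed
  show ?thesis
    by (rule submodule.intro) (use assms smult in auto)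
qed

text \<open>The \<open>A\<close>-action on the balanced tensor product is given on representatives; it is well defined because
it commutes with the right action of \<open>R\<close> on \<open>M\<close>.\<close>
locale balanced_bimodule = M: module A M + N: abelian_group N
  for A :: "('a, 'j) ring_scheme" and M :: "('a, 'b, 'm) module_scheme"
    and R :: "('r, 'k) ring_scheme" and N :: "('r, 'c, 'n) module_scheme" +
  fixes act :: "'b \<Rightarrow> 'r \<Rightarrow> 'b"
  assumes act_closed: "x \<in> carrier M \<Longrightarrow> r \<in> carrier R \<Longrightarrow> act x r \<in> carrier M"
    and smult_closed: "r \<in> carrier R \<Longrightarrow> y \<in> carrier N \<Longrightarrow> r \<odot>\<^bsub>N\<^esub> y \<in> carrier N"
    and act_commute: "a \<in> carrier A \<Longrightarrow> x \<in> carrier M \<Longrightarrow> r \<in> carrier R \<Longrightarrow>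
      a \<odot>\<^bsub>M\<^esub> act x r = act (a \<odot>\<^bsub>M\<^esub> x) r"
begin

abbreviation F where "F \<equiv> pair_module M N"
abbreviation null where "null \<equiv> balanced_null R M act N"
abbreviation Q where "Q \<equiv> quotient_module F null"
abbreviation BT where "BT \<equiv> balanced_tensor R M act N"
abbreviation pe where "pe \<equiv> pair_elem M N"

definition tensor :: "'b \<Rightarrow> 'c \<Rightarrow> ('b \<times> 'c \<Rightarrow> int) set" where
  "tensor x y = null +>\<^bsub>F\<^esub> pe x y"

sublocale F: module \<Z> F by (rule module_free_module[OF int_is_cring])

lemma pe_closed [simp]: "pe x y \<in> carrier F"
  by (rule basis_elem_closed[OF int_is_cring])

lemma balanced_rels_closed: "balanced_rels R M act N \<subseteq> carrier F"
  unfolding balanced_rels_def by auto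

lemma balanced_rels_cases [consumes 1]:
  assumes "f \<in> balanced_rels R M act N"
  obtains (left) x x' y where "x \<in> carrier M" "x' \<in> carrier M" "y \<in> carrier N"
      "f = pe (x \<oplus>\<^bsub>M\<^esub> x') y \<ominus>\<^bsub>F\<^esub> (pe x y \<oplus>\<^bsub>F\<^esub> pe x' y)"
    | (right) x y y' where "x \<in> carrier M" "y \<in> carrier N" "y' \<in> carrier N"
      "f = pe x (y \<oplus>\<^bsub>N\<^esub> y') \<ominus>\<^bsub>F\<^esub> (pe x y \<oplus>\<^bsub>F\<^esub> pe x y')"
    | (balanced) x r y where "x \<in> carrier M" "r \<in> carrier R" "y \<in> carrier N"
      "f = pe (act x r) y \<ominus>\<^bsub>F\<^esub> pe x (r \<odot>\<^bsub>N\<^esub> y)"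
  using assms unfolding balanced_rels_def by (elim UnE CollectE exE conjE) (erule that; assumption)+

lemma balanced_rels_left:
  "x \<in> carrier M \<Longrightarrow> x' \<in> carrier M \<Longrightarrow> y \<in> carrier N \<Longrightarrow>
    pe (x \<oplus>\<^bsub>M\<^esub> x') y \<ominus>\<^bsub>F\<^esub> (pe x y \<oplus>\<^bsub>F\<^esub> pe x' y) \<in> balanced_rels R M act N"
  unfolding balanced_rels_def
  by (rule UnI1, rule UnI1, rule CollectI, (rule exI)+, intro conjI, rule refl; assumption)

lemma balanced_rels_right:
  "x \<in> carrier M \<Longrightarrow> y \<in> carrier N \<Longrightarrow> y' \<in> carrier N \<Longrightarrow>
    pe x (y \<oplus>\<^bsub>N\<^esub> y') \<ominus>\<^bsub>F\<^esub> (pe x y \<oplus>\<^bsub>F\<^esub> pe x y') \<in> balanced_rels R M act N"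
  unfolding balanced_rels_def
  by (rule UnI1, rule UnI2, rule CollectI, (rule exI)+, intro conjI, rule refl; assumption)

lemma balanced_rels_balanced:
  "x \<in> carrier M \<Longrightarrow> r \<in> carrier R \<Longrightarrow> y \<in> carrier N \<Longrightarrow>
    pe (act x r) y \<ominus>\<^bsub>F\<^esub> pe x (r \<odot>\<^bsub>N\<^esub> y) \<in> balanced_rels R M act N"
  unfolding balanced_rels_def
  by (rule UnI2, rule CollectI, (rule exI)+, intro conjI, rule refl; assumption)

lemmas balanced_relsI = balanced_rels_left balanced_rels_right balanced_rels_balanced

lemma null_submodule: "LinearCombinations.submodule \<Z> null F"
  unfolding balanced_null_def by (rule F.span_is_submodule[OF balanced_rels_closed])

lemma rels_subset_null: "balanced_rels R M act N \<subseteq> null"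
  unfolding balanced_null_def by (rule F.in_own_span[OF balanced_rels_closed])

sublocale Q: module \<Z> Q by (rule quotient_is_module[OF F.module_axioms null_submodule])

lemma projection_hom: "(\<lambda>f. null +>\<^bsub>F\<^esub> f) \<in> module_hom \<Z> F Q"
  by (rule quotient_projection_hom[OF F.module_axioms null_submodule])

lemma BT_simps: "carrier BT = carrier Q" "\<zero>\<^bsub>BT\<^esub> = \<zero>\<^bsub>Q\<^esub>" "add BT = add Q"
  by (simp_all add: balanced_tensor_def quotient_module_def)

lemma tensor_closed [simp]: "tensor x y \<in> carrier BT"
  unfolding tensor_def BT_simps by (rule funcset_mem[OF module_hom_closed[OF projection_hom]]) simp

lemma projection_rel:
  assumes "f \<in> balanced_rels R M act N"
  shows "null +>\<^bsub>F\<^esub> f = \<zero>\<^bsub>Q\<^esub>"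
  using assms rels_subset_null balanced_rels_closed
    coset_eq_null_iff[OF F.module_axioms null_submodule, of f]
  unfolding quotient_zero[OF F.module_axioms null_submodule] by blast

lemma projection_eq:
  assumes "f \<ominus>\<^bsub>F\<^esub> g \<in> balanced_rels R M act N" "f \<in> carrier F" "g \<in> carrier F"
  shows "null +>\<^bsub>F\<^esub> f = null +>\<^bsub>F\<^esub> g"
proof -
  interpret p: mod_hom \<Z> F Q "\<lambda>f. null +>\<^bsub>F\<^esub> f" by unfold_locales (rule projection_hom)
  have "(null +>\<^bsub>F\<^esub> f) \<ominus>\<^bsub>Q\<^esub> (null +>\<^bsub>F\<^esub> g) = \<zero>\<^bsub>Q\<^esub>"
    using projection_rel[OF assms(1)] assms(2,3) by simp
  then show ?thesis
    using Q.M.minus_equality[of "null +>\<^bsub>F\<^esub> f" "\<ominus>\<^bsub>Q\<^esub> (null +>\<^bsub>F\<^esub> g)"] p.f_im[OF assms(2)] p.f_im[OF assms(3)]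
    by (simp add: a_minus_def)
qed

lemma tensor_add_left:
  assumes "x \<in> carrier M" "x' \<in> carrier M" "y \<in> carrier N"
  shows "tensor (x \<oplus>\<^bsub>M\<^esub> x') y = tensor x y \<oplus>\<^bsub>BT\<^esub> tensor x' y"
proof -
  have "null +>\<^bsub>F\<^esub> pe (x \<oplus>\<^bsub>M\<^esub> x') y = null +>\<^bsub>F\<^esub> (pe x y \<oplus>\<^bsub>F\<^esub> pe x' y)"
    by (rule projection_eq) (use assms balanced_relsI in auto)
  then show ?thesis
    unfolding tensor_def BT_simps by (simp only: module_hom_add[OF projection_hom pe_closed pe_closed])
qed

lemma tensor_balanced:
  assumes "x \<in> carrier M" "r \<in> carrier R" "y \<in> carrier N"
  shows "tensor (act x r) y = tensor x (r \<odot>\<^bsub>N\<^esub> y)"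
  unfolding tensor_def by (rule projection_eq) (use assms balanced_relsI in auto)

lemma BT_generated:
  assumes W: "LinearCombinations.submodule \<Z> W Q"
    and tensor: "\<And>x y. x \<in> carrier M \<Longrightarrow> y \<in> carrier N \<Longrightarrow> tensor x y \<in> W"
  shows "carrier BT \<subseteq> W"
proof -
  have "carrier F \<subseteq> {f \<in> carrier F. null +>\<^bsub>F\<^esub> f \<in> W}"
    by (rule free_module_generated[OF int_is_cring preimage_submodule[OF F.module_axioms Q.module_axioms projection_hom W]])
       (use tensor in \<open>auto simp: tensor_def\<close>)
  then show ?thesis
    unfolding BT_simps quotient_carrier[OF F.module_axioms null_submodule] by blast
qed

text \<open>Such a \<open>\<beta>\<close> induces an additive map on the tensor product. What matters here is the resulting
criterion for a pure tensor to be nonzero.\<close>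

lemma biadditive_kills_null:
  assumes P: "abelian_group P" and \<beta>: "\<And>x y. x \<in> carrier M \<Longrightarrow> y \<in> carrier N \<Longrightarrow> \<beta> x y \<in> carrier P"
    and add_left: "\<And>x x' y. x \<in> carrier M \<Longrightarrow> x' \<in> carrier M \<Longrightarrow> y \<in> carrier N \<Longrightarrow>
      \<beta> (x \<oplus>\<^bsub>M\<^esub> x') y = \<beta> x y \<oplus>\<^bsub>P\<^esub> \<beta> x' y"
    and add_right: "\<And>x y y'. x \<in> carrier M \<Longrightarrow> y \<in> carrier N \<Longrightarrow> y' \<in> carrier N \<Longrightarrow>
      \<beta> x (y \<oplus>\<^bsub>N\<^esub> y') = \<beta> x y \<oplus>\<^bsub>P\<^esub> \<beta> x y'"
    and balanced: "\<And>x r y. x \<in> carrier M \<Longrightarrow> r \<in> carrier R \<Longrightarrow> y \<in> carrier N \<Longrightarrow>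
      \<beta> (act x r) y = \<beta> x (r \<odot>\<^bsub>N\<^esub> y)"
    and xy: "x \<in> carrier M" "y \<in> carrier N" and zero: "tensor x y = \<zero>\<^bsub>BT\<^esub>"
  shows "\<beta> x y = \<zero>\<^bsub>P\<^esub>"
proof -
  let ?P = "additive_int_module P"
  have PM: "module \<Z> ?P" by (rule additive_int_module[OF P])
  interpret P: module \<Z> ?P by (rule PM)
  have P_simps: "carrier ?P = carrier P" "\<zero>\<^bsub>?P\<^esub> = \<zero>\<^bsub>P\<^esub>" "add ?P = add P"
    by (simp_all add: additive_int_module_def)
  let ?\<phi> = "\<lambda>(x, y). \<beta> x y"
  have c: "?\<phi> \<in> carrier M \<times> carrier N \<rightarrow> carrier ?P" using \<beta> by (auto simp: P_simps)
  define L where "L = linear_ext ?P (carrier M \<times> carrier N) ?\<phi>"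
  interpret L: mod_hom \<Z> F ?P L
    unfolding L_def by unfold_locales (rule linear_ext_hom[OF PM c])
  have ext: "L (pe x y) = \<beta> x y" if "x \<in> carrier M" "y \<in> carrier N" for x y
    unfolding L_def using linear_ext_basis[OF PM c, of "(x, y)"] that by simp
  have \<beta>': "\<beta> x y \<in> carrier ?P" if "x \<in> carrier M" "y \<in> carrier N" for x y
    using \<beta>[OF that] by (simp add: P_simps)
  have diff: "u \<ominus>\<^bsub>?P\<^esub> u = \<zero>\<^bsub>?P\<^esub>" if "u \<in> carrier ?P" for u
    using that by (simp add: a_minus_def P.M.r_neg)
  have kill: "L f \<in> {\<zero>\<^bsub>?P\<^esub>}" if "f \<in> balanced_rels R M act N" for f
    using that
    by (cases rule: balanced_rels_cases)
       (simp_all add: ext act_closed smult_closed add_left add_right balanced \<beta>' P_simps(3)[symmetric] diff)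
  have zs: "LinearCombinations.submodule \<Z> {\<zero>\<^bsub>?P\<^esub>} ?P"
    by (rule submodule.intro) (auto simp: PM)
  have "pe x y \<in> null"
    using zero coset_eq_null_iff[OF F.module_axioms null_submodule pe_closed]
    unfolding tensor_def BT_simps quotient_zero[OF F.module_axioms null_submodule] by blast
  then have "pe x y \<in> LinearCombinations.module.span \<Z> F (balanced_rels R M act N)"
    by (simp only: balanced_null_def)
  from linear_ext_span[OF PM c balanced_rels_closed zs kill[unfolded L_def] this]
  have "L (pe x y) \<in> {\<zero>\<^bsub>?P\<^esub>}" by (simp only: L_def)
  then show ?thesis using xy by (simp add: ext P_simps)
qed

text \<open>Multiplication by \<open>a\<close> in the first entry carries each defining relation to one of the same kind;
for balancedness this is where the two actions have to commute.\<close>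

lemma BT_smult_tensor:
  assumes a: "a \<in> carrier A" and xy: "x \<in> carrier M" "y \<in> carrier N"
  shows "a \<odot>\<^bsub>BT\<^esub> tensor x y = tensor (a \<odot>\<^bsub>M\<^esub> x) y"
proof -
  let ?\<phi> = "\<lambda>(x, y). pe (a \<odot>\<^bsub>M\<^esub> x) y"
  have c: "?\<phi> \<in> carrier M \<times> carrier N \<rightarrow> carrier F" by auto
  define L where "L = linear_ext F (carrier M \<times> carrier N) ?\<phi>"
  have Lh: "L \<in> module_hom \<Z> F F" unfolding L_def by (rule linear_ext_hom[OF F.module_axioms c])
  interpret L: mod_hom \<Z> F F L by unfold_locales (rule Lh)
  have ext: "L (pe x y) = pe (a \<odot>\<^bsub>M\<^esub> x) y" if "x \<in> carrier M" "y \<in> carrier N" for x y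
    unfolding L_def using linear_ext_basis[OF F.module_axioms c, of "(x, y)"] that by simp
  have rels: "L f \<in> balanced_rels R M act N" if "f \<in> balanced_rels R M act N" for f
    using that
  proof (cases rule: balanced_rels_cases)
    case (left x x' y)
    then have "L f = pe (a \<odot>\<^bsub>M\<^esub> x \<oplus>\<^bsub>M\<^esub> a \<odot>\<^bsub>M\<^esub> x') y \<ominus>\<^bsub>F\<^esub>
        (pe (a \<odot>\<^bsub>M\<^esub> x) y \<oplus>\<^bsub>F\<^esub> pe (a \<odot>\<^bsub>M\<^esub> x') y)"
      using a by (simp add: ext M.smult_r_distr)
    then show ?thesis using balanced_relsI(1) left a by simp
  next
    case (right x y y')
    then have "L f = pe (a \<odot>\<^bsub>M\<^esub> x) (y \<oplus>\<^bsub>N\<^esub> y') \<ominus>\<^bsub>F\<^esub>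
        (pe (a \<odot>\<^bsub>M\<^esub> x) y \<oplus>\<^bsub>F\<^esub> pe (a \<odot>\<^bsub>M\<^esub> x) y')"
      by (simp add: ext)
    then show ?thesis using balanced_relsI(2) right a by simp
  next
    case (balanced x r y)
    then have "L f = pe (act (a \<odot>\<^bsub>M\<^esub> x) r) y \<ominus>\<^bsub>F\<^esub> pe (a \<odot>\<^bsub>M\<^esub> x) (r \<odot>\<^bsub>N\<^esub> y)"
      using a by (simp add: ext act_closed smult_closed act_commute)
    then show ?thesis using balanced_relsI(3) balanced a by simp
  qed
  have null: "L f \<in> null" if "f \<in> null" for f
    unfolding L_def
    by (rule linear_ext_span[OF F.module_axioms c balanced_rels_closed null_submodule])
       (use rels rels_subset_null that in \<open>auto simp: L_def balanced_null_def\<close>)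
  show ?thesis
    using induced_map_hom_coset[OF F.module_axioms null_submodule Lh null pe_closed[of x y]] xy
    by (simp add: tensor_def balanced_tensor_def L_def[symmetric] ext)
qed

end

section \<open>Translation of subsets of a finite abelian group\<close>

definition subsets_of_card :: "('g, 'l) monoid_scheme \<Rightarrow> nat \<Rightarrow> 'g set set" where
  "subsets_of_card G m = {S. S \<subseteq> carrier G \<and> card S = m}"

text \<open>A system of representatives for the translation orbits on subsets of size \<open>m\<close> when \<open>m\<close> is coprime
to the group order.\<close>
definition product_one_subsets :: "('g, 'l) monoid_scheme \<Rightarrow> nat \<Rightarrow> 'g set set" where
  "product_one_subsets G m = {S \<in> subsets_of_card G m. finprod G (\<lambda>x. x) S = \<one>\<^bsub>G\<^esub>}"

context comm_group
begin

lemma finprod_translate: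
  assumes "finite S" "S \<subseteq> carrier G" "g \<in> carrier G"
  shows "finprod G (\<lambda>x. x) ((\<lambda>x. g \<otimes> x) ` S) = g [^] card S \<otimes> finprod G (\<lambda>x. x) S"
proof -
  have inj: "inj_on (\<lambda>x. g \<otimes> x) S"
    using assms by (auto simp: inj_on_def subset_iff)
  have "finprod G (\<lambda>x. x) ((\<lambda>x. g \<otimes> x) ` S) = finprod G (\<lambda>x. g \<otimes> x) S"
    by (rule finprod_reindex[OF _ inj]) (use assms in auto)
  also have "\<dots> = finprod G (\<lambda>x. g) S \<otimes> finprod G (\<lambda>x. x) S"
    by (rule finprod_multf) (use assms in auto)
  finally show ?thesis using assms by (simp add: finprod_const)
qed

text \<open>If \<open>m a = 1 + b |G|\<close>, then \<open>x\<^sup>m\<^sup>a = x\<close> by Lagrange. So taking \<open>a\<close>-th powers inverts taking \<open>m\<close>-th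
powers.\<close>

lemma coprime_power_root:
  assumes fin: "finite (carrier G)" and cop: "coprime m (order G)" and ne: "order G \<noteq> 1"
  shows "\<exists>a. \<forall>x \<in> carrier G. (x [^] m) [^] (a :: nat) = x"
proof -
  obtain a b where ab: "m * a = order G * b + 1"
    using coprime_bezout_strong[OF cop ne] by blast
  have "(x [^] m) [^] a = x" if x: "x \<in> carrier G" for x
  proof -
    have "(x [^] m) [^] a = (x [^] order G) [^] b \<otimes> x [^] (1::nat)"
      using x by (simp only: nat_pow_pow nat_pow_mult ab nat_pow_closed)
    also have "x [^] order G = \<one>"
      using power_order_eq_one[OF fin x] by (simp add: order_def)
    finally show ?thesis using x by simp
  qed
  then show ?thesis by blast
qed

lemma translate_translate:
  assumes "g \<in> carrier G" "h \<in> carrier G" "S \<subseteq> carrier G"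
  shows "(\<lambda>x. g \<otimes> x) ` (\<lambda>x. h \<otimes> x) ` S = (\<lambda>x. (g \<otimes> h) \<otimes> x) ` S"
  using assms by (auto simp: image_image m_assoc subset_iff intro!: image_cong)

lemma translate_subsets_of_card:
  assumes "g \<in> carrier G" "S \<in> subsets_of_card G m"
  shows "(\<lambda>x. g \<otimes> x) ` S \<in> subsets_of_card G m"
proof -
  have "inj_on (\<lambda>x. g \<otimes> x) S"
    using assms by (auto simp: inj_on_def subset_iff subsets_of_card_def)
  then show ?thesis
    using assms by (auto simp: subsets_of_card_def card_image)
qed

text \<open>The product of the elements of \<open>gX\<close> is \<open>g\<^sup>m\<close> when those of \<open>X\<close> have product \<open>1\<close>, so \<open>g\<close>, and then
\<open>X\<close>, can be recovered from \<open>gX\<close> by taking an \<open>m\<close>-th root.\<close>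

lemma translate_bij_betw:
  assumes fin: "finite (carrier G)" and cop: "coprime m (order G)" and ne: "order G \<noteq> 1"
  shows "bij_betw (\<lambda>(g, S). (\<lambda>x. g \<otimes> x) ` S) (carrier G \<times> product_one_subsets G m) (subsets_of_card G m)"
proof -
  obtain a :: nat where a: "\<And>x. x \<in> carrier G \<Longrightarrow> (x [^] m) [^] a = x"
    using coprime_power_root[OF assms] by blast
  have a': "(x [^] a) [^] m = x" if "x \<in> carrier G" for x
    using a[OF that] that by (simp add: nat_pow_pow mult.commute)
  \<comment> \<open>The \<open>m\<close>-th root of the product of \<open>S\<close> is the only candidate for the translating element.\<close>
  define r where "r S = finprod G (\<lambda>x. x) S [^] a" for S
  have sub: "finite S" "S \<subseteq> carrier G" "card S = m" if "S \<in> subsets_of_card G m" for S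
    using that fin finite_subset by (auto simp: subsets_of_card_def)
  have prod: "finprod G (\<lambda>x. x) S \<in> carrier G" if "S \<in> subsets_of_card G m" for S
    using sub[OF that] by (intro finprod_closed) auto
  have rc: "r S \<in> carrier G" if "S \<in> subsets_of_card G m" for S
    using prod[OF that] by (simp add: r_def)
  have r_translate: "r ((\<lambda>x. g \<otimes> x) ` S) = g" if "g \<in> carrier G" "S \<in> product_one_subsets G m" for g S
    using that sub[of S] a[of g] by (simp add: r_def product_one_subsets_def finprod_translate)
  have one: "(\<lambda>x. \<one> \<otimes> x) ` S = S" if "S \<subseteq> carrier G" for S
    using that by (auto simp: subset_iff image_iff)
  show ?thesis
  proof (rule bij_betw_byWitness[where f' = "\<lambda>S. (r S, (\<lambda>x. inv (r S) \<otimes> x) ` S)"])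
    show "\<forall>gS \<in> carrier G \<times> product_one_subsets G m.
      (\<lambda>S. (r S, (\<lambda>x. inv (r S) \<otimes> x) ` S)) (case gS of (g, S) \<Rightarrow> (\<lambda>x. g \<otimes> x) ` S) = gS"
      using sub by (auto simp: r_translate product_one_subsets_def translate_translate one)
    show "\<forall>S \<in> subsets_of_card G m. (case (r S, (\<lambda>x. inv (r S) \<otimes> x) ` S) of (g, S) \<Rightarrow> (\<lambda>x. g \<otimes> x) ` S) = S"
      using sub rc by (simp add: translate_translate one)
    show "(\<lambda>(g, S). (\<lambda>x. g \<otimes> x) ` S) ` (carrier G \<times> product_one_subsets G m) \<subseteq> subsets_of_card G m"
      by (auto simp: product_one_subsets_def translate_subsets_of_card simp del: image_iff)
    have "(\<lambda>x. inv (r S) \<otimes> x) ` S \<in> product_one_subsets G m" if S: "S \<in> subsets_of_card G m" for S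
    proof -
      have "finprod G (\<lambda>x. x) ((\<lambda>x. inv (r S) \<otimes> x) ` S) = inv (r S [^] m) \<otimes> finprod G (\<lambda>x. x) S"
        using sub[OF S] rc[OF S] by (simp add: finprod_translate nat_pow_inv)
      also have "r S [^] m = finprod G (\<lambda>x. x) S"
        unfolding r_def by (rule a'[OF prod[OF S]])
      finally show ?thesis
        using translate_subsets_of_card[OF inv_closed[OF rc[OF S]] S] prod[OF S]
        by (simp add: product_one_subsets_def)
    qed
    then show "(\<lambda>S. (r S, (\<lambda>x. inv (r S) \<otimes> x) ` S)) ` subsets_of_card G m
        \<subseteq> carrier G \<times> product_one_subsets G m"
      using rc by auto
  qed
qed

lemma card_product_one_subsets:
  assumes "finite (carrier G)" "coprime m (order G)" "order G \<noteq> 1"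
  shows "order G * card (product_one_subsets G m) = order G choose m"
  using bij_betw_same_card[OF translate_bij_betw[OF assms]] n_subsets[OF assms(1), of m]
  by (simp add: card_cartesian_product order_def subsets_of_card_def)

end

section \<open>The operators on the tensor power of a group algebra\<close>

text \<open>Keeps the index set \<open>{1..n + 1}\<close> in the form in which it occurs in the definitions.\<close>

declare One_nat_def [simp del]

locale group_algebra_tensor = K: cring K + C: comm_group C
  for K :: "('a, 'k) ring_scheme" and C :: "('g, 'l) monoid_scheme" +
  fixes n :: nat
  assumes finite_C: "finite (carrier C)"
begin

abbreviation A where "A \<equiv> group_algebra K C"
abbreviation I where "I \<equiv> {1..n + 1}"
abbreviation T where "T \<equiv> tensor_power K A I"
abbreviation Sym where "Sym \<equiv> sym_group (n + 1)"
abbreviation \<delta> where "\<delta> \<equiv> basis_elem K (carrier C)"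

definition basis_tensor :: "(nat \<Rightarrow> 'g) \<Rightarrow> ((nat \<Rightarrow> 'g \<Rightarrow> 'a) \<Rightarrow> 'a) set" where
  "basis_tensor t = pure_tensor K A I (\<lambda>i\<in>I. \<delta> (t i))"

definition perm_sign :: "(nat \<Rightarrow> nat) \<Rightarrow> 'a" where
  "perm_sign \<pi> = (if evenperm \<pi> then \<one>\<^bsub>K\<^esub> else \<ominus>\<^bsub>K\<^esub> \<one>\<^bsub>K\<^esub>)"

lemma perm_sign_closed [simp]: "perm_sign \<pi> \<in> carrier K"
  by (simp add: perm_sign_def)

sublocale A: module K A
  by (rule module_group_algebra[OF K.is_cring])

sublocale T: module K T
  by (rule tensor_power_module[OF A.module_axioms])

lemma \<delta>_closed [simp]: "\<delta> g \<in> carrier A"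
  using basis_elem_closed[OF K.is_cring] by (simp add: group_algebra_def)

lemma \<delta>_mult:
  assumes "g \<in> carrier C" "h \<in> carrier C"
  shows "\<delta> g \<otimes>\<^bsub>A\<^esub> \<delta> h = \<delta> (g \<otimes>\<^bsub>C\<^esub> h)"
proof -
  have "inv\<^bsub>C\<^esub> g \<otimes>\<^bsub>C\<^esub> x = h \<longleftrightarrow> x = g \<otimes>\<^bsub>C\<^esub> h" if "x \<in> carrier C" for x
    using assms that by (metis C.inv_closed C.inv_solve_left')
  then show ?thesis
    unfolding basis_elem_mult[OF K.is_cring C.is_group finite_C assms(1) \<delta>_closed]
    using assms by (auto simp: basis_elem_def fun_eq_iff restrict_def)
qed

lemma A_generated:
  assumes "LinearCombinations.submodule K W A" "\<And>g. g \<in> carrier C \<Longrightarrow> \<delta> g \<in> W"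
  shows "carrier A \<subseteq> W"
proof -
  interpret F: module K "free_module K (carrier C)" by (rule module_free_module[OF K.is_cring])
  have "LinearCombinations.submodule K W (free_module K (carrier C))"
    using assms(1) F.module_axioms by (simp add: submodule_def group_algebra_def)
  from free_module_generated[OF K.is_cring this assms(2)] show ?thesis
    by (simp add: group_algebra_def)
qed

lemma basis_tensor_closed [simp]: "basis_tensor t \<in> carrier T"
  unfolding basis_tensor_def by (rule pure_tensor_closed[OF A.module_axioms])

text \<open>Replace the entries of a tuple by group elements one position at a time, using linearity in that
entry. The set \<open>J\<close> in the proof holds the positions whose entries are still arbitrary.\<close>

lemma T_generated:
  assumes W: "LinearCombinations.submodule K W T"
    and basis: "\<And>t. t \<in> I \<rightarrow> carrier C \<Longrightarrow> basis_tensor t \<in> W"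
  shows "carrier T \<subseteq> W"
proof (rule tensor_power_generated[OF A.module_axioms W])
  have main: "pure_tensor K A I b \<in> W"
    if "finite J" "J \<subseteq> I" "b \<in> tuples A I" "\<And>i. i \<in> I - J \<Longrightarrow> \<exists>g \<in> carrier C. b i = \<delta> g" for J b
    using that
  proof (induction J arbitrary: b rule: finite_induct)
    case empty
    then obtain t where t: "\<And>i. i \<in> I \<Longrightarrow> t i \<in> carrier C \<and> b i = \<delta> (t i)"
      by simp metis
    have b: "b = (\<lambda>i\<in>I. \<delta> (t i))"
      using empty.prems(2) t by (auto simp: fun_eq_iff restrict_def PiE_iff extensional_def)
    have "basis_tensor t \<in> W"
      by (rule basis) (use t in auto)
    then show ?case
      unfolding b basis_tensor_def .
  next
    case (insert j J)
    have j: "j \<in> I" using insert.prems(1) by blast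
    have h: "(\<lambda>x. pure_tensor K A I (b(j := x))) \<in> module_hom K A T"
      using pure_tensor_multilinear[OF A.module_axioms, of I] insert.prems(2) j
      unfolding multilinear_map_def by blast
    have "carrier A \<subseteq> {x \<in> carrier A. pure_tensor K A I (b(j := x)) \<in> W}"
    proof (rule A_generated[OF preimage_submodule[OF A.module_axioms T.module_axioms h W]])
      fix g assume g: "g \<in> carrier C"
      have "pure_tensor K A I (b(j := \<delta> g)) \<in> W"
        by (rule insert.IH) (use insert.prems insert.hyps g j in \<open>auto intro!: fun_upd_tuple[OF _ j]\<close>)
      then show "\<delta> g \<in> {x \<in> carrier A. pure_tensor K A I (b(j := x)) \<in> W}" by simp
    qed
    moreover have "b j \<in> carrier A" using insert.prems(2) j by blast
    ultimately have "pure_tensor K A I (b(j := b j)) \<in> W" by blast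
    then show ?case by simp
  qed
  fix b assume "b \<in> tuples A I"
  then show "pure_tensor K A I b \<in> W" by (intro main[of I]) auto
qed

lemma T_hom_eqI:
  assumes "module K P" "f \<in> module_hom K T P" "g \<in> module_hom K T P"
    and "\<And>t. t \<in> I \<rightarrow> carrier C \<Longrightarrow> f (basis_tensor t) = g (basis_tensor t)" and "x \<in> carrier T"
  shows "f x = g x"
proof -
  have "carrier T \<subseteq> {x \<in> carrier T. f x = g x}"
    by (rule T_generated[OF equalizer_submodule[OF T.module_axioms assms(1-3)]]) (simp add: assms(4))
  with assms(5) show ?thesis by blast
qed

lemma diag_op_aux:
  assumes g: "g \<in> carrier C"
  shows diag_op_hom: "diag_op K C n g \<in> module_hom K T T"
    and diag_op_pure: "b \<in> tuples A I \<Longrightarrow>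
      diag_op K C n g (pure_tensor K A I b) = pure_tensor K A I (\<lambda>i\<in>I. \<delta> g \<otimes>\<^bsub>A\<^esub> b i)"
proof -
  have ml: "multilinear_map K A I T (\<lambda>b. tensor_null K A I +>\<^bsub>tuple_module K A I\<^esub>
      tuple_elem K A I (\<lambda>i\<in>I. \<delta> g \<otimes>\<^bsub>A\<^esub> b i))"
    using multilinear_map_reindex[OF pure_tensor_multilinear[OF A.module_axioms] permutes_id
        basis_elem_mult_hom[OF K.is_cring C.is_group finite_C g], of I]
    by (simp add: pure_tensor_def)
  have c: "(\<lambda>b. tuple_elem K A I (\<lambda>i\<in>I. \<delta> g \<otimes>\<^bsub>A\<^esub> b i)) \<in> tuples A I \<rightarrow> carrier (tuple_module K A I)"
    by (intro funcsetI basis_elem_closed[OF K.is_cring])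
  show "diag_op K C n g \<in> module_hom K T T"
    unfolding diag_op_def by (rule tensor_map_hom(1)[OF A.module_axioms c ml])
  show "diag_op K C n g (pure_tensor K A I b) = pure_tensor K A I (\<lambda>i\<in>I. \<delta> g \<otimes>\<^bsub>A\<^esub> b i)"
    if "b \<in> tuples A I"
    unfolding diag_op_def tensor_map_hom(2)[OF A.module_axioms c ml that] by (simp add: pure_tensor_def)
qed

lemma basis_tuple: "(\<lambda>i\<in>I. \<delta> (t i)) \<in> tuples A I"
  by auto

lemma basis_tensor_cong: "(\<And>i. i \<in> I \<Longrightarrow> s i = t i) \<Longrightarrow> basis_tensor s = basis_tensor t"
  unfolding basis_tensor_def by (metis (no_types, lifting) restrict_ext)

lemma diag_op_basis:
  assumes "g \<in> carrier C" "t \<in> I \<rightarrow> carrier C"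
  shows "diag_op K C n g (basis_tensor t) = basis_tensor (\<lambda>i. g \<otimes>\<^bsub>C\<^esub> t i)"
proof -
  have "(\<lambda>i\<in>I. \<delta> g \<otimes>\<^bsub>A\<^esub> (\<lambda>i\<in>I. \<delta> (t i)) i) = (\<lambda>i\<in>I. \<delta> (g \<otimes>\<^bsub>C\<^esub> t i))"
    by (rule restrict_ext) (use assms in \<open>simp add: \<delta>_mult Pi_iff\<close>)
  then show ?thesis
    unfolding basis_tensor_def diag_op_pure[OF assms(1) basis_tuple] by simp
qed

sublocale diag: finite_group_representation K T C "diag_op K C n"
proof unfold_locales
  show "finite (carrier C)" by (rule finite_C)
next
  fix g assume "g \<in> carrier C"
  then show "diag_op K C n g \<in> module_hom K T T" by (rule diag_op_hom)
next
  fix x assume x: "x \<in> carrier T"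
  show "diag_op K C n \<one>\<^bsub>C\<^esub> x = x"
  proof (rule T_hom_eqI[OF T.module_axioms diag_op_hom _ _ x])
    show "(\<lambda>x. x) \<in> module_hom K T T" by (simp add: module_hom_def)
    fix t assume "t \<in> I \<rightarrow> carrier C"
    then show "diag_op K C n \<one>\<^bsub>C\<^esub> (basis_tensor t) = basis_tensor t"
      by (auto simp: diag_op_basis Pi_iff intro!: basis_tensor_cong)
  qed simp
next
  fix g h x assume gh: "g \<in> carrier C" "h \<in> carrier C" and x: "x \<in> carrier T"
  show "diag_op K C n (g \<otimes>\<^bsub>C\<^esub> h) x = diag_op K C n g (diag_op K C n h x)"
  proof (rule T_hom_eqI[OF T.module_axioms diag_op_hom module_hom_comp[OF diag_op_hom diag_op_hom] _ x])
    fix t assume t: "t \<in> I \<rightarrow> carrier C"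
    then have "(\<lambda>i. h \<otimes>\<^bsub>C\<^esub> t i) \<in> I \<rightarrow> carrier C" using gh by auto
    then show "diag_op K C n (g \<otimes>\<^bsub>C\<^esub> h) (basis_tensor t) =
        diag_op K C n g (diag_op K C n h (basis_tensor t))"
      using gh t by (auto simp: diag_op_basis C.m_assoc Pi_iff intro!: basis_tensor_cong)
  qed (use gh in simp_all)
qed

lemma T_tilde_module: "module A (T_tilde K C n)"
  using diag.group_algebra_module[OF C.comm_group_axioms] by (simp add: T_tilde_def)

lemma T_tilde_simps:
  "carrier (T_tilde K C n) = carrier T" "\<zero>\<^bsub>T_tilde K C n\<^esub> = \<zero>\<^bsub>T\<^esub>" "add (T_tilde K C n) = add T"
  "smult (T_tilde K C n) = diag.act"
  by (simp_all add: T_tilde_def)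

text \<open>Makes \<open>K\<close>-linear arguments available for modules over the group algebra.\<close>

lemma scalar_act: "c \<in> carrier K \<Longrightarrow> x \<in> carrier T \<Longrightarrow> diag.act (c \<odot>\<^bsub>A\<^esub> \<delta> \<one>\<^bsub>C\<^esub>) x = c \<odot>\<^bsub>T\<^esub> x"
  by (simp add: diag.act_smult_left diag.act_basis diag.act_one)

lemma perm_op_aux:
  assumes \<pi>: "\<pi> permutes I"
  shows perm_op_hom: "perm_op K C n \<pi> \<in> module_hom K T T"
    and perm_op_pure_tensor: "b \<in> tuples A I \<Longrightarrow> perm_op K C n \<pi> (pure_tensor K A I b) =
      perm_sign \<pi> \<odot>\<^bsub>T\<^esub> pure_tensor K A I (\<lambda>i\<in>I. b (\<pi> i))"
proof -
  interpret F: module K "tuple_module K A I" by (rule module_free_module[OF K.is_cring])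
  let ?\<phi> = "\<lambda>b. let e = tuple_elem K A I (\<lambda>i\<in>I. b (\<pi> i))
    in if evenperm \<pi> then e else \<ominus>\<^bsub>tuple_module K A I\<^esub> e"
  have c: "?\<phi> \<in> tuples A I \<rightarrow> carrier (tuple_module K A I)"
    by (intro funcsetI) (simp add: Let_def basis_elem_closed[OF K.is_cring] F.M.a_inv_closed)
  have \<phi>: "?\<phi> b = perm_sign \<pi> \<odot>\<^bsub>tuple_module K A I\<^esub> tuple_elem K A I (\<lambda>i\<in>I. b (\<pi> i))" for b
    by (simp add: perm_sign_def Let_def F.smult_minus_1 basis_elem_closed[OF K.is_cring])
  have \<phi>': "tensor_null K A I +>\<^bsub>tuple_module K A I\<^esub> ?\<phi> b =
      perm_sign \<pi> \<odot>\<^bsub>T\<^esub> pure_tensor K A I (\<lambda>i\<in>I. b (\<pi> i))" for b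
    unfolding \<phi> pure_tensor_def
    by (rule module_hom_smult[OF tensor_projection_hom[OF A.module_axioms]])
       (simp_all add: basis_elem_closed[OF K.is_cring])
  have "(\<lambda>x. perm_sign \<pi> \<odot>\<^bsub>T\<^esub> x) \<in> module_hom K T T"
    by (auto simp: module_hom_def T.smult_r_distr T.smult_assoc1[symmetric] K.m_comm)
  from multilinear_map_comp[OF multilinear_map_reindex[OF pure_tensor_multilinear[OF A.module_axioms] \<pi>, of "\<lambda>i x. x"] this]
  have ml: "multilinear_map K A I T (\<lambda>b. tensor_null K A I +>\<^bsub>tuple_module K A I\<^esub> ?\<phi> b)"
    unfolding \<phi>' by (simp add: module_hom_def)
  show "perm_op K C n \<pi> \<in> module_hom K T T"
    unfolding perm_op_def by (rule tensor_map_hom(1)[OF A.module_axioms c ml])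
  show "perm_op K C n \<pi> (pure_tensor K A I b) =
      perm_sign \<pi> \<odot>\<^bsub>T\<^esub> pure_tensor K A I (\<lambda>i\<in>I. b (\<pi> i))" if "b \<in> tuples A I"
    unfolding perm_op_def tensor_map_hom(2)[OF A.module_axioms c ml that] by (rule \<phi>')
qed

lemma perm_op_basis:
  assumes \<pi>: "\<pi> permutes I"
  shows "perm_op K C n \<pi> (basis_tensor t) = perm_sign \<pi> \<odot>\<^bsub>T\<^esub> basis_tensor (t \<circ> \<pi>)"
proof -
  have "(\<lambda>i\<in>I. (\<lambda>i\<in>I. \<delta> (t i)) (\<pi> i)) = (\<lambda>i\<in>I. \<delta> ((t \<circ> \<pi>) i))"
    using permutes_in_image[OF \<pi>] by (auto simp: fun_eq_iff restrict_def)
  then show ?thesis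
    unfolding basis_tensor_def perm_op_pure_tensor[OF \<pi> basis_tuple] by simp
qed

sublocale perm: linear_operator_family K T Sym "perm_op K C n"
  by unfold_locales (auto simp: sym_group_carrier perm_op_hom, simp add: sym_group_def finite_permutations)

lemma perm_op_id: "x \<in> carrier T \<Longrightarrow> perm_op K C n id x = x"
proof (rule T_hom_eqI[OF T.module_axioms perm_op_hom[OF permutes_id], of "\<lambda>x. x"])
  show "(\<lambda>x. x) \<in> module_hom K T T" by (simp add: module_hom_def)
  show "perm_op K C n id (basis_tensor t) = basis_tensor t" for t
    by (simp add: perm_op_basis[OF permutes_id] perm_sign_def)
qed

lemma diag_perm_commute:
  assumes g: "g \<in> carrier C" and \<pi>: "\<pi> permutes I" and x: "x \<in> carrier T"
  shows "diag_op K C n g (perm_op K C n \<pi> x) = perm_op K C n \<pi> (diag_op K C n g x)"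
proof (rule T_hom_eqI[OF T.module_axioms module_hom_comp[OF perm_op_hom[OF \<pi>] diag_op_hom[OF g]]
      module_hom_comp[OF diag_op_hom[OF g] perm_op_hom[OF \<pi>]] _ x])
  fix t assume t: "t \<in> I \<rightarrow> carrier C"
  have "t \<circ> \<pi> \<in> I \<rightarrow> carrier C"
    using t permutes_in_image[OF \<pi>] by auto
  then show "diag_op K C n g (perm_op K C n \<pi> (basis_tensor t)) =
      perm_op K C n \<pi> (diag_op K C n g (basis_tensor t))"
    using g t by (simp add: perm_op_basis[OF \<pi>] module_hom_smult[OF diag_op_hom] diag_op_basis o_def)
qed

lemma act_commute:
  assumes a: "a \<in> carrier A" and s: "s \<in> carrier (group_algebra K Sym)" and x: "x \<in> carrier T"
  shows "diag.act a (sym_act K C n x s) = sym_act K C n (diag.act a x) s"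
  unfolding sym_act_def
proof (rule perm.commuting_hom_act[OF diag.act_hom[OF a] s x])
  fix \<pi> assume "\<pi> \<in> carrier Sym"
  then have \<pi>: "\<pi> permutes I" by (simp add: sym_group_carrier)
  show "diag.act a (perm_op K C n \<pi> x) = perm_op K C n \<pi> (diag.act a x)"
    by (rule diag.commuting_hom_act[OF perm_op_hom[OF \<pi>] a x, symmetric])
       (simp add: diag_perm_commute[OF _ \<pi> x])
qed

end

section \<open>Determinants as alternating functionals\<close>

definition self_module :: "('a, 'k) ring_scheme \<Rightarrow> ('a, 'a) module" where
  "self_module K = \<lparr>carrier = carrier K, mult = mult K, one = one K, zero = zero K, add = add K, smult = mult K\<rparr>"

lemma self_module_simps [simp]:
  "carrier (self_module K) = carrier K" "\<zero>\<^bsub>self_module K\<^esub> = \<zero>\<^bsub>K\<^esub>"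
  "add (self_module K) = add K" "smult (self_module K) = mult K"
  by (simp_all add: self_module_def)

lemma self_module:
  assumes "cring K"
  shows "module K (self_module K)"
proof -
  interpret cring K by fact
  show ?thesis
    by (rule module_criteria[OF is_cring]) (use r_neg in \<open>auto simp: a_ac m_ac l_distr r_distr\<close>)
qed

lemma finsum_self_module: "finsum (self_module K) f X = finsum K f X"
  by (simp add: finsum_def finprod_def)

text \<open>Linear combinations of linear functionals are linear.\<close>

lemma self_module_functionalI:
  assumes "cring K" "module K M" and "finite X"
    and c: "\<And>\<pi>. \<pi> \<in> X \<Longrightarrow> c \<pi> \<in> carrier K"
    and f: "\<And>\<pi>. \<pi> \<in> X \<Longrightarrow> f \<pi> \<in> module_hom K M (self_module K)"
  shows "(\<lambda>x. \<Oplus>\<^bsub>K\<^esub>\<pi>\<in>X. c \<pi> \<otimes>\<^bsub>K\<^esub> f \<pi> x) \<in> module_hom K M (self_module K)"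
proof -
  interpret K: cring K by fact
  interpret M: module K M by fact
  have fc: "f \<pi> x \<in> carrier K" if "\<pi> \<in> X" "x \<in> carrier M" for \<pi> x
    using module_hom_closed[OF f[OF that(1)]] that(2) by auto
  note add = module_hom_add[OF f, simplified] and smult = module_hom_smult[OF f, simplified]
  show ?thesis
    unfolding module_hom_def
  proof (intro CollectI conjI Pi_I allI impI; (elim conjE)?; unfold self_module_simps)
    fix x y assume x: "x \<in> carrier M" and y: "y \<in> carrier M"
    have "(\<Oplus>\<^bsub>K\<^esub>\<pi>\<in>X. c \<pi> \<otimes>\<^bsub>K\<^esub> f \<pi> (x \<oplus>\<^bsub>M\<^esub> y)) =
        (\<Oplus>\<^bsub>K\<^esub>\<pi>\<in>X. c \<pi> \<otimes>\<^bsub>K\<^esub> f \<pi> x \<oplus>\<^bsub>K\<^esub> c \<pi> \<otimes>\<^bsub>K\<^esub> f \<pi> y)"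
      by (rule K.finsum_cong') (use x y c fc in \<open>auto simp: add K.r_distr\<close>)
    also have "\<dots> = (\<Oplus>\<^bsub>K\<^esub>\<pi>\<in>X. c \<pi> \<otimes>\<^bsub>K\<^esub> f \<pi> x) \<oplus>\<^bsub>K\<^esub> (\<Oplus>\<^bsub>K\<^esub>\<pi>\<in>X. c \<pi> \<otimes>\<^bsub>K\<^esub> f \<pi> y)"
      by (rule K.finsum_addf) (use x y c fc in auto)
    finally show "(\<Oplus>\<^bsub>K\<^esub>\<pi>\<in>X. c \<pi> \<otimes>\<^bsub>K\<^esub> f \<pi> (x \<oplus>\<^bsub>M\<^esub> y)) =
      (\<Oplus>\<^bsub>K\<^esub>\<pi>\<in>X. c \<pi> \<otimes>\<^bsub>K\<^esub> f \<pi> x) \<oplus>\<^bsub>K\<^esub> (\<Oplus>\<^bsub>K\<^esub>\<pi>\<in>X. c \<pi> \<otimes>\<^bsub>K\<^esub> f \<pi> y)" .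
  next
    fix r x assume r: "r \<in> carrier K" and x: "x \<in> carrier M"
    have "(\<Oplus>\<^bsub>K\<^esub>\<pi>\<in>X. c \<pi> \<otimes>\<^bsub>K\<^esub> f \<pi> (r \<odot>\<^bsub>M\<^esub> x)) = (\<Oplus>\<^bsub>K\<^esub>\<pi>\<in>X. r \<otimes>\<^bsub>K\<^esub> (c \<pi> \<otimes>\<^bsub>K\<^esub> f \<pi> x))"
      by (rule K.finsum_cong') (use r x c fc in \<open>auto simp: smult K.m_ac\<close>)
    also have "\<dots> = r \<otimes>\<^bsub>K\<^esub> (\<Oplus>\<^bsub>K\<^esub>\<pi>\<in>X. c \<pi> \<otimes>\<^bsub>K\<^esub> f \<pi> x)"
      by (rule K.finsum_rdistr[symmetric, OF assms(3) r]) (use x c fc in auto)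
    finally show "(\<Oplus>\<^bsub>K\<^esub>\<pi>\<in>X. c \<pi> \<otimes>\<^bsub>K\<^esub> f \<pi> (r \<odot>\<^bsub>M\<^esub> x)) = r \<otimes>\<^bsub>K\<^esub> (\<Oplus>\<^bsub>K\<^esub>\<pi>\<in>X. c \<pi> \<otimes>\<^bsub>K\<^esub> f \<pi> x)" .
  qed (use c fc in auto)
qed

context group_algebra_tensor
begin

text \<open>The determinant of the matrix of coefficients of the elements \<open>b i\<close> at the group elements \<open>t j\<close>.\<close>
definition minor :: "(nat \<Rightarrow> 'g) \<Rightarrow> (nat \<Rightarrow> 'g \<Rightarrow> 'a) \<Rightarrow> 'a" where
  "minor t b = (\<Oplus>\<^bsub>K\<^esub>\<pi>\<in>{\<pi>. \<pi> permutes I}. perm_sign \<pi> \<otimes>\<^bsub>K\<^esub> (\<Otimes>\<^bsub>K\<^esub>i\<in>I. b i (t (\<pi> i))))"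

lemma finite_perms: "finite {\<pi>. \<pi> permutes I}"
  by (simp add: finite_permutations)

lemma A_eval_closed: "a \<in> carrier A \<Longrightarrow> g \<in> carrier C \<Longrightarrow> a g \<in> carrier K"
  by (rule diag.coeff_closed)

lemma minor_multilinear:
  assumes t: "t \<in> I \<rightarrow> carrier C"
  shows "multilinear_map K A I (self_module K) (minor t)"
  unfolding multilinear_map_def
proof (intro conjI Pi_I ballI)
  have tc: "t (\<pi> i) \<in> carrier C" if "\<pi> permutes I" "i \<in> I" for \<pi> i
    using t that permutes_in_image[OF that(1), of i] by blast
  have bc: "b i (t (\<pi> i)) \<in> carrier K" if "b \<in> tuples A I" "\<pi> permutes I" "i \<in> I" for b \<pi> i
    using that tc by (intro A_eval_closed) auto
  show "minor t b \<in> carrier (self_module K)" if "b \<in> tuples A I" for b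
    unfolding minor_def self_module_simps
    by (intro K.finsum_closed Pi_I K.m_closed K.finprod_closed) (use bc[OF that] in auto)
  fix b i assume b: "b \<in> tuples A I" and i: "i \<in> I"
  define c where "c \<pi> = perm_sign \<pi> \<otimes>\<^bsub>K\<^esub> (\<Otimes>\<^bsub>K\<^esub>j\<in>I - {i}. b j (t (\<pi> j)))" for \<pi>
  have cc: "c \<pi> \<in> carrier K" if "\<pi> permutes I" for \<pi>
    unfolding c_def by (intro K.m_closed K.finprod_closed) (use bc[OF b that] in auto)
  have ev: "(\<lambda>x. x (t (\<pi> i))) \<in> module_hom K A (self_module K)" if "\<pi> permutes I" for \<pi>
    using tc[OF that i] by (auto simp: module_hom_def group_algebra_def free_module_def)
  have "minor t (b(i := x)) = (\<Oplus>\<^bsub>K\<^esub>\<pi>\<in>{\<pi>. \<pi> permutes I}. c \<pi> \<otimes>\<^bsub>K\<^esub> x (t (\<pi> i)))" if x: "x \<in> carrier A" for x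
    unfolding minor_def
  proof (rule K.finsum_cong'[OF refl])
    fix \<pi> assume "\<pi> \<in> {\<pi>. \<pi> permutes I}"
    then have \<pi>: "\<pi> permutes I" by simp
    have xc: "x (t (\<pi> i)) \<in> carrier K" using x tc[OF \<pi> i] by (rule A_eval_closed)
    have "(\<Otimes>\<^bsub>K\<^esub>j\<in>I. (b(i := x)) j (t (\<pi> j))) =
        x (t (\<pi> i)) \<otimes>\<^bsub>K\<^esub> (\<Otimes>\<^bsub>K\<^esub>j\<in>I - {i}. (b(i := x)) j (t (\<pi> j)))"
      by (subst K.finprod_split[of _ _ i]) (use i bc[OF b \<pi>] xc in auto)
    also have "(\<Otimes>\<^bsub>K\<^esub>j\<in>I - {i}. (b(i := x)) j (t (\<pi> j))) = (\<Otimes>\<^bsub>K\<^esub>j\<in>I - {i}. b j (t (\<pi> j)))"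
      by (rule K.finprod_cong') (use bc[OF b \<pi>] in auto)
    finally show "perm_sign \<pi> \<otimes>\<^bsub>K\<^esub> (\<Otimes>\<^bsub>K\<^esub>j\<in>I. (b(i := x)) j (t (\<pi> j))) = c \<pi> \<otimes>\<^bsub>K\<^esub> x (t (\<pi> i))"
      using bc[OF b \<pi>] xc by (simp add: c_def K.m_ac K.finprod_closed Pi_def)
  qed (use cc x tc i A_eval_closed in auto)
  moreover have "(\<lambda>x. \<Oplus>\<^bsub>K\<^esub>\<pi>\<in>{\<pi>. \<pi> permutes I}. c \<pi> \<otimes>\<^bsub>K\<^esub> x (t (\<pi> i))) \<in> module_hom K A (self_module K)"
    by (rule self_module_functionalI[OF K.is_cring A.module_axioms finite_perms]) (use cc ev in auto)
  ultimately show "(\<lambda>x. minor t (b(i := x))) \<in> module_hom K A (self_module K)"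
    by (simp add: module_hom_def Pi_def)
qed

text \<open>The minor of a tuple of group elements: the determinant of the 0-1 matrix with entry 1 at \<open>(i, j)\<close>
iff \<open>t j = s i\<close>.\<close>
definition matching_sum :: "(nat \<Rightarrow> 'g) \<Rightarrow> (nat \<Rightarrow> 'g) \<Rightarrow> 'a" where
  "matching_sum t s = (\<Oplus>\<^bsub>K\<^esub>\<pi>\<in>{\<pi>. \<pi> permutes I}.
    perm_sign \<pi> \<otimes>\<^bsub>K\<^esub> (\<Otimes>\<^bsub>K\<^esub>i\<in>I. if t (\<pi> i) = s i then \<one>\<^bsub>K\<^esub> else \<zero>\<^bsub>K\<^esub>))"

lemma minor_basis:
  assumes t: "t \<in> I \<rightarrow> carrier C"
  shows "minor t (\<lambda>i\<in>I. \<delta> (s i)) = matching_sum t s"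
  unfolding minor_def matching_sum_def
proof (rule K.finsum_cong'[OF refl])
  fix \<pi> assume "\<pi> \<in> {\<pi>. \<pi> permutes I}"
  then have \<pi>: "\<pi> permutes I" by simp
  have "(\<Otimes>\<^bsub>K\<^esub>i\<in>I. (\<lambda>i\<in>I. \<delta> (s i)) i (t (\<pi> i))) = (\<Otimes>\<^bsub>K\<^esub>i\<in>I. if t (\<pi> i) = s i then \<one>\<^bsub>K\<^esub> else \<zero>\<^bsub>K\<^esub>)"
    by (rule K.finprod_cong') (use t permutes_in_image[OF \<pi>] in \<open>auto simp: basis_elem_def Pi_iff\<close>)
  then show "perm_sign \<pi> \<otimes>\<^bsub>K\<^esub> (\<Otimes>\<^bsub>K\<^esub>i\<in>I. (\<lambda>i\<in>I. \<delta> (s i)) i (t (\<pi> i))) =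
    perm_sign \<pi> \<otimes>\<^bsub>K\<^esub> (\<Otimes>\<^bsub>K\<^esub>i\<in>I. if t (\<pi> i) = s i then \<one>\<^bsub>K\<^esub> else \<zero>\<^bsub>K\<^esub>)"
    by simp
qed (auto intro!: K.finprod_closed)

lemma perm_sign_comp:
  assumes "\<pi> permutes I" "\<sigma> permutes I"
  shows "perm_sign (\<pi> \<circ> \<sigma>) = perm_sign \<pi> \<otimes>\<^bsub>K\<^esub> perm_sign \<sigma>"
  using evenperm_comp[of \<pi> \<sigma>] assms permutation_permutes[of \<pi>] permutation_permutes[of \<sigma>]
  by (auto simp: perm_sign_def K.l_minus K.r_minus)

lemma perm_sign_square: "perm_sign \<sigma> \<otimes>\<^bsub>K\<^esub> perm_sign \<sigma> = \<one>\<^bsub>K\<^esub>"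
  by (simp add: perm_sign_def K.l_minus K.r_minus)

lemma matching_sum_closed [simp]: "matching_sum t s \<in> carrier K"
  unfolding matching_sum_def by (intro K.finsum_closed Pi_I K.m_closed K.finprod_closed) auto

text \<open>Permuting the rows of a matrix multiplies its determinant by the sign, which is its own inverse.\<close>

lemma matching_sum_perm:
  assumes \<sigma>: "\<sigma> permutes I"
  shows "perm_sign \<sigma> \<otimes>\<^bsub>K\<^esub> matching_sum t (s \<circ> \<sigma>) = matching_sum t s"
proof -
  define m where "m s \<pi> = (\<Otimes>\<^bsub>K\<^esub>i\<in>I. if t (\<pi> i) = s i then \<one>\<^bsub>K\<^esub> else \<zero>\<^bsub>K\<^esub>)" for s \<pi>
  have mc [simp]: "m s \<pi> \<in> carrier K" for s \<pi>
    unfolding m_def by (rule K.finprod_closed) auto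
  have m\<sigma>: "m (s \<circ> \<sigma>) (\<pi> \<circ> \<sigma>) = m s \<pi>" for \<pi>
    unfolding m_def by (subst (2) K.finprod_permute[OF \<sigma>]) (auto simp: o_def)
  have "matching_sum t (s \<circ> \<sigma>) = (\<Oplus>\<^bsub>K\<^esub>\<pi>\<in>{\<pi>. \<pi> permutes I}. perm_sign \<pi> \<otimes>\<^bsub>K\<^esub> m (s \<circ> \<sigma>) \<pi>)"
    by (simp add: matching_sum_def m_def)
  also have "\<dots> = (\<Oplus>\<^bsub>K\<^esub>\<pi>\<in>{\<pi>. \<pi> permutes I}. perm_sign (\<pi> \<circ> \<sigma>) \<otimes>\<^bsub>K\<^esub> m (s \<circ> \<sigma>) (\<pi> \<circ> \<sigma>))"
    by (rule K.finsum_permutations_compose_right[OF \<sigma>]) auto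
  also have "\<dots> = (\<Oplus>\<^bsub>K\<^esub>\<pi>\<in>{\<pi>. \<pi> permutes I}. perm_sign \<sigma> \<otimes>\<^bsub>K\<^esub> (perm_sign \<pi> \<otimes>\<^bsub>K\<^esub> m s \<pi>))"
    by (rule K.finsum_cong') (auto simp: perm_sign_comp[OF _ \<sigma>] m\<sigma> K.m_ac)
  also have "\<dots> = perm_sign \<sigma> \<otimes>\<^bsub>K\<^esub> matching_sum t s"
    unfolding matching_sum_def m_def[symmetric]
    by (rule K.finsum_rdistr[symmetric, OF finite_perms]) auto
  finally show ?thesis
    by (simp add: K.m_assoc[symmetric] perm_sign_square)
qed

text \<open>For an injective \<open>t\<close> the 0-1 matrix is the identity matrix.\<close>

lemma matching_sum_self:
  assumes inj: "inj_on t I" and eq: "\<And>i. i \<in> I \<Longrightarrow> s i = t i"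
  shows "matching_sum t s = \<one>\<^bsub>K\<^esub>"
proof -
  have "(\<Otimes>\<^bsub>K\<^esub>i\<in>I. if t (\<pi> i) = s i then \<one>\<^bsub>K\<^esub> else \<zero>\<^bsub>K\<^esub>) = (if id = \<pi> then \<one>\<^bsub>K\<^esub> else \<zero>\<^bsub>K\<^esub>)"
    if \<pi>: "\<pi> permutes I" for \<pi>
  proof (cases "\<pi> = id")
    case True
    then show ?thesis by (auto simp: eq intro!: K.finprod_one_eqI)
  next
    case False
    then obtain i where i: "\<pi> i \<noteq> i" by (auto simp: fun_eq_iff)
    then have iI: "i \<in> I" using \<pi> by (meson permutes_not_in)
    then have "t (\<pi> i) \<noteq> s i"
      using inj_onD[OF inj, of "\<pi> i" i] i eq[OF iI] permutes_in_image[OF \<pi>, of i] by metis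
    then show ?thesis
      using iI False by (subst K.finprod_zero) auto
  qed
  then have "matching_sum t s = (\<Oplus>\<^bsub>K\<^esub>\<pi>\<in>{\<pi>. \<pi> permutes I}. if id = \<pi> then perm_sign \<pi> else \<zero>\<^bsub>K\<^esub>)"
    unfolding matching_sum_def by (intro K.finsum_cong') auto
  also have "\<dots> = perm_sign id"
    by (rule K.finsum_singleton[OF _ finite_perms]) (auto simp: permutes_id)
  finally show ?thesis by (simp add: perm_sign_def)
qed

text \<open>A nonzero summand would express \<open>s\<close> as \<open>t\<close> composed with a permutation.\<close>

lemma matching_sum_zero:
  assumes "t ` I \<noteq> s ` I"
  shows "matching_sum t s = \<zero>\<^bsub>K\<^esub>"
  unfolding matching_sum_def
proof (rule K.add.finprod_one_eqI)
  fix \<pi> assume "\<pi> \<in> {\<pi>. \<pi> permutes I}"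
  then have \<pi>: "\<pi> permutes I" by simp
  have "\<exists>i \<in> I. t (\<pi> i) \<noteq> s i"
  proof (rule ccontr)
    assume "\<not> ?thesis"
    then have "s ` I = t ` \<pi> ` I" by (auto simp: image_image)
    then show False using assms by (simp add: permutes_image[OF \<pi>])
  qed
  then have "(\<Otimes>\<^bsub>K\<^esub>i\<in>I. if t (\<pi> i) = s i then \<one>\<^bsub>K\<^esub> else \<zero>\<^bsub>K\<^esub>) = \<zero>\<^bsub>K\<^esub>"
    by (intro K.finprod_zero) auto
  then show "perm_sign \<pi> \<otimes>\<^bsub>K\<^esub> (\<Otimes>\<^bsub>K\<^esub>i\<in>I. if t (\<pi> i) = s i then \<one>\<^bsub>K\<^esub> else \<zero>\<^bsub>K\<^esub>) = \<zero>\<^bsub>K\<^esub>"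
    by simp
qed

lemma alternating_functional:
  assumes t: "t \<in> I \<rightarrow> carrier C"
  obtains f where "f \<in> module_hom K T (self_module K)"
    and "\<And>s. f (basis_tensor s) = matching_sum t s"
    and "\<And>\<pi> x. \<pi> permutes I \<Longrightarrow> x \<in> carrier T \<Longrightarrow> f (perm_op K C n \<pi> x) = f x"
proof -
  note KM = self_module[OF K.is_cring]
  obtain f where f: "f \<in> module_hom K T (self_module K)"
    and fp: "\<forall>b \<in> tuples A I. f (pure_tensor K A I b) = minor t b"
    using tensor_lift[OF A.module_axioms KM minor_multilinear[OF t]] by blast
  have fb: "f (basis_tensor s) = matching_sum t s" for s
    unfolding basis_tensor_def using fp basis_tuple minor_basis[OF t] by metis
  have inv: "f (perm_op K C n \<pi> x) = f x" if \<pi>: "\<pi> permutes I" and x: "x \<in> carrier T" for \<pi> x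
  proof (rule T_hom_eqI[OF KM module_hom_comp[OF perm_op_hom[OF \<pi>] f] f _ x])
    fix s
    show "f (perm_op K C n \<pi> (basis_tensor s)) = f (basis_tensor s)"
      unfolding perm_op_basis[OF \<pi>]
      by (simp add: module_hom_smult[OF f] fb matching_sum_perm[OF \<pi>])
  qed
  from f fb inv show ?thesis by (rule that)
qed

end

section \<open>The projection onto the coinvariants\<close>

context group_algebra_tensor
begin

abbreviation triv where "triv \<equiv> trivial_module K Sym"

lemma finite_Sym: "finite (carrier Sym)"
  by (rule perm.finite_group)

lemma triv_simps:
  "carrier triv = carrier K" "add triv = add K" "\<zero>\<^bsub>triv\<^esub> = \<zero>\<^bsub>K\<^esub>"
  by (simp_all add: trivial_module_def)

lemma triv_smult:
  assumes "s \<in> carrier (group_algebra K Sym)"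
  shows "s \<odot>\<^bsub>triv\<^esub> c = (\<Oplus>\<^bsub>K\<^esub>\<pi>\<in>carrier Sym. s \<pi>) \<otimes>\<^bsub>K\<^esub> c"
proof -
  have "fsupp_sum K s (carrier Sym) = finsum K s (carrier Sym)"
    by (rule K.add.gfinprod_eq_finprod[OF finite_Sym]) (use perm.coeff_closed[OF assms] in auto)
  then show ?thesis by (simp add: trivial_module_def)
qed

sublocale B: balanced_bimodule A "T_tilde K C n" "group_algebra K Sym" triv "sym_act K C n"
proof (intro balanced_bimodule.intro balanced_bimodule_axioms.intro T_tilde_module)
  show "abelian_group triv"
    by (rule abelian_groupI) (auto simp: triv_simps K.a_ac intro: K.add.l_inv_ex)
  show "sym_act K C n x r \<in> carrier (T_tilde K C n)"
    if "x \<in> carrier (T_tilde K C n)" "r \<in> carrier (group_algebra K Sym)" for x r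
    using perm.act_closed[OF that(2)] that(1) by (simp add: T_tilde_simps sym_act_def)
  show "r \<odot>\<^bsub>triv\<^esub> y \<in> carrier triv"
    if r: "r \<in> carrier (group_algebra K Sym)" and y: "y \<in> carrier triv" for r y
  proof -
    have "(\<Oplus>\<^bsub>K\<^esub>\<pi>\<in>carrier Sym. r \<pi>) \<in> carrier K"
      by (rule K.finsum_closed) (use perm.coeff_closed[OF r] in auto)
    then show ?thesis using y by (simp add: triv_smult[OF r] triv_simps)
  qed
  show "a \<odot>\<^bsub>T_tilde K C n\<^esub> sym_act K C n x r = sym_act K C n (a \<odot>\<^bsub>T_tilde K C n\<^esub> x) r"
    if "a \<in> carrier A" "x \<in> carrier (T_tilde K C n)" "r \<in> carrier (group_algebra K Sym)" for a x r
    using act_commute[OF that(1,3)] that(2) by (simp add: T_tilde_simps)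
qed

abbreviation S where "S \<equiv> S_tilde K C n"

lemma S_eq: "S = B.BT"
  by (simp add: S_tilde_def)

definition \<theta> :: "((nat \<Rightarrow> 'g \<Rightarrow> 'a) \<Rightarrow> 'a) set \<Rightarrow> (((nat \<Rightarrow> 'g \<Rightarrow> 'a) \<Rightarrow> 'a) set \<times> 'a \<Rightarrow> int) set" where
  "\<theta> x = B.tensor x \<one>\<^bsub>K\<^esub>"

lemma \<theta>_closed [simp]: "\<theta> x \<in> carrier S"
  by (simp add: \<theta>_def S_eq)

lemma \<theta>_add: "x \<in> carrier T \<Longrightarrow> y \<in> carrier T \<Longrightarrow> \<theta> (x \<oplus>\<^bsub>T\<^esub> y) = \<theta> x \<oplus>\<^bsub>S\<^esub> \<theta> y"
  using B.tensor_add_left[of x y "\<one>\<^bsub>K\<^esub>"] by (simp add: \<theta>_def S_eq T_tilde_simps triv_simps)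

lemma \<theta>_act: "a \<in> carrier A \<Longrightarrow> x \<in> carrier T \<Longrightarrow> \<theta> (diag.act a x) = a \<odot>\<^bsub>S\<^esub> \<theta> x"
  using B.BT_smult_tensor[of a x "\<one>\<^bsub>K\<^esub>"] by (simp add: \<theta>_def S_eq T_tilde_simps triv_simps)

lemma sum_scaled_basis:
  assumes "y \<in> carrier K" "\<pi> \<in> carrier Sym"
  shows "(\<Oplus>\<^bsub>K\<^esub>\<tau>\<in>carrier Sym. (y \<odot>\<^bsub>group_algebra K Sym\<^esub> basis_elem K (carrier Sym) \<pi>) \<tau>) = y"
proof -
  have "(\<Oplus>\<^bsub>K\<^esub>\<tau>\<in>carrier Sym. (y \<odot>\<^bsub>group_algebra K Sym\<^esub> basis_elem K (carrier Sym) \<pi>) \<tau>) =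
      (\<Oplus>\<^bsub>K\<^esub>\<tau>\<in>carrier Sym. if \<pi> = \<tau> then y else \<zero>\<^bsub>K\<^esub>)"
    by (rule K.finsum_cong') (use assms in \<open>auto simp: group_algebra_def free_module_def basis_elem_def\<close>)
  also have "\<dots> = y"
    using K.finsum_singleton[OF assms(2) finite_Sym, of "\<lambda>_. y"] assms(1) by simp
  finally show ?thesis .
qed

lemma sym_basis_closed: "basis_elem K (carrier Sym) \<pi> \<in> carrier (group_algebra K Sym)"
  using basis_elem_closed[OF K.is_cring] by (simp add: group_algebra_def)

lemma sym_act_scaled_basis:
  assumes "y \<in> carrier K" "\<pi> permutes I" "x \<in> carrier T"
  shows "sym_act K C n x (y \<odot>\<^bsub>group_algebra K Sym\<^esub> basis_elem K (carrier Sym) \<pi>) =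
    y \<odot>\<^bsub>T\<^esub> perm_op K C n \<pi> x"
  using assms by (simp add: sym_act_def perm.act_smult_left sym_basis_closed perm.act_basis sym_group_carrier)

text \<open>Balancedness for the multiple \<open>y\<cdot>\<pi>\<close> of a group element, which acts on the trivial module as
multiplication by \<open>y\<close>. With \<open>\<pi> = id\<close> it moves the scalar to the left, so that every pure tensor is
in the image of \<open>\<theta>\<close>; with \<open>y = 1\<close> it gives the invariance of \<open>\<theta>\<close> under the signed action.\<close>

lemma tensor_perm:
  assumes y: "y \<in> carrier K" and \<pi>: "\<pi> permutes I" and x: "x \<in> carrier T"
  shows "B.tensor x y = \<theta> (y \<odot>\<^bsub>T\<^esub> perm_op K C n \<pi> x)"
proof -
  interpret AS: module K "group_algebra K Sym" by (rule module_group_algebra[OF K.is_cring])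
  let ?r = "y \<odot>\<^bsub>group_algebra K Sym\<^esub> basis_elem K (carrier Sym) \<pi>"
  have \<pi>': "\<pi> \<in> carrier Sym" using \<pi> by (simp add: sym_group_carrier)
  have r: "?r \<in> carrier (group_algebra K Sym)"
    using y sym_basis_closed by (rule AS.smult_closed)
  have "\<theta> (sym_act K C n x ?r) = B.tensor x (?r \<odot>\<^bsub>triv\<^esub> \<one>\<^bsub>K\<^esub>)"
    unfolding \<theta>_def by (rule B.tensor_balanced) (use x r in \<open>simp_all add: T_tilde_simps triv_simps\<close>)
  then show ?thesis
    using y by (simp add: sym_act_scaled_basis[OF y \<pi> x] triv_smult[OF r] sum_scaled_basis[OF y \<pi>'])
qed

lemma \<theta>_perm:
  assumes "\<pi> permutes I" "x \<in> carrier T"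
  shows "\<theta> (perm_op K C n \<pi> x) = \<theta> x"
proof -
  have "perm_op K C n \<pi> x \<in> carrier T"
    using perm.rho_closed assms by (simp add: sym_group_carrier)
  then show ?thesis
    using tensor_perm[OF K.one_closed assms] by (simp add: \<theta>_def)
qed

lemma \<theta>_zero: "\<theta> \<zero>\<^bsub>T\<^esub> = \<zero>\<^bsub>S\<^esub>"
proof -
  have "\<theta> \<zero>\<^bsub>T\<^esub> \<oplus>\<^bsub>B.Q\<^esub> \<theta> \<zero>\<^bsub>T\<^esub> = \<theta> \<zero>\<^bsub>T\<^esub>"
    using \<theta>_add[of "\<zero>\<^bsub>T\<^esub>" "\<zero>\<^bsub>T\<^esub>"] by (simp add: S_eq B.BT_simps)
  then show ?thesis
    using \<theta>_closed[of "\<zero>\<^bsub>T\<^esub>"] B.Q.M.add.l_cancel_one[of "\<theta> \<zero>\<^bsub>T\<^esub>" "\<theta> \<zero>\<^bsub>T\<^esub>"]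
    by (simp add: S_eq B.BT_simps)
qed

lemma \<theta>_surj: "\<theta> ` carrier T = carrier S"
proof
  have "LinearCombinations.submodule \<Z> (\<theta> ` carrier T) B.Q"
  proof (rule int_submoduleI[OF B.Q.module_axioms])
    show sub: "\<theta> ` carrier T \<subseteq> carrier B.Q"
      using \<theta>_closed by (auto simp: S_eq B.BT_simps)
    show "\<zero>\<^bsub>B.Q\<^esub> \<in> \<theta> ` carrier T"
      using \<theta>_zero T.zero_closed by (metis S_eq B.BT_simps(2) imageI)
    show "u \<oplus>\<^bsub>B.Q\<^esub> v \<in> \<theta> ` carrier T" if "u \<in> \<theta> ` carrier T" "v \<in> \<theta> ` carrier T" for u v
      using that \<theta>_add T.a_closed by (auto simp: S_eq B.BT_simps intro!: image_eqI[of _ _ "_ \<oplus>\<^bsub>T\<^esub> _"])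
    fix u assume "u \<in> \<theta> ` carrier T"
    then obtain x where x: "x \<in> carrier T" "u = \<theta> x" by blast
    have "\<theta> (\<ominus>\<^bsub>T\<^esub> x) \<oplus>\<^bsub>B.Q\<^esub> u = \<zero>\<^bsub>B.Q\<^esub>"
      using \<theta>_add[of "\<ominus>\<^bsub>T\<^esub> x" x] \<theta>_zero x by (simp add: S_eq B.BT_simps T.M.l_neg)
    then have "\<ominus>\<^bsub>B.Q\<^esub> u = \<theta> (\<ominus>\<^bsub>T\<^esub> x)"
      using \<theta>_closed by (intro B.Q.M.minus_equality) (simp_all add: x S_eq B.BT_simps)
    then show "\<ominus>\<^bsub>B.Q\<^esub> u \<in> \<theta> ` carrier T" using x by simp
  qed
  then show "carrier S \<subseteq> \<theta> ` carrier T"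
    unfolding S_eq
  proof (rule B.BT_generated)
    fix x y assume "x \<in> carrier (T_tilde K C n)" "y \<in> carrier triv"
    then show "B.tensor x y \<in> \<theta> ` carrier T"
      using tensor_perm[OF _ permutes_id, of y x] by (simp add: T_tilde_simps triv_simps perm_op_id)
  qed
qed auto

lemma S_module: "module A S"
  by (rule module_surjective_image[OF T_tilde_module, of \<theta>])
     (simp_all add: T_tilde_simps \<theta>_surj \<theta>_zero \<theta>_add \<theta>_act)

lemma \<theta>_hom: "\<theta> \<in> module_hom A (T_tilde K C n) S"
  by (simp add: module_hom_def T_tilde_simps \<theta>_add \<theta>_act)

text \<open>For an invariant functional \<open>f\<close>, the map \<open>(x, y) \<mapsto> f x \<cdot> y\<close> is balanced: an element of the group
algebra of the symmetric group acts on values of \<open>f\<close> through the sum of its coefficients, as it does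
on the trivial module.\<close>

lemma \<theta>_kernel:
  assumes f: "f \<in> module_hom K T (self_module K)"
    and inv: "\<And>\<pi> x. \<pi> permutes I \<Longrightarrow> x \<in> carrier T \<Longrightarrow> f (perm_op K C n \<pi> x) = f x"
    and x: "x \<in> carrier T" and zero: "\<theta> x = \<zero>\<^bsub>S\<^esub>"
  shows "f x = \<zero>\<^bsub>K\<^esub>"
proof -
  have fc [simp]: "f y \<in> carrier K" if "y \<in> carrier T" for y
    using module_hom_closed[OF f] that by auto
  have fadd: "f (y \<oplus>\<^bsub>T\<^esub> z) = f y \<oplus>\<^bsub>K\<^esub> f z" if "y \<in> carrier T" "z \<in> carrier T" for y z
    using module_hom_add[OF f that] by simp
  have fact: "f (sym_act K C n y r) = (\<Oplus>\<^bsub>K\<^esub>\<pi>\<in>carrier Sym. r \<pi>) \<otimes>\<^bsub>K\<^esub> f y"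
    if y: "y \<in> carrier T" and r: "r \<in> carrier (group_algebra K Sym)" for y r
  proof -
    have "f (sym_act K C n y r) = (\<Oplus>\<^bsub>K\<^esub>\<pi>\<in>carrier Sym. r \<pi> \<otimes>\<^bsub>K\<^esub> f (perm_op K C n \<pi> y))"
      unfolding sym_act_def using perm.hom_act[OF self_module[OF K.is_cring] f r y] by (simp add: finsum_self_module)
    also have "\<dots> = (\<Oplus>\<^bsub>K\<^esub>\<pi>\<in>carrier Sym. r \<pi> \<otimes>\<^bsub>K\<^esub> f y)"
      by (rule K.finsum_cong') (use perm.coeff_closed[OF r] y in \<open>auto simp: inv sym_group_carrier\<close>)
    also have "\<dots> = (\<Oplus>\<^bsub>K\<^esub>\<pi>\<in>carrier Sym. r \<pi>) \<otimes>\<^bsub>K\<^esub> f y"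
      by (rule K.finsum_ldistr[symmetric, OF finite_Sym]) (use perm.coeff_closed[OF r] y in auto)
    finally show ?thesis .
  qed
  have "f x \<otimes>\<^bsub>K\<^esub> \<one>\<^bsub>K\<^esub> = \<zero>\<^bsub>K\<^esub>"
  proof (rule B.biadditive_kills_null[OF K.abelian_group_axioms, of "\<lambda>x y. f x \<otimes>\<^bsub>K\<^esub> y"])
    fix y r z assume y: "y \<in> carrier (T_tilde K C n)" and r: "r \<in> carrier (group_algebra K Sym)"
      and z: "z \<in> carrier triv"
    have "(\<Oplus>\<^bsub>K\<^esub>\<pi>\<in>carrier Sym. r \<pi>) \<in> carrier K"
      by (rule K.finsum_closed) (use perm.coeff_closed[OF r] in auto)
    then show "f (sym_act K C n y r) \<otimes>\<^bsub>K\<^esub> z = f y \<otimes>\<^bsub>K\<^esub> (r \<odot>\<^bsub>triv\<^esub> z)"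
      using y z r by (simp add: T_tilde_simps triv_simps fact triv_smult K.m_ac)
  qed (use x zero in \<open>auto simp: T_tilde_simps triv_simps fadd K.l_distr K.r_distr \<theta>_def S_eq\<close>)
  then show ?thesis using x by simp
qed

end

section \<open>The basis\<close>

lemma bij_betw_eq_comp_permutation:
  assumes f: "bij_betw f J R" and h: "bij_betw h J R"
  obtains \<pi> where "\<pi> permutes J" "\<And>i. i \<in> J \<Longrightarrow> h i = f (\<pi> i)"
proof
  define \<pi> where "\<pi> i = (if i \<in> J then inv_into J f (h i) else i)" for i
  have "bij_betw (inv_into J f \<circ> h) J J"
    by (rule bij_betw_trans[OF h bij_betw_inv_into[OF f]])
  then have "bij_betw \<pi> J J"
    by (subst bij_betw_cong[where g = "inv_into J f \<circ> h"]) (auto simp: \<pi>_def)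
  then show "\<pi> permutes J"
    by (rule bij_imp_permutes) (simp add: \<pi>_def)
  show "h i = f (\<pi> i)" if "i \<in> J" for i
    using that bij_betw_apply[OF h that] bij_betw_imp_surj_on[OF f] by (simp add: \<pi>_def f_inv_into_f)
qed

text \<open>The additive order of \<open>1\<close> would divide \<open>2\<close>.\<close>

lemma odd_characteristic_two_nonzero: 
  "ring_characteristic K = p \<Longrightarrow> field K \<Longrightarrow> prime p \<Longrightarrow> odd p \<Longrightarrow> \<one>\<^bsub>K\<^esub> \<oplus>\<^bsub>K\<^esub> \<one>\<^bsub>K\<^esub> \<noteq> \<zero>\<^bsub>K\<^esub>"
proof
  assume char: "ring_characteristic K = p" and K: "field K" and p: "prime p" "odd p"
    and eq: "\<one>\<^bsub>K\<^esub> \<oplus>\<^bsub>K\<^esub> \<one>\<^bsub>K\<^esub> = \<zero>\<^bsub>K\<^esub>"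
  interpret field K by fact
  have "\<one>\<^bsub>K\<^esub> [^]\<^bsub>add_monoid K\<^esub> (2::nat) = \<one>\<^bsub>add_monoid K\<^esub>"
    using eq by (simp add: numeral_2_eq_2)
  then have "group.ord (add_monoid K) \<one>\<^bsub>K\<^esub> dvd 2"
    using add.pow_eq_id[of "\<one>\<^bsub>K\<^esub>" 2] by (simp add: add_pow_def)
  then have "p dvd 2" using char by (simp add: ring_characteristic_def)
  then show False using p by (metis primes_dvd_imp_eq two_is_prime_nat dvd_refl)
qed

locale exterior_power = group_algebra_tensor K C n + field K
  for K :: "('a, 'k) ring_scheme" and C :: "('g, 'l) monoid_scheme" and n :: nat +
  assumes two_nonzero: "\<one>\<^bsub>K\<^esub> \<oplus>\<^bsub>K\<^esub> \<one>\<^bsub>K\<^esub> \<noteq> \<zero>\<^bsub>K\<^esub>"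
    and coprime: "coprime (n + 1) (order C)" and nontrivial: "order C \<noteq> 1"
begin

sublocale S: module A S by (rule S_module)

lemma \<theta>_scale:
  assumes "c \<in> carrier K" "x \<in> carrier T"
  shows "\<theta> (c \<odot>\<^bsub>T\<^esub> x) = (c \<odot>\<^bsub>A\<^esub> \<delta> \<one>\<^bsub>C\<^esub>) \<odot>\<^bsub>S\<^esub> \<theta> x"
  using \<theta>_act[of "c \<odot>\<^bsub>A\<^esub> \<delta> \<one>\<^bsub>C\<^esub>" x] assms by (simp add: scalar_act)

text \<open>The transposition of two equal entries fixes the tensor and changes its sign, so twice its image
is \<open>0\<close>.\<close>

lemma \<theta>_basis_repeated:
  assumes "\<not> inj_on t I"
  shows "\<theta> (basis_tensor t) = \<zero>\<^bsub>S\<^esub>"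
proof -
  obtain i j where ij: "i \<in> I" "j \<in> I" "i \<noteq> j" "t i = t j"
    using assms by (auto simp: inj_on_def)
  define \<pi> where "\<pi> = Transposition.transpose i j"
  have \<pi>: "\<pi> permutes I" unfolding \<pi>_def using ij by (intro permutes_swap_id)
  have odd: "perm_sign \<pi> = \<ominus>\<^bsub>K\<^esub> \<one>\<^bsub>K\<^esub>" using ij by (simp add: perm_sign_def \<pi>_def evenperm_swap)
  have "t \<circ> \<pi> = t" using ij by (auto simp: \<pi>_def transpose_def)
  then have "\<theta> (basis_tensor t) = \<theta> ((\<ominus>\<^bsub>K\<^esub> \<one>\<^bsub>K\<^esub>) \<odot>\<^bsub>T\<^esub> basis_tensor t)"
    using \<theta>_perm[OF \<pi> basis_tensor_closed[of t]] perm_op_basis[OF \<pi>, of t] odd by simp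
  moreover have "\<theta> (((\<one>\<^bsub>K\<^esub> \<oplus>\<^bsub>K\<^esub> \<one>\<^bsub>K\<^esub>) \<odot>\<^bsub>T\<^esub> basis_tensor t)) = \<theta> (basis_tensor t) \<oplus>\<^bsub>S\<^esub> \<theta> (basis_tensor t)"
    by (simp add: T.smult_l_distr \<theta>_add)
  moreover have "\<theta> (basis_tensor t) \<oplus>\<^bsub>S\<^esub> \<theta> ((\<ominus>\<^bsub>K\<^esub> \<one>\<^bsub>K\<^esub>) \<odot>\<^bsub>T\<^esub> basis_tensor t) = \<zero>\<^bsub>S\<^esub>"
    by (simp add: \<theta>_add[symmetric] T.smult_l_minus T.M.r_neg \<theta>_zero)
  ultimately have two: "\<theta> (((\<one>\<^bsub>K\<^esub> \<oplus>\<^bsub>K\<^esub> \<one>\<^bsub>K\<^esub>) \<odot>\<^bsub>T\<^esub> basis_tensor t)) = \<zero>\<^bsub>S\<^esub>"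
    by simp
  define h where "h = inv\<^bsub>K\<^esub> (\<one>\<^bsub>K\<^esub> \<oplus>\<^bsub>K\<^esub> \<one>\<^bsub>K\<^esub>)"
  have unit: "\<one>\<^bsub>K\<^esub> \<oplus>\<^bsub>K\<^esub> \<one>\<^bsub>K\<^esub> \<in> Units K"
    using two_nonzero by (simp add: field_Units)
  have h: "h \<in> carrier K" "h \<otimes>\<^bsub>K\<^esub> (\<one>\<^bsub>K\<^esub> \<oplus>\<^bsub>K\<^esub> \<one>\<^bsub>K\<^esub>) = \<one>\<^bsub>K\<^esub>"
    unfolding h_def using K.Units_l_inv[OF unit] K.Units_inv_closed[OF unit] by auto
  have "\<theta> (basis_tensor t) = \<theta> (h \<odot>\<^bsub>T\<^esub> ((\<one>\<^bsub>K\<^esub> \<oplus>\<^bsub>K\<^esub> \<one>\<^bsub>K\<^esub>) \<odot>\<^bsub>T\<^esub> basis_tensor t))"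
    using h by (simp add: T.smult_assoc1[symmetric])
  also have "\<dots> = (h \<odot>\<^bsub>A\<^esub> \<delta> \<one>\<^bsub>C\<^esub>) \<odot>\<^bsub>S\<^esub> \<theta> ((\<one>\<^bsub>K\<^esub> \<oplus>\<^bsub>K\<^esub> \<one>\<^bsub>K\<^esub>) \<odot>\<^bsub>T\<^esub> basis_tensor t)"
    using h(1) by (intro \<theta>_scale) auto
  also have "\<dots> = \<zero>\<^bsub>S\<^esub>"
    unfolding two using h(1) by (intro S.smult_r_null) auto
  finally show ?thesis .
qed

lemma \<theta>_basis_perm:
  assumes \<pi>: "\<pi> permutes I"
  shows "\<theta> (basis_tensor (t \<circ> \<pi>)) = (perm_sign \<pi> \<odot>\<^bsub>A\<^esub> \<delta> \<one>\<^bsub>C\<^esub>) \<odot>\<^bsub>S\<^esub> \<theta> (basis_tensor t)"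
proof -
  have "basis_tensor (t \<circ> \<pi>) = perm_sign \<pi> \<odot>\<^bsub>T\<^esub> perm_op K C n \<pi> (basis_tensor t)"
    by (simp add: perm_op_basis[OF \<pi>] T.smult_assoc1[symmetric] perm_sign_square)
  moreover have "perm_op K C n \<pi> (basis_tensor t) \<in> carrier T"
    using module_hom_closed[OF perm_op_hom[OF \<pi>]] basis_tensor_closed by blast
  ultimately show ?thesis
    using \<theta>_perm[OF \<pi> basis_tensor_closed[of t]] by (simp add: \<theta>_scale)
qed

abbreviation reps where "reps \<equiv> product_one_subsets C (n + 1)"

text \<open>An arbitrary enumeration: a different one would only change the sign of the image of its tensor under
\<open>\<theta>\<close>.\<close>
definition enum :: "'g set \<Rightarrow> nat \<Rightarrow> 'g" where
  "enum X = (SOME t. bij_betw t I X)"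

definition basis_vector :: "'g set \<Rightarrow> (((nat \<Rightarrow> 'g \<Rightarrow> 'a) \<Rightarrow> 'a) set \<times> 'a \<Rightarrow> int) set" where
  "basis_vector X = \<theta> (basis_tensor (enum X))"

lemma subset_repsD:
  assumes "X \<in> reps"
  shows "X \<subseteq> carrier C" "finite X" "card X = n + 1"
  using assms finite_subset[OF _ finite_C] by (auto simp: product_one_subsets_def subsets_of_card_def)

lemma finite_reps: "finite reps"
  by (rule finite_subset[of _ "Pow (carrier C)"]) (use subset_repsD finite_C in auto)

lemma enum_bij: "X \<in> reps \<Longrightarrow> bij_betw (enum X) I X"
  unfolding enum_def
  using ex_bij_betw_nat_finite_1[OF subset_repsD(2)] subset_repsD(3)
  by (metis (mono_tags, lifting) someI_ex)

lemma enum_closed: "X \<in> reps \<Longrightarrow> enum X \<in> I \<rightarrow> carrier C"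
  using bij_betwE[OF enum_bij] subset_repsD(1) by blast

lemma basis_vector_closed: "basis_vector X \<in> carrier S"
  by (simp add: basis_vector_def)

lemma translate_inj_on: "g \<in> carrier C \<Longrightarrow> inj_on (\<lambda>x. g \<otimes>\<^bsub>C\<^esub> x) (carrier C)"
  by (auto simp: inj_on_def)

text \<open>The tensors whose image lies in the span form a \<open>K\<close>-submodule, so tensors of group elements \<open>t\<close>
suffice. For injective \<open>t\<close> the set of its values is a translate \<open>gX\<close> of a representative, and \<open>t\<close>
differs from the translated enumeration of \<open>X\<close> by a permutation.\<close>

lemma basis_vector_generates:
  "carrier S \<subseteq> LinearCombinations.module.span A S (basis_vector ` reps)" (is "_ \<subseteq> ?W")
proof -
  have uS: "basis_vector ` reps \<subseteq> carrier S" using basis_vector_closed by auto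
  have W: "LinearCombinations.submodule A ?W S" by (rule S.span_is_submodule[OF uS])
  have uW: "basis_vector X \<in> ?W" if "X \<in> reps" for X
    using S.in_own_span[OF uS] that by blast
  have scale: "\<theta> (c \<odot>\<^bsub>T\<^esub> x) \<in> ?W" if "c \<in> carrier K" "x \<in> carrier T" "\<theta> x \<in> ?W" for c x
    unfolding \<theta>_scale[OF that(1,2)] using that by (intro submodule.smult_closed[OF W]) auto
  have sub: "LinearCombinations.submodule K {x \<in> carrier T. \<theta> x \<in> ?W} T"
    by (rule submodule.intro)
       (use scale in \<open>auto simp: T.module_axioms \<theta>_add \<theta>_zero submodule.m_closed[OF W] submodule.zero_closed[OF W]\<close>)
  have "carrier T \<subseteq> {x \<in> carrier T. \<theta> x \<in> ?W}"
  proof (rule T_generated[OF sub])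
    fix t assume t: "t \<in> I \<rightarrow> carrier C"
    have "\<theta> (basis_tensor t) \<in> ?W"
    proof (cases "inj_on t I")
      case False
      then show ?thesis using submodule.zero_closed[OF W] by (simp add: \<theta>_basis_repeated)
    next
      case True
      have "t ` I \<in> subsets_of_card C (n + 1)"
        using t True by (auto simp: subsets_of_card_def card_image)
      then have "t ` I \<in> (\<lambda>(g, X). (\<lambda>x. g \<otimes>\<^bsub>C\<^esub> x) ` X) ` (carrier C \<times> reps)"
        by (simp only: bij_betw_imp_surj_on[OF C.translate_bij_betw[OF finite_C coprime nontrivial]])
      then obtain q where q: "q \<in> carrier C \<times> reps" "t ` I = (\<lambda>(g, X). (\<lambda>x. g \<otimes>\<^bsub>C\<^esub> x) ` X) q"
        by (rule imageE)
      obtain g X where gX: "q = (g, X)" by (cases q)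
      have g: "g \<in> carrier C" and X: "X \<in> reps" and tX: "t ` I = (\<lambda>x. g \<otimes>\<^bsub>C\<^esub> x) ` X"
        using q by (simp_all add: gX)
      have "bij_betw (\<lambda>x. g \<otimes>\<^bsub>C\<^esub> x) X (t ` I)"
        unfolding bij_betw_def using tX inj_on_subset[OF translate_inj_on[OF g] subset_repsD(1)[OF X]] by simp
      then have 1: "bij_betw ((\<lambda>x. g \<otimes>\<^bsub>C\<^esub> x) \<circ> enum X) I (t ` I)"
        by (rule bij_betw_trans[OF enum_bij[OF X]])
      have 2: "bij_betw t I (t ` I)" using True by (simp add: bij_betw_def)
      obtain \<pi> where \<pi>: "\<pi> permutes I" "\<And>i. i \<in> I \<Longrightarrow> t i = ((\<lambda>x. g \<otimes>\<^bsub>C\<^esub> x) \<circ> enum X) (\<pi> i)"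
        using bij_betw_eq_comp_permutation[OF 1 2] by metis
      have "enum X \<circ> \<pi> \<in> I \<rightarrow> carrier C"
        using enum_closed[OF X] permutes_in_image[OF \<pi>(1)] by auto
      then have "basis_tensor t = diag.act (\<delta> g) (basis_tensor (enum X \<circ> \<pi>))"
        using \<pi>(2) g by (auto simp: diag.act_basis diag_op_basis intro!: basis_tensor_cong)
      then have "\<theta> (basis_tensor t) = \<delta> g \<odot>\<^bsub>S\<^esub> ((perm_sign \<pi> \<odot>\<^bsub>A\<^esub> \<delta> \<one>\<^bsub>C\<^esub>) \<odot>\<^bsub>S\<^esub> basis_vector X)"
        by (simp add: \<theta>_act \<theta>_basis_perm[OF \<pi>(1)] basis_vector_def)
      also have "\<dots> \<in> ?W"
        using uW[OF X] by (intro submodule.smult_closed[OF W]) auto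
      finally show ?thesis .
    qed
    then show "basis_tensor t \<in> {x \<in> carrier T. \<theta> x \<in> ?W}" by simp
  qed
  then show ?thesis unfolding \<theta>_surj[symmetric] by blast
qed

lemma finsum_T_tilde: "finsum (T_tilde K C n) f X = finsum T f X"
  by (simp add: finsum_def finprod_def T_tilde_simps)

text \<open>The coefficient of \<open>h\<close> in \<open>a Y\<close> is read off by the minor for the translate \<open>hY\<close>. It vanishes on all
other translates \<open>gX\<close>, because these are different sets.\<close>

lemma basis_vector_independent:
  assumes a: "\<And>X. X \<in> reps \<Longrightarrow> a X \<in> carrier A"
    and zero: "(\<Oplus>\<^bsub>S\<^esub>X\<in>reps. a X \<odot>\<^bsub>S\<^esub> basis_vector X) = \<zero>\<^bsub>S\<^esub>"
    and Y: "Y \<in> reps" and h: "h \<in> carrier C"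
  shows "a Y h = \<zero>\<^bsub>K\<^esub>"
proof -
  define t where "t i = h \<otimes>\<^bsub>C\<^esub> enum Y i" for i
  have tc: "t \<in> I \<rightarrow> carrier C" using enum_closed[OF Y] h by (auto simp: t_def Pi_iff)
  have img: "(\<lambda>i. g \<otimes>\<^bsub>C\<^esub> enum X i) ` I = (\<lambda>x. g \<otimes>\<^bsub>C\<^esub> x) ` X" if "X \<in> reps" for X g
    using bij_betw_imp_surj_on[OF enum_bij[OF that]] by (metis image_image)
  have inj: "inj_on t I"
    using bij_betw_imp_inj_on[OF enum_bij[OF Y]] enum_closed[OF Y] h by (auto simp: inj_on_def t_def Pi_iff)
  obtain f where f: "f \<in> module_hom K T (self_module K)"
    and fb: "\<And>s. f (basis_tensor s) = matching_sum t s"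
    and fperm: "\<And>\<pi> x. \<pi> permutes I \<Longrightarrow> x \<in> carrier T \<Longrightarrow> f (perm_op K C n \<pi> x) = f x"
    using alternating_functional[OF tc] by blast
  have pair: "f (diag_op K C n g (basis_tensor (enum X))) = (if h = g \<and> Y = X then \<one>\<^bsub>K\<^esub> else \<zero>\<^bsub>K\<^esub>)"
    if X: "X \<in> reps" and g: "g \<in> carrier C" for X g
  proof (cases "h = g \<and> Y = X")
    case True
    then show ?thesis
      using matching_sum_self[OF inj] by (simp add: diag_op_basis[OF g enum_closed[OF X]] fb t_def)
  next
    case False
    then have "(\<lambda>x. g \<otimes>\<^bsub>C\<^esub> x) ` X \<noteq> (\<lambda>x. h \<otimes>\<^bsub>C\<^esub> x) ` Y"
      using inj_onD[OF bij_betw_imp_inj_on[OF C.translate_bij_betw[OF finite_C coprime nontrivial]],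
          of "(g, X)" "(h, Y)"] X Y g h by (simp, metis)
    then have "matching_sum t (\<lambda>i. g \<otimes>\<^bsub>C\<^esub> enum X i) = \<zero>\<^bsub>K\<^esub>"
      using img[OF X, of g] img[OF Y, of h] by (intro matching_sum_zero) (auto simp: t_def)
    with False show ?thesis
      by (auto simp: diag_op_basis[OF g enum_closed[OF X]] fb)
  qed
  define x where "x = (\<Oplus>\<^bsub>T\<^esub>X\<in>reps. diag.act (a X) (basis_tensor (enum X)))"
  have ac: "diag.act (a X) (basis_tensor (enum X)) \<in> carrier T" if "X \<in> reps" for X
    using a[OF that] by (intro diag.act_closed) auto
  have xT: "x \<in> carrier T"
    unfolding x_def using ac by (intro T.finsum_closed) auto
  have "\<theta> x = (\<Oplus>\<^bsub>S\<^esub>X\<in>reps. \<theta> (diag.act (a X) (basis_tensor (enum X))))"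
    unfolding x_def finsum_T_tilde[symmetric]
    by (rule module_hom_finsum[OF T_tilde_module S_module \<theta>_hom finite_reps]) (use ac in \<open>auto simp: T_tilde_simps\<close>)
  also have "\<dots> = (\<Oplus>\<^bsub>S\<^esub>X\<in>reps. a X \<odot>\<^bsub>S\<^esub> basis_vector X)"
    by (rule S.finsum_cong') (use a basis_vector_closed in \<open>auto simp: \<theta>_act basis_vector_def\<close>)
  finally have "\<theta> x = \<zero>\<^bsub>S\<^esub>" by (simp add: zero)
  then have "\<zero>\<^bsub>K\<^esub> = f x"
    using \<theta>_kernel[OF f fperm xT] by simp
  also have "f x = (\<Oplus>\<^bsub>K\<^esub>X\<in>reps. f (diag.act (a X) (basis_tensor (enum X))))"
    unfolding x_def finsum_self_module[of K, symmetric]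
    by (rule module_hom_finsum[OF T.module_axioms self_module[OF K.is_cring] f finite_reps]) (use ac in auto)
  also have "\<dots> = (\<Oplus>\<^bsub>K\<^esub>X\<in>reps. if Y = X then a X h else \<zero>\<^bsub>K\<^esub>)"
  proof (rule K.finsum_cong'[OF refl])
    fix X assume X: "X \<in> reps"
    have "f (diag.act (a X) (basis_tensor (enum X))) =
        (\<Oplus>\<^bsub>K\<^esub>g\<in>carrier C. a X g \<otimes>\<^bsub>K\<^esub> f (diag_op K C n g (basis_tensor (enum X))))"
      using diag.hom_act[OF self_module[OF K.is_cring] f a[OF X] basis_tensor_closed]
      by (simp add: finsum_self_module)
    also have "\<dots> = (\<Oplus>\<^bsub>K\<^esub>g\<in>carrier C. if h = g then (if Y = X then a X g else \<zero>\<^bsub>K\<^esub>) else \<zero>\<^bsub>K\<^esub>)"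
      by (rule K.finsum_cong') (use pair[OF X] A_eval_closed[OF a[OF X]] in auto)
    also have "\<dots> = (if Y = X then a X h else \<zero>\<^bsub>K\<^esub>)"
      by (rule K.finsum_singleton[OF h finite_C]) (use A_eval_closed[OF a[OF X]] in auto)
    finally show "f (diag.act (a X) (basis_tensor (enum X))) = (if Y = X then a X h else \<zero>\<^bsub>K\<^esub>)" .
  qed (use A_eval_closed[OF a] h in auto)
  also have "\<dots> = a Y h"
    by (rule K.finsum_singleton[OF Y finite_reps]) (use A_eval_closed[OF a] h in auto)
  finally show ?thesis ..
qed

lemma A_eq_zeroI: "x \<in> carrier A \<Longrightarrow> (\<And>g. g \<in> carrier C \<Longrightarrow> x g = \<zero>\<^bsub>K\<^esub>) \<Longrightarrow> x = \<zero>\<^bsub>A\<^esub>"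
  by (rule PiE_ext[of _ "carrier C" "\<lambda>_. carrier K"]) (simp_all add: group_algebra_def free_module_def)

lemma basis_vector_inj: "inj_on basis_vector reps"
proof (rule inj_onI, rule ccontr)
  fix X Y assume X: "X \<in> reps" and Y: "Y \<in> reps" and eq: "basis_vector X = basis_vector Y" and ne: "X \<noteq> Y"
  \<comment> \<open>Two equal vectors would satisfy the relation with coefficients \<open>1\<close> and \<open>-1\<close>.\<close>
  define a where "a Z = (if Z = X then \<one>\<^bsub>A\<^esub> else if Z = Y then \<ominus>\<^bsub>A\<^esub> \<one>\<^bsub>A\<^esub> else \<zero>\<^bsub>A\<^esub>)" for Z
  have aA: "a Z \<in> carrier A" for Z by (simp add: a_def)
  have aZ: "a Z \<odot>\<^bsub>S\<^esub> basis_vector Z = \<zero>\<^bsub>S\<^esub>" if "Z \<in> reps - {X} - {Y}" for Z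
    using that basis_vector_closed by (simp add: a_def)
  have aX: "a X \<odot>\<^bsub>S\<^esub> basis_vector X = basis_vector Y"
    using basis_vector_closed[of Y] by (simp add: a_def eq)
  have aY: "a Y \<odot>\<^bsub>S\<^esub> basis_vector Y = \<ominus>\<^bsub>S\<^esub> basis_vector Y"
    using S.smult_l_minus[OF _ basis_vector_closed, of "\<one>\<^bsub>A\<^esub>" Y] basis_vector_closed[of Y] ne by (simp add: a_def)
  have "(\<Oplus>\<^bsub>S\<^esub>Z\<in>reps. a Z \<odot>\<^bsub>S\<^esub> basis_vector Z) = a X \<odot>\<^bsub>S\<^esub> basis_vector X \<oplus>\<^bsub>S\<^esub> (\<Oplus>\<^bsub>S\<^esub>Z\<in>reps - {X}. a Z \<odot>\<^bsub>S\<^esub> basis_vector Z)"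
    using aA basis_vector_closed by (intro S.M.add.finprod_split) (use X finite_reps in auto)
  also have "(\<Oplus>\<^bsub>S\<^esub>Z\<in>reps - {X}. a Z \<odot>\<^bsub>S\<^esub> basis_vector Z) = a Y \<odot>\<^bsub>S\<^esub> basis_vector Y \<oplus>\<^bsub>S\<^esub> (\<Oplus>\<^bsub>S\<^esub>Z\<in>reps - {X} - {Y}. a Z \<odot>\<^bsub>S\<^esub> basis_vector Z)"
    using aA basis_vector_closed by (intro S.M.add.finprod_split) (use X Y ne finite_reps in auto)
  also have "(\<Oplus>\<^bsub>S\<^esub>Z\<in>reps - {X} - {Y}. a Z \<odot>\<^bsub>S\<^esub> basis_vector Z) = \<zero>\<^bsub>S\<^esub>"
    by (rule S.M.add.finprod_one_eqI) (rule aZ)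
  finally have "(\<Oplus>\<^bsub>S\<^esub>Z\<in>reps. a Z \<odot>\<^bsub>S\<^esub> basis_vector Z) = \<zero>\<^bsub>S\<^esub>"
    using aX aY basis_vector_closed[of Y] by (simp only: S.M.r_zero S.M.r_neg S.M.a_inv_closed)
  from basis_vector_independent[OF aA this X C.one_closed] have "\<one>\<^bsub>K\<^esub> = \<zero>\<^bsub>K\<^esub>"
    by (simp add: a_def group_algebra_def basis_elem_def)
  then show False by simp
qed

text \<open>The rank is the number of translation orbits on subsets of size \<open>n + 1\<close>.\<close>

theorem S_tilde_free: "free_of_rank A S (card reps)"
  unfolding free_of_rank_def
proof (intro conjI exI[of _ "basis_vector ` reps"])
  have uS: "basis_vector ` reps \<subseteq> carrier S" using basis_vector_closed by auto
  show "module A S" by (rule S_module)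
  show fin: "finite (basis_vector ` reps)" using finite_reps by simp
  show "card (basis_vector ` reps) = card reps" by (rule card_image[OF basis_vector_inj])
  show "basis_vector ` reps \<subseteq> carrier S" by (rule uS)
  show "LinearCombinations.module.span A S (basis_vector ` reps) = carrier S"
    using basis_vector_generates S.span_is_subset2[OF uS] by blast
  show "\<not> LinearCombinations.module.lin_dep A S (basis_vector ` reps)"
  proof (rule S.finite_lin_indpt2[OF fin uS], intro ballI)
    fix a v assume a: "a \<in> basis_vector ` reps \<rightarrow> carrier A" and zero: "S.lincomb a (basis_vector ` reps) = \<zero>\<^bsub>S\<^esub>"
      and "v \<in> basis_vector ` reps"
    then obtain Y where Y: "Y \<in> reps" "v = basis_vector Y" by blast
    have aA: "a (basis_vector X) \<in> carrier A" if "X \<in> reps" for X using a that by blast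
    have "S.lincomb a (basis_vector ` reps) = (\<Oplus>\<^bsub>S\<^esub>X\<in>reps. a (basis_vector X) \<odot>\<^bsub>S\<^esub> basis_vector X)"
      unfolding S.lincomb_def by (rule S.finsum_reindex[OF _ basis_vector_inj]) (use aA basis_vector_closed in auto)
    with zero have "(\<Oplus>\<^bsub>S\<^esub>X\<in>reps. a (basis_vector X) \<odot>\<^bsub>S\<^esub> basis_vector X) = \<zero>\<^bsub>S\<^esub>" by simp
    from basis_vector_independent[of "\<lambda>X. a (basis_vector X)", OF aA this Y(1)] show "a v = \<zero>\<^bsub>A\<^esub>"
      using aA[OF Y(1)] Y(2) by (intro A_eq_zeroI) auto
  qed
qed

end

theorem proposition4p11:
  fixes K :: "('a, 'k) ring_scheme" and C :: "('g, 'l) monoid_scheme" and p n :: nat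
  assumes "prime p" and "odd p"
    and "field K" and "ring_characteristic K = p"
    and "group C" and "cyclic_group C" and "order C = p"
    and "1 \<le> n" and "n \<le> p - 2"
  shows "\<exists>r. real r = 1 / real p * real (p choose (n + 1)) \<and>
             free_of_rank (group_algebra K C) (S_tilde K C n) r"
proof -
  interpret C: group C by fact
  have comm: "comm_group C" by (rule C.cyclic_imp_abelian_group) fact
  interpret field K by fact
  have p: "p > 1" using \<open>prime p\<close> by (rule prime_gt_1_nat)
  have fin: "finite (carrier C)"
    by (rule ccontr) (use \<open>order C = p\<close> p in \<open>simp add: order_def\<close>)
  have "\<not> p dvd n + 1"
    using \<open>n \<le> p - 2\<close> p by (auto dest: dvd_imp_le)
  then have cop: "coprime (n + 1) p"
    using \<open>prime p\<close> prime_imp_coprime coprime_commute by blast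
  interpret C: comm_group C by (rule comm)
  interpret exterior_power K C n
    by unfold_locales
      (use fin cop p odd_characteristic_two_nonzero[OF assms(4,3,1,2)] \<open>order C = p\<close> in auto)
  have "p * card (product_one_subsets C (n + 1)) = p choose (n + 1)"
    using C.card_product_one_subsets[OF fin coprime nontrivial] \<open>order C = p\<close> by simp
  then have "real p * real (card (product_one_subsets C (n + 1))) = real (p choose (n + 1))"
    by (metis of_nat_mult)
  then have "real (card (product_one_subsets C (n + 1))) = 1 / real p * real (p choose (n + 1))"
    using p by (simp add: field_simps)
  with S_tilde_free show ?thesis by blast
qed

end
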